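(* Let $(S,\mathbb C)$ be a relative Sierpiński carpet (i.e. with $\Omega=\mathbb C$), and $u:S\to\mathbb R$ a (normalized) carpet-harmonic function such that $|u|$ is bounded. Then $u$ is constant.
   Context: Relative Sierpiński carpets. Let $\Omega\subset\mathbb C$ be a connected open set and $\{Q_i\}_{i\in\mathbb N}$ open Jordan regions compactly contained in $\Omega$, with pairwise disjoint closures, such that $S:=\Omega\setminus\bigcup_iQ_i$ has empty interior and is locally connected. Then $(S,\Omega)$ is a relative Sierpiński carpet with peripheral disks $Q_i$. Standing assumptions on every relative Sierpiński carpet: (i) $\mathcal H^2(S)=0$; (ii) there is $K_0\ge1$ such that for each $i$ there are concentric balls $B(x,r)\subset Q_i\subset B(x,R)$ with $R/r\le K_0$; (iii) there is $K_1>0$ such that $\mathcal H^2(B(x,r)\cap Q_i)\ge K_1r^2$ for all $i$, $x\in Q_i$, $0<r<\operatorname{diam}(Q_i)$. $\mathcal H^m$ is Hausdorff measure normalized to agree with Lebesgue measure. Notation. $\widehat{\mathbb R}=\mathbb R\cup\{\pm\infty\}$. $V\subset\subset\Omega$: $\overline V$ is compact and contained in $\Omega$. $I_V=\{i:Q_i\cap V\ne\emptyset\}$. $S^\circ$: points of $S$ on no $\partial Q_i$. A path is a continuous map from a bounded interval to $\mathbb C$ with a continuous extension to the closed interval (also its image); it is open if the interval is open; subpaths are restrictions to subintervals. For $g:S\to\widehat{\mathbb R}$: $M_{Q_i}(g)=\sup_{\partial Q_i}g$, $m_{Q_i}(g)=\inf_{\partial Q_i}g$, $\operatorname{osc}_{Q_i}(g)=M_{Q_i}(g)-m_{Q_i}(g)$.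 Moduli of a path family $\Gamma$ in $\Omega$. $\mathrm{mod}_2(\Gamma)=\inf\int\lambda^2d\mathcal H^2$ over Borel $\lambda\ge0$ with $\int_\gamma\lambda\,ds\ge1$ for all $\gamma\in\Gamma$ (with $\int_\gamma\lambda\,ds:=\infty$ if $\gamma$ is not locally rectifiable). Weak modulus $\mathrm{mod}_w(\Gamma)=\inf\sum_i\rho(Q_i)^2$ over non-negative sequences for which there is $\Gamma_0\subset\Gamma$ with $\mathrm{mod}_2(\Gamma_0)=0$ and $\sum_{i:Q_i\cap\gamma\ne\emptyset}\rho(Q_i)\ge1$ for $\gamma\in\Gamma\setminus\Gamma_0$. Strong modulus $\mathrm{mod}_s(\Gamma)$: the same infimum over sequences satisfying this inequality for all $\gamma\in\Gamma$ with $\mathcal H^1(\gamma\cap S)=0$. Sobolev spaces. $\{\rho(Q_i)\}$ is a weak (strong) upper gradient of $g:S\to\widehat{\mathbb R}$ if there is $\Gamma_0$ with $\mathrm{mod}_w(\Gamma_0)=0$ ($\mathrm{mod}_s(\Gamma_0)=0$) such that for all paths $\gamma\subset\Omega$, $\gamma\notin\Gamma_0$, and $x,y\in\gamma\cap S$: $g(x),g(y)\neq\pm\infty$ and $|g(x)-g(y)|\le\sum_{i:Q_i\cap\gamma\ne\emptyset}\rho(Q_i)$. $g\in\mathcal W^{1,2}_{\mathrm{loc}}(S)$ if $M_{Q_i}(g),m_{Q_i}(g)$ are finite for all $i$, $\sum_{i\in I_B}M_{Q_i}(g)^2\operatorname{diam}(Q_i)^2<\infty$ and $\sum_{i\in I_B}\operatorname{osc}_{Q_i}(g)^2<\infty$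 for every ball $B\subset\subset\Omega$, and $\{\operatorname{osc}_{Q_i}(g)\}$ is an upper gradient of $g$; $g\in\mathcal W^{1,2}(S)$ if moreover the sums over all $i\in\mathbb N$ are finite. There is a weak and a strong version; the statement holds for each, with one version fixed throughout. Dirichlet energy: $D_V(g)=\sum_{i\in I_V}\operatorname{osc}_{Q_i}(g)^2$. $u\in\mathcal W^{1,2}_{\mathrm{loc}}(S)$ is carpet-harmonic if $D_V(u)\le D_V(u+\zeta)$ for every open $V\subset\subset\Omega$ and $\zeta\in\mathcal W^{1,2}(S)$ with $\zeta|_{S\setminus V}\equiv0$. Normalized functions. For $g\in\mathcal W^{1,2}_{\mathrm{loc}}(S)$ let $\hat g(Q_i)=M_{Q_i}(g)$. Let $\mathcal G_{\hat g}$ be the family of non-constant paths $\gamma\subset\Omega$ with: $\mathcal H^1(\gamma\cap S)=0$; for every subpath $\gamma'$ of $\gamma$ and $Q_{i_1},Q_{i_2}$ meeting $\gamma'$, $|\hat g(Q_{i_1})-\hat g(Q_{i_2})|\le\sum_{i:Q_i\cap\gamma'\neq\emptyset}\operatorname{osc}_{Q_i}(g)$; $\sum_{i:Q_i\cap\gamma'\ne\emptyset}\operatorname{osc}_{Q_i}(g)<\infty$ for subpaths $\gamma'\subset\subset\Omega$; and, if $\sum_{i\in\mathbb N}\operatorname{osc}_{Q_i}(g)^2<\infty$, also $\sum_{i:Q_i\cap\gamma\ne\emptyset}\operatorname{osc}_{Q_i}(g)<\infty$. A point $x\in S$ is accessible by $\gamma_0$ if $x\in\gamma_0\cap S^\circ$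 (put $\gamma=\gamma_0$), or there is an open subpath $\gamma$ of $\gamma_0$ with $x\in\overline\gamma\setminus\gamma$ and $\gamma\cap Q_{i_0}=\emptyset$ whenever $x\in\partial Q_{i_0}$. The normalized version $\tilde g$ of $g$ is: $\tilde g(x)=\liminf_{Q_i\to x,\,Q_i\cap\gamma\ne\emptyset}\hat g(Q_i)$ if $x$ is accessible by a path $\gamma_0\in\mathcal G_{\hat g}$, where $\gamma=\gamma_0$ if $x\in\gamma_0\cap S^\circ$, and otherwise $\gamma$ is an open subpath of $\gamma_0$ with $x\in\overline\gamma\setminus\gamma$ and $\gamma\cap Q_{i_0}=\emptyset$ whenever $x\in\partial Q_{i_0}$ (the value is independent of $\gamma$); for non-accessible $x\in\partial Q_{i_0}$, $\tilde g(x)=\liminf\tilde g(y)$ as $y\to x$ through accessible $y\in\partial Q_{i_0}$; for all other $x$, $\tilde g(x)=\liminf\tilde g(y)$ as $y\to x$ through accessible $y$. A function is normalized if it equals the normalized version of some function in the Sobolev space. Standing convention: carpet-harmonic functions are normalized. *)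

theory Defs
  imports "HOL-Analysis.Analysis"
begin

section \<open>Hausdorff measure\<close>

text \<open>
  The \<open>m\<close>-dimensional Hausdorff (outer) measure for \<open>m \<ge> 1\<close>, with the constant that makes it agree
  with Lebesgue measure on \<open>m\<close>-dimensional space. Boundedness of the covering sets is required
  because \<^const>\<open>diameter\<close> is meaningless on unbounded sets. Only \<open>m = 1\<close> is used below:
  with this normalization, two-dimensional Hausdorff measure on the Borel sets of the plane is
  Lebesgue measure, written \<^const>\<open>lborel\<close>.
\<close>

definition hausdorff_measure :: "nat \<Rightarrow> 'a::metric_space set \<Rightarrow> ennreal" where
  "hausdorff_measure m E =
     (SUP \<delta>\<in>{0<..}.
        INF A\<in>{A :: nat \<Rightarrow> 'a set. E \<subseteq> (\<Union>j. A j) \<and> (\<forall>j. bounded (A j) \<and> diameter (A j) \<le> \<delta>)}.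
          \<Sum>j. ennreal (unit_ball_vol (real m) * (diameter (A j) / 2) ^ m))"

section \<open>Relative Sierpinski carpets\<close>

definition compactly_contained :: "complex set \<Rightarrow> complex set \<Rightarrow> bool" where
  "compactly_contained V \<Omega> \<longleftrightarrow> compact (closure V) \<and> closure V \<subseteq> \<Omega>"

definition open_jordan_region :: "complex set \<Rightarrow> bool" where
  "open_jordan_region U \<longleftrightarrow>
     (\<exists>c. simple_path c \<and> pathfinish c = pathstart c \<and> U = inside (path_image c))"

definition carpet :: "complex set \<Rightarrow> (nat \<Rightarrow> complex set) \<Rightarrow> complex set" where
  "carpet \<Omega> Q = \<Omega> - (\<Union>i. Q i)"

text \<open>The last three conjuncts are the standing assumptions on area, quasiroundness and fatness.\<close>

definition relative_sierpinski_carpet :: "complex set \<Rightarrow> (nat \<Rightarrow> complex set) \<Rightarrow> bool" where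
  "relative_sierpinski_carpet \<Omega> Q \<longleftrightarrow>
     open \<Omega> \<and> connected \<Omega> \<and>
     (\<forall>i. open_jordan_region (Q i) \<and> compactly_contained (Q i) \<Omega>) \<and>
     (\<forall>i j. i \<noteq> j \<longrightarrow> closure (Q i) \<inter> closure (Q j) = {}) \<and>
     interior (carpet \<Omega> Q) = {} \<and>
     locally connected (carpet \<Omega> Q) \<and>
     emeasure lborel (carpet \<Omega> Q) = 0 \<and>
     (\<exists>K0\<ge>1. \<forall>i. \<exists>x r R. 0 < r \<and> R / r \<le> K0 \<and> ball x r \<subseteq> Q i \<and> Q i \<subseteq> ball x R) \<and>
     (\<exists>K1>0. \<forall>i. \<forall>x\<in>Q i. \<forall>r. 0 < r \<and> r < diameter (Q i) \<longrightarrow>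
        emeasure lborel (ball x r \<inter> Q i) \<ge> ennreal (K1 * r\<^sup>2))"

definition carpet_interior :: "complex set \<Rightarrow> (nat \<Rightarrow> complex set) \<Rightarrow> complex set" where
  "carpet_interior \<Omega> Q = {x \<in> carpet \<Omega> Q. \<forall>i. x \<notin> frontier (Q i)}"

definition disks_meeting :: "(nat \<Rightarrow> complex set) \<Rightarrow> complex set \<Rightarrow> nat set" where
  "disks_meeting Q V = {i. Q i \<inter> V \<noteq> {}}"

section \<open>Paths\<close>

text \<open>
  A path is a pair of an interval and a function, of which only the values on the interval matter.
  The library's \<^const>\<open>path\<close> is always parametrized by the closed unit interval, whereas here
  the interval may be open, half-open, closed, or a single point.
\<close>

type_synonym cpath = "real set \<times> (real \<Rightarrow> complex)"

definition trace :: "cpath \<Rightarrow> complex set" where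
  "trace \<gamma> = snd \<gamma> ` fst \<gamma>"

definition is_cpath :: "cpath \<Rightarrow> bool" where
  "is_cpath \<gamma> \<longleftrightarrow>
     is_interval (fst \<gamma>) \<and> bounded (fst \<gamma>) \<and> fst \<gamma> \<noteq> {} \<and>
     (\<exists>h. continuous_on (closure (fst \<gamma>)) h \<and> (\<forall>t\<in>fst \<gamma>. h t = snd \<gamma> t))"

definition open_cpath :: "cpath \<Rightarrow> bool" where
  "open_cpath \<gamma> \<longleftrightarrow> is_cpath \<gamma> \<and> open (fst \<gamma>)"

definition is_subpath :: "cpath \<Rightarrow> cpath \<Rightarrow> bool" where
  "is_subpath \<gamma>' \<gamma> \<longleftrightarrow>
     is_interval (fst \<gamma>') \<and> fst \<gamma>' \<noteq> {} \<and> fst \<gamma>' \<subseteq> fst \<gamma> \<and> snd \<gamma>' = snd \<gamma>"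

definition paths_in :: "complex set \<Rightarrow> cpath set" where
  "paths_in \<Omega> = {\<gamma>. is_cpath \<gamma> \<and> trace \<gamma> \<subseteq> \<Omega>}"

definition path_length :: "(real \<Rightarrow> complex) \<Rightarrow> real \<Rightarrow> real \<Rightarrow> ennreal" where
  "path_length f a b =
     (SUP (n, t)\<in>{(n :: nat, t :: nat \<Rightarrow> real). mono_on {..n} t \<and> t ` {..n} \<subseteq> {a..b}}.
        \<Sum>k<n. ennreal (dist (f (t k)) (f (t (Suc k)))))"

text \<open>
  The arc-length parametrization does not depend on the chosen parameter \<open>t\<close>, since \<open>f\<close> is
  constant on any interval on which the length function is constant.
\<close>

definition arclength_param :: "(real \<Rightarrow> complex) \<Rightarrow> real \<Rightarrow> real \<Rightarrow> real \<Rightarrow> complex" where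
  "arclength_param f a b s = f (SOME t. t \<in> {a..b} \<and> path_length f a t = ennreal s)"

definition rectifiable_line_integral ::
    "(complex \<Rightarrow> ennreal) \<Rightarrow> (real \<Rightarrow> complex) \<Rightarrow> real \<Rightarrow> real \<Rightarrow> ennreal" where
  "rectifiable_line_integral l f a b =
     (\<integral>\<^sup>+s. l (arclength_param f a b s) * indicator {0..enn2real (path_length f a b)} s \<partial>lborel)"

definition locally_rectifiable :: "cpath \<Rightarrow> bool" where
  "locally_rectifiable \<gamma> \<longleftrightarrow>
     (\<forall>a\<in>fst \<gamma>. \<forall>b\<in>fst \<gamma>. a \<le> b \<longrightarrow> path_length (snd \<gamma>) a b < \<infinity>)"

definition line_integral :: "(complex \<Rightarrow> ennreal) \<Rightarrow> cpath \<Rightarrow> ennreal" where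
  "line_integral l \<gamma> =
     (if locally_rectifiable \<gamma>
      then SUP (a, b)\<in>{(a, b). a \<in> fst \<gamma> \<and> b \<in> fst \<gamma> \<and> a \<le> b}.
             rectifiable_line_integral l (snd \<gamma>) a b
      else \<infinity>)"

section \<open>Moduli\<close>

definition mod2 :: "cpath set \<Rightarrow> ennreal" where
  "mod2 \<Gamma> =
     (INF l\<in>{l :: complex \<Rightarrow> ennreal. l \<in> borel_measurable borel \<and> (\<forall>\<gamma>\<in>\<Gamma>. line_integral l \<gamma> \<ge> 1)}.
        \<integral>\<^sup>+x. (l x)\<^sup>2 \<partial>lborel)"

definition path_sum :: "(nat \<Rightarrow> complex set) \<Rightarrow> (nat \<Rightarrow> real) \<Rightarrow> cpath \<Rightarrow> ennreal" where
  "path_sum Q \<rho> \<gamma> = (\<Sum>\<^sub>\<infinity>i\<in>disks_meeting Q (trace \<gamma>). ennreal (\<rho> i))"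

definition weak_modulus :: "(nat \<Rightarrow> complex set) \<Rightarrow> cpath set \<Rightarrow> ennreal" where
  "weak_modulus Q \<Gamma> =
     (INF \<rho>\<in>{\<rho> :: nat \<Rightarrow> real. (\<forall>i. \<rho> i \<ge> 0) \<and>
              (\<exists>\<Gamma>0\<subseteq>\<Gamma>. mod2 \<Gamma>0 = 0 \<and> (\<forall>\<gamma>\<in>\<Gamma> - \<Gamma>0. path_sum Q \<rho> \<gamma> \<ge> 1))}.
        \<Sum>i. ennreal ((\<rho> i)\<^sup>2))"

definition strong_modulus ::
    "complex set \<Rightarrow> (nat \<Rightarrow> complex set) \<Rightarrow> cpath set \<Rightarrow> ennreal" where
  "strong_modulus \<Omega> Q \<Gamma> =
     (INF \<rho>\<in>{\<rho> :: nat \<Rightarrow> real. (\<forall>i. \<rho> i \<ge> 0) \<and>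
              (\<forall>\<gamma>\<in>\<Gamma>. hausdorff_measure 1 (trace \<gamma> \<inter> carpet \<Omega> Q) = 0 \<longrightarrow> path_sum Q \<rho> \<gamma> \<ge> 1)}.
        \<Sum>i. ennreal ((\<rho> i)\<^sup>2))"

datatype modulus_version = Weak | Strong

fun carpet_modulus ::
    "modulus_version \<Rightarrow> complex set \<Rightarrow> (nat \<Rightarrow> complex set) \<Rightarrow> cpath set \<Rightarrow> ennreal" where
  "carpet_modulus Weak \<Omega> Q \<Gamma> = weak_modulus Q \<Gamma>"
| "carpet_modulus Strong \<Omega> Q \<Gamma> = strong_modulus \<Omega> Q \<Gamma>"

section \<open>Sobolev spaces\<close>

text \<open>
  A function on the carpet with values in the extended reals is represented by a function on the
  whole plane, of which only the values on the carpet are used. The argument \<open>U\<close> of the next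
  three definitions is a peripheral disk.
\<close>

definition Mdisk :: "(complex \<Rightarrow> ereal) \<Rightarrow> complex set \<Rightarrow> ereal" where
  "Mdisk g U = (SUP x\<in>frontier U. g x)"

definition mdisk :: "(complex \<Rightarrow> ereal) \<Rightarrow> complex set \<Rightarrow> ereal" where
  "mdisk g U = (INF x\<in>frontier U. g x)"

definition osc :: "(complex \<Rightarrow> ereal) \<Rightarrow> complex set \<Rightarrow> ereal" where
  "osc g U = Mdisk g U - mdisk g U"

definition upper_gradient ::
    "modulus_version \<Rightarrow> complex set \<Rightarrow> (nat \<Rightarrow> complex set) \<Rightarrow> (nat \<Rightarrow> real)
      \<Rightarrow> (complex \<Rightarrow> ereal) \<Rightarrow> bool" where
  "upper_gradient v \<Omega> Q \<rho> g \<longleftrightarrow>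
     (\<forall>i. \<rho> i \<ge> 0) \<and>
     (\<exists>\<Gamma>0\<subseteq>paths_in \<Omega>. carpet_modulus v \<Omega> Q \<Gamma>0 = 0 \<and>
        (\<forall>\<gamma>\<in>paths_in \<Omega> - \<Gamma>0. \<forall>x\<in>trace \<gamma> \<inter> carpet \<Omega> Q. \<forall>y\<in>trace \<gamma> \<inter> carpet \<Omega> Q.
           \<bar>g x\<bar> \<noteq> \<infinity> \<and> \<bar>g y\<bar> \<noteq> \<infinity> \<and> \<bar>g x - g y\<bar> \<le> enn2ereal (path_sum Q \<rho> \<gamma>)))"

text \<open>
  \<^const>\<open>real_of_ereal\<close> is harmless below: the first conjunct makes all \<open>M\<close>, \<open>m\<close> and hence all
  oscillations finite. For non-negative real terms \<open>summable_on\<close> says that the sum is finite.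
\<close>

definition W12_loc ::
    "modulus_version \<Rightarrow> complex set \<Rightarrow> (nat \<Rightarrow> complex set) \<Rightarrow> (complex \<Rightarrow> ereal) set" where
  "W12_loc v \<Omega> Q =
     {g. (\<forall>i. \<bar>Mdisk g (Q i)\<bar> \<noteq> \<infinity> \<and> \<bar>mdisk g (Q i)\<bar> \<noteq> \<infinity>) \<and>
         (\<forall>x r. 0 < r \<and> compactly_contained (ball x r) \<Omega> \<longrightarrow>
            (\<lambda>i. (real_of_ereal (Mdisk g (Q i)))\<^sup>2 * (diameter (Q i))\<^sup>2)
               summable_on disks_meeting Q (ball x r) \<and>
            (\<lambda>i. (real_of_ereal (osc g (Q i)))\<^sup>2) summable_on disks_meeting Q (ball x r)) \<and>
         upper_gradient v \<Omega> Q (\<lambda>i. real_of_ereal (osc g (Q i))) g}"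

definition W12 ::
    "modulus_version \<Rightarrow> complex set \<Rightarrow> (nat \<Rightarrow> complex set) \<Rightarrow> (complex \<Rightarrow> ereal) set" where
  "W12 v \<Omega> Q =
     {g \<in> W12_loc v \<Omega> Q.
        (\<lambda>i. (real_of_ereal (Mdisk g (Q i)))\<^sup>2 * (diameter (Q i))\<^sup>2) summable_on UNIV \<and>
        (\<lambda>i. (real_of_ereal (osc g (Q i)))\<^sup>2) summable_on UNIV}"

section \<open>Carpet-harmonic functions\<close>

definition dirichlet_energy ::
    "(nat \<Rightarrow> complex set) \<Rightarrow> complex set \<Rightarrow> (complex \<Rightarrow> ereal) \<Rightarrow> ennreal" where
  "dirichlet_energy Q V g = (\<Sum>\<^sub>\<infinity>i\<in>disks_meeting Q V. (e2ennreal (osc g (Q i)))\<^sup>2)"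

text \<open>
  The oscillations of \<open>u + \<zeta>\<close> only involve values on the boundaries of the peripheral disks, where
  both functions are finite, so the convention for adding opposite infinities plays no role.
\<close>

definition carpet_harmonic ::
    "modulus_version \<Rightarrow> complex set \<Rightarrow> (nat \<Rightarrow> complex set) \<Rightarrow> (complex \<Rightarrow> ereal) \<Rightarrow> bool" where
  "carpet_harmonic v \<Omega> Q u \<longleftrightarrow>
     u \<in> W12_loc v \<Omega> Q \<and>
     (\<forall>V \<zeta>. open V \<and> compactly_contained V \<Omega> \<and> \<zeta> \<in> W12 v \<Omega> Q \<and>
            (\<forall>x\<in>carpet \<Omega> Q - V. \<zeta> x = 0) \<longrightarrow>
        dirichlet_energy Q V u \<le> dirichlet_energy Q V (\<lambda>x. u x + \<zeta> x))"

section \<open>Normalized functions\<close>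

definition good_paths ::
    "complex set \<Rightarrow> (nat \<Rightarrow> complex set) \<Rightarrow> (complex \<Rightarrow> ereal) \<Rightarrow> cpath set" where
  "good_paths \<Omega> Q g =
     {\<gamma> \<in> paths_in \<Omega>.
        \<not> snd \<gamma> constant_on fst \<gamma> \<and>
        hausdorff_measure 1 (trace \<gamma> \<inter> carpet \<Omega> Q) = 0 \<and>
        (\<forall>\<gamma>'. is_subpath \<gamma>' \<gamma> \<longrightarrow>
           (\<forall>i\<in>disks_meeting Q (trace \<gamma>'). \<forall>j\<in>disks_meeting Q (trace \<gamma>').
              \<bar>Mdisk g (Q i) - Mdisk g (Q j)\<bar>
                \<le> enn2ereal (path_sum Q (\<lambda>i. real_of_ereal (osc g (Q i))) \<gamma>'))) \<and>
        (\<forall>\<gamma>'. is_subpath \<gamma>' \<gamma> \<and> compactly_contained (trace \<gamma>') \<Omega> \<longrightarrow>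
           path_sum Q (\<lambda>i. real_of_ereal (osc g (Q i))) \<gamma>' < \<infinity>) \<and>
        ((\<lambda>i. (real_of_ereal (osc g (Q i)))\<^sup>2) summable_on UNIV \<longrightarrow>
           path_sum Q (\<lambda>i. real_of_ereal (osc g (Q i))) \<gamma> < \<infinity>)}"

text \<open>
  \<open>accesses \<Omega> Q \<gamma>0 \<gamma> x\<close>: the point \<open>x\<close> of the carpet is accessible by \<open>\<gamma>0\<close>, and \<open>\<gamma>\<close> is a
  path along which the limit at \<open>x\<close> is to be taken.
\<close>

definition accesses ::
    "complex set \<Rightarrow> (nat \<Rightarrow> complex set) \<Rightarrow> cpath \<Rightarrow> cpath \<Rightarrow> complex \<Rightarrow> bool" where
  "accesses \<Omega> Q \<gamma>0 \<gamma> x \<longleftrightarrow>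
     x \<in> carpet \<Omega> Q \<and>
     (if x \<in> trace \<gamma>0 \<inter> carpet_interior \<Omega> Q then \<gamma> = \<gamma>0
      else open_cpath \<gamma> \<and> is_subpath \<gamma> \<gamma>0 \<and> x \<in> closure (trace \<gamma>) - trace \<gamma> \<and>
           (\<forall>i. x \<in> frontier (Q i) \<longrightarrow> trace \<gamma> \<inter> Q i = {}))"

definition accessible ::
    "complex set \<Rightarrow> (nat \<Rightarrow> complex set) \<Rightarrow> (complex \<Rightarrow> ereal) \<Rightarrow> complex \<Rightarrow> bool" where
  "accessible \<Omega> Q g x \<longleftrightarrow> (\<exists>\<gamma>0\<in>good_paths \<Omega> Q g. \<exists>\<gamma>. accesses \<Omega> Q \<gamma>0 \<gamma> x)"

text \<open>\<open>Q i \<rightarrow> x\<close> with \<open>Q i\<close> meeting \<open>\<gamma>\<close>: the disks lie in arbitrarily small balls about \<open>x\<close>.\<close>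

definition disks_to :: "(nat \<Rightarrow> complex set) \<Rightarrow> cpath \<Rightarrow> complex \<Rightarrow> nat filter" where
  "disks_to Q \<gamma> x =
     (INF r\<in>{0<..}. principal {i \<in> disks_meeting Q (trace \<gamma>). Q i \<subseteq> ball x r})"

text \<open>For functions in the local Sobolev space the value does not depend on the choice of path.\<close>

definition accessible_value ::
    "complex set \<Rightarrow> (nat \<Rightarrow> complex set) \<Rightarrow> (complex \<Rightarrow> ereal) \<Rightarrow> complex \<Rightarrow> ereal" where
  "accessible_value \<Omega> Q g x =
     (let \<gamma> = SOME \<gamma>. \<exists>\<gamma>0\<in>good_paths \<Omega> Q g. accesses \<Omega> Q \<gamma>0 \<gamma> x
      in Liminf (disks_to Q \<gamma> x) (\<lambda>i. Mdisk g (Q i)))"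

definition normalized_version ::
    "complex set \<Rightarrow> (nat \<Rightarrow> complex set) \<Rightarrow> (complex \<Rightarrow> ereal) \<Rightarrow> complex \<Rightarrow> ereal" where
  "normalized_version \<Omega> Q g x =
     (if accessible \<Omega> Q g x then accessible_value \<Omega> Q g x
      else if \<exists>i. x \<in> frontier (Q i)
      then Liminf (at x within {y \<in> frontier (Q (THE i. x \<in> frontier (Q i))). accessible \<Omega> Q g y})
             (accessible_value \<Omega> Q g)
      else Liminf (at x within {y. accessible \<Omega> Q g y}) (accessible_value \<Omega> Q g))"

definition normalized ::
    "modulus_version \<Rightarrow> complex set \<Rightarrow> (nat \<Rightarrow> complex set) \<Rightarrow> (complex \<Rightarrow> ereal) \<Rightarrow> bool" where
  "normalized v \<Omega> Q u \<longleftrightarrow>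
     (\<exists>g\<in>W12_loc v \<Omega> Q. \<forall>x\<in>carpet \<Omega> Q. u x = normalized_version \<Omega> Q g x)"

end

theory Submission
  imports Defs
begin

text \<open>
  A bounded harmonic \<open>u\<close> is compared with \<open>u (1 - \<phi>\<^sup>2)\<close>, where \<open>\<phi>\<close> is an average of cutoff functions at very
  sparse scales. No disk sees two of these scales, so fatness makes the energy of \<open>\<phi>\<close> arbitrarily small, and
  the resulting Caccioppoli inequality shows that \<open>u\<close> has no oscillation on any peripheral circle. That
  the competitor is admissible amounts to the fact that the oscillations of a function form an upper
  gradient as soon as there is any square summable one: a path is shortened by jumping through disks
  until every other disk meets at most two of its remaining pieces.

  By Fubini and a length-area estimate almost every horizontal or vertical segment avoids a given
  family of modulus zero. Crossing such segments shows that \<open>u\<close> is equal to one constant \<open>c\<close> on all peripheral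
  circles. At the remaining points the normalization enters: \<open>u\<close> is the normalized version of some \<open>g\<close>,
  which need not be \<open>u\<close> itself. The value \<open>c\<close>, known at points of generic segments, is carried over from
  the limit of \<open>g\<close> along the path chosen at such a point to the limit along the segment by
  means of small rectangles whose sides have small path sums. Finally every small disk is met by a short
  generic segment, so the maxima of \<open>g\<close> over the disks tend to \<open>c\<close> at every point off the circles.
\<close>

section \<open>Sums and null sets\<close>

text \<open>The gain in the energy estimate is an orthogonality effect: on each disk at most one of
  the cutoffs varies, and each has bounded energy because fatness is scale invariant, so an average
  of n of them has energy of order 1/n. The obstacle in the competitor is that the upper gradient
  supplied by the product rule exceeds its oscillations, whereas the Sobolev space demands the
  oscillations themselves. Shortest chains remove the excess: what is left of the path between the
  jumps avoids the first disks of the enumeration and costs at most twice the tail of a convergent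
  sum. An upper gradient says nothing about a single point off the circles, since it ignores
  families of modulus zero. Values there come only from normalization, that is from liminfs of disk
  maxima of \<open>g\<close> along a path picked by a choice operator. The only link between
  \<open>u\<close> and \<open>g\<close> is their agreement at accessible points on segments that are
  generic for both. Weak and strong modulus differ only in which paths may be discarded for free;
  isolating this lets nearly every argument run once.\<close>

lemma infsum_ennreal_eq_suminf:
  fixes f :: "nat \<Rightarrow> ennreal"
  shows "infsum f A = (\<Sum>i. f i * indicator A i)"
proof -
  have "infsum f A = infsum (\<lambda>i. f i * indicator A i) UNIV"
    by (rule infsum_cong_neutral) auto
  also have "\<dots> = (\<Sum>i. f i * indicator A i)"
    by (intro sums_unique has_sum_imp_sums has_sum_infsum nonneg_summable_on_complete) auto
  finally show ?thesis .
qed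

lemma path_sum_suminf:
  "path_sum Q \<rho> \<gamma> = (\<Sum>i. ennreal (\<rho> i) * indicator (disks_meeting Q (trace \<gamma>)) i)"
  unfolding path_sum_def by (rule infsum_ennreal_eq_suminf)

lemma disks_meeting_mono: "A \<subseteq> B \<Longrightarrow> disks_meeting Q A \<subseteq> disks_meeting Q B"
  by (auto simp: disks_meeting_def)

lemma path_sum_mono:
  assumes "trace \<gamma>' \<subseteq> trace \<gamma>" "\<And>i. i \<in> disks_meeting Q (trace \<gamma>') \<Longrightarrow> \<rho> i \<le> \<rho>' i"
  shows "path_sum Q \<rho> \<gamma>' \<le> path_sum Q \<rho>' \<gamma>"
  unfolding path_sum_suminf using assms disks_meeting_mono[OF assms(1), of Q]
  by (intro suminf_le allI) (auto split: split_indicator intro!: ennreal_leI)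

lemma infsum_ennreal:
  assumes "\<And>i. i \<in> A \<Longrightarrow> (f i :: real) \<ge> 0" "f summable_on A"
  shows "(\<Sum>\<^sub>\<infinity>i\<in>A. ennreal (f i)) = ennreal (infsum f A)"
proof -
  have "sum (ennreal \<circ> f) F = ennreal (sum f F)" if "finite F" "F \<subseteq> A" for F
    using that assms(1) by (auto simp: sum_ennreal subsetD)
  then have "infsum (ennreal \<circ> f) A = ennreal (infsum f A)"
    using assms(2) by (intro infsum_comm_additive_general) auto
  then show ?thesis by (simp add: o_def)
qed

lemma summable_on_if_infsum_ennreal_finite:
  assumes "\<And>i. i \<in> A \<Longrightarrow> (f i :: real) \<ge> 0" "(\<Sum>\<^sub>\<infinity>i\<in>A. ennreal (f i)) < \<infinity>"
  shows "f summable_on A"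
proof (rule nonneg_bdd_above_summable_on)
  let ?s = "\<Sum>\<^sub>\<infinity>i\<in>A. ennreal (f i)"
  have "sum f F \<le> enn2real ?s" if "F \<subseteq> A" "finite F" for F
  proof -
    have "ennreal (sum f F) = infsum (\<lambda>i. ennreal (f i)) F"
      using that assms by (simp add: sum_ennreal subset_iff)
    also have "\<dots> \<le> ?s"
      using that by (intro infsum_mono_neutral nonneg_summable_on_complete) auto
    finally show ?thesis
      using assms(2) by (metis ennreal_enn2real enn2real_nonneg ennreal_le_iff infinity_ennreal_def)
  qed
  then show "bdd_above (sum f ` {F. F \<subseteq> A \<and> finite F})" by (auto intro!: bdd_aboveI)
qed (use assms in auto)

section \<open>One-dimensional Hausdorff null sets\<close>

lemma hausdorff_measure_mono: "E \<subseteq> F \<Longrightarrow> hausdorff_measure m E \<le> hausdorff_measure m F"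
  unfolding hausdorff_measure_def
  by (intro SUP_mono' INF_superset_mono) auto

text \<open>The measure is a supremum over scales, so any single scale may be used, here 1. In
  dimension one the factor \<open>unit_ball_vol 1 = 2\<close> cancels the halving of the diameter,
  leaving the plain sum of diameters.\<close>

lemma hausdorff_null_cover:
  fixes E :: "'a::metric_space set"
  assumes "hausdorff_measure 1 E = 0" "e > 0"
  shows "\<exists>A. E \<subseteq> (\<Union>j::nat. A j) \<and> (\<forall>j. bounded (A j)) \<and> (\<Sum>j. ennreal (diameter (A j))) < e"
proof -
  have "(INF A\<in>{A :: nat \<Rightarrow> 'a set. E \<subseteq> (\<Union>j. A j) \<and> (\<forall>j. bounded (A j) \<and> diameter (A j) \<le> 1)}.
          \<Sum>j. ennreal (unit_ball_vol (real 1) * (diameter (A j) / 2) ^ 1)) \<le> hausdorff_measure 1 E"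
    unfolding hausdorff_measure_def by (rule SUP_upper) auto
  then have "\<dots> < e" using assms by simp
  then have "(INF A\<in>{A :: nat \<Rightarrow> 'a set. E \<subseteq> (\<Union>j. A j) \<and> (\<forall>j. bounded (A j) \<and> diameter (A j) \<le> 1)}.
          \<Sum>j. ennreal (unit_ball_vol (real 1) * (diameter (A j) / 2) ^ 1)) < e"
    using \<open>_ \<le> hausdorff_measure 1 E\<close> by order
  then show ?thesis unfolding INF_less_iff by (auto simp: unit_ball_vol_1)
qed

lemma hausdorff_nullI:
  fixes E :: "'a::metric_space set"
  assumes "\<And>\<delta> e. \<delta> > 0 \<Longrightarrow> e > 0 \<Longrightarrow> \<exists>A. E \<subseteq> (\<Union>j::nat. A j) \<and>
    (\<forall>j. bounded (A j) \<and> diameter (A j) \<le> \<delta>) \<and> (\<Sum>j. ennreal (diameter (A j))) \<le> ennreal e"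
  shows "hausdorff_measure 1 E = 0"
proof -
  have "(INF A\<in>{A :: nat \<Rightarrow> 'a set. E \<subseteq> (\<Union>j. A j) \<and> (\<forall>j. bounded (A j) \<and> diameter (A j) \<le> \<delta>)}.
          \<Sum>j. ennreal (unit_ball_vol (real 1) * (diameter (A j) / 2) ^ 1)) \<le> 0" if "\<delta> > 0" for \<delta>
  proof (rule ennreal_le_epsilon)
    fix e :: real assume "e > 0"
    from assms[OF that this] obtain A where A: "E \<subseteq> (\<Union>j::nat. A j)"
      "\<forall>j. bounded (A j) \<and> diameter (A j) \<le> \<delta>" "(\<Sum>j. ennreal (diameter (A j))) \<le> ennreal e" by blast
    show "(INF A\<in>{A :: nat \<Rightarrow> 'a set. E \<subseteq> (\<Union>j. A j) \<and> (\<forall>j. bounded (A j) \<and> diameter (A j) \<le> \<delta>)}.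
          \<Sum>j. ennreal (unit_ball_vol (real 1) * (diameter (A j) / 2) ^ 1)) \<le> 0 + ennreal e"
      by (rule INF_lower2[of A]) (use A in \<open>auto simp: unit_ball_vol_1\<close>)
  qed
  then show ?thesis unfolding hausdorff_measure_def
    by (intro antisym SUP_least) auto
qed

text \<open>\<open>X\<close> need not be measurable: intersecting Borel covers of measure at most
  \<open>1 / (n + 1)\<close> gives a Borel null set that contains it. Sets of exceptional line
  parameters are treated in this way.\<close>

lemma negligible_if_small_covers:
  fixes X :: "'a::euclidean_space set"
  assumes "\<And>e::real. e > 0 \<Longrightarrow> \<exists>U\<in>sets borel. X \<subseteq> U \<and> emeasure lborel U \<le> ennreal e"
  shows "negligible X"
proof -
  have "\<exists>U. \<forall>n::nat. U n \<in> sets borel \<and> X \<subseteq> U n \<and> emeasure lborel (U n) \<le> ennreal (1 / real (Suc n))"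
    by (rule choice) (use assms in \<open>metis divide_pos_pos of_nat_0_less_iff zero_less_Suc zero_less_one\<close>)
  then obtain U where U: "\<And>n. U n \<in> sets borel" "\<And>n. X \<subseteq> U n"
      "\<And>n. emeasure lborel (U n) \<le> ennreal (1 / real (Suc n))" by blast
  have "emeasure lborel (\<Inter>n. U n) \<le> 0"
  proof (rule ennreal_le_epsilon)
    fix e :: real assume "e > 0"
    then obtain n where n: "1 / real (Suc n) < e" using nat_approx_posE by blast
    have "emeasure lborel (\<Inter>n. U n) \<le> emeasure lborel (U n)"
      by (rule emeasure_mono) (use U in auto)
    also have "\<dots> \<le> 0 + ennreal e" using U(3)[of n] n \<open>e > 0\<close>
      by (metis add_0 ennreal_leI less_imp_le order_trans)
    finally show "emeasure lborel (\<Inter>n. U n) \<le> 0 + ennreal e" .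
  qed
  moreover have "(\<Inter>n. U n) \<in> sets borel" using U(1) by blast
  ultimately have "(\<Inter>n. U n) \<in> null_sets lborel" by (auto simp: null_sets_def)
  then have "negligible (\<Inter>n. U n)"
    by (simp add: negligible_iff_null_sets null_sets_completionI)
  then show ?thesis by (rule negligible_subset) (use U in auto)
qed

text \<open>The image of a covering set lies in an interval of twice its diameter. Applied to
  coordinates and to distances from a point, this shows that almost every value of such a function
  is not taken on a set of zero length.\<close>

lemma negligible_image_hausdorff_null:
  fixes f :: "'a::metric_space \<Rightarrow> real"
  assumes E: "hausdorff_measure 1 E = 0"
    and f: "\<And>x y. x \<in> E \<Longrightarrow> y \<in> E \<Longrightarrow> \<bar>f x - f y\<bar> \<le> dist x y"
  shows "negligible (f ` E)"
proof (rule negligible_if_small_covers)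
  fix e :: real assume e: "e > 0"
  from hausdorff_null_cover[OF E, of "ennreal (e/2)"] e
  obtain A where A: "E \<subseteq> (\<Union>j::nat. A j)" "\<And>j. bounded (A j)"
    "(\<Sum>j. ennreal (diameter (A j))) < ennreal (e/2)" by (metis half_gt_zero ennreal_less_zero_iff)
  define p where "p j = (SOME x. x \<in> A j \<inter> E)" for j
  define I where "I j = {f (p j) - diameter (A j) .. f (p j) + diameter (A j)}" for j
  have sub: "f x \<in> I j" if "x \<in> A j" "x \<in> E" for x j
  proof -
    have p: "p j \<in> A j \<inter> E" unfolding p_def by (rule someI[of _ x]) (use that in auto)
    have "dist x (p j) \<le> diameter (A j)" using p that A(2) by (intro diameter_bounded_bound) auto
    then show ?thesis using f[of x "p j"] p that by (auto simp: I_def)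
  qed
  show "\<exists>U\<in>sets borel. f ` E \<subseteq> U \<and> emeasure lborel U \<le> ennreal e"
  proof (intro bexI conjI)
    show "f ` E \<subseteq> (\<Union>j. I j)" using A(1) sub by blast
    have "emeasure lborel (\<Union>j. I j) \<le> (\<Sum>j. emeasure lborel (I j))"
      by (rule emeasure_subadditive_countably) (auto simp: I_def)
    also have "\<dots> = (\<Sum>j. 2 * ennreal (diameter (A j)))"
      using A(2) by (simp add: I_def diameter_ge_0 ennreal_mult')
    also have "\<dots> = 2 * (\<Sum>j. ennreal (diameter (A j)))" by simp
    also have "\<dots> \<le> 2 * ennreal (e/2)" using A(3) by (intro mult_left_mono) auto
    also have "\<dots> = ennreal e" using e
      by (metis ennreal_mult' ennreal_numeral field_sum_of_halves mult_2 zero_le_numeral)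
    finally show "emeasure lborel (\<Union>j. I j) \<le> ennreal e" .
  qed (auto simp: I_def)
qed

lemma diameter_le_dist:
  fixes S :: "'a::metric_space set"
  assumes "0 \<le> d" "\<And>x y. x \<in> S \<Longrightarrow> y \<in> S \<Longrightarrow> dist x y \<le> d"
  shows "diameter S \<le> d"
  using assms by (auto simp: diameter_def intro!: cSUP_least)

text \<open>An open set \<open>U\<close> of length less than \<open>e\<close> around
  \<open>N\<close> is cut into non-overlapping intervals, and the image of the part of
  \<open>N\<close> in such an interval has diameter at most the length of the interval. The
  Lipschitz bound is assumed on \<open>N\<close> only.\<close>

lemma hausdorff_null_image:
  fixes h :: "real \<Rightarrow> 'a::metric_space"
  assumes N: "negligible N" "N \<subseteq> {a..b}"
    and h: "\<And>s t. s \<in> N \<Longrightarrow> t \<in> N \<Longrightarrow> dist (h s) (h t) \<le> \<bar>s - t\<bar>"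
  shows "hausdorff_measure 1 (h ` N) = 0"
proof (cases "N = {}")
  case True
  then show ?thesis by (intro hausdorff_nullI exI[of _ "\<lambda>_. {}"]) auto
next
  case False
  show ?thesis
  proof (rule hausdorff_nullI)
    fix \<delta> e :: real assume \<delta>: "\<delta> > 0" and e: "e > 0"
    obtain U where U: "open U" "N \<subseteq> U" "U \<in> lmeasurable" "measure lebesgue U < e"
    proof -
      have Ns: "N \<in> sets lebesgue" using N(1) by (simp add: negligible_imp_sets)
      from sets_lebesgue_outer_open[OF Ns e]
      obtain T where T: "open T" "N \<subseteq> T" "(T - N) \<in> lmeasurable" "emeasure lebesgue (T - N) < ennreal e" by metis
      have eq: "T = (T - N) \<union> N" using T(2) by auto
      have "T \<in> lmeasurable" by (subst eq) (intro fmeasurable.Un T(3) negligible_imp_measurable[OF N(1)])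
      moreover have "measure lebesgue T = measure lebesgue (T - N)"
        using measure_Un_null_set[of "T - N" lebesgue N] eq T(3) N(1)
        by (metis fmeasurableD negligible_iff_null_sets)
      moreover have "measure lebesgue (T - N) < e"
        using T(3,4) e by (simp add: emeasure_eq_measure2 ennreal_less_iff)
      ultimately show ?thesis using that T by auto
    qed
    have "a \<le> b" using False N by fastforce
    \<comment> \<open>Each interval of the covering is controlled by a point of \<open>N\<close>,
      where the first branch applies. Hence it lies in \<open>U\<close> and has length at most
      \<open>\<delta>\<close>.\<close>
    define G where "G x = (if x \<in> U then U \<inter> ball x (\<delta>/2) else ball x 1)" for x
    have "gauge G" unfolding gauge_def G_def using U(1) \<delta> by auto
    have sub: "N \<subseteq> cbox (a-1) (b+1)" using N by auto
    have ne: "box (a-1) (b+1) \<noteq> {}" using \<open>a \<le> b\<close> by (auto simp: box_eq_empty)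
    from covering_lemma[OF sub ne \<open>gauge G\<close>] obtain D where D: "countable D"
      "\<And>K. K \<in> D \<Longrightarrow> interior K \<noteq> {} \<and> (\<exists>c d. K = cbox c d)"
      "pairwise (\<lambda>A B. interior A \<inter> interior B = {}) D"
      "\<And>K. K \<in> D \<Longrightarrow> \<exists>x \<in> N \<inter> K. K \<subseteq> G x" "N \<subseteq> \<Union>D" by metis
    have DU: "K \<subseteq> U" if "K \<in> D" for K
      using D(4)[OF that] U(2) by (auto simp: G_def split: if_splits)
    have Dd: "\<bar>s - t\<bar> \<le> \<delta>" if "K \<in> D" "s \<in> K" "t \<in> K" for K s t
    proof -
      from D(4)[OF that(1)] obtain x where "x \<in> N" "K \<subseteq> G x" by auto
      then have "s \<in> ball x (\<delta>/2)" "t \<in> ball x (\<delta>/2)" using U(2) that by (auto simp: G_def split: if_splits)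
      then have "\<bar>x - s\<bar> < \<delta>/2" "\<bar>x - t\<bar> < \<delta>/2" by (auto simp: dist_real_def)
      then show ?thesis by linarith
    qed
    define idx where "idx = to_nat_on D"
    have idx: "inj_on idx D" unfolding idx_def by (rule inj_on_to_nat_on[OF D(1)])
    define A where "A j = (if j \<in> idx ` D then h ` (N \<inter> inv_into D idx j) else {})" for j
    have Aidx: "A (idx K) = h ` (N \<inter> K)" if "K \<in> D" for K
      using that idx by (simp add: A_def)
    have dia: "bounded (h ` (N \<inter> K)) \<and> diameter (h ` (N \<inter> K)) \<le> measure lebesgue K \<and> diameter (h ` (N \<inter> K)) \<le> \<delta>"
      if K: "K \<in> D" for K
    proof -
      from D(2)[OF K] obtain c d where cd: "K = cbox c d" by auto
      then have "c \<le> d" using D(2)[OF K] by fastforce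
      have di: "dist x y \<le> \<bar>d - c\<bar>" if "x \<in> h ` (N \<inter> K)" "y \<in> h ` (N \<inter> K)" for x y
      proof -
        from that obtain s t where "x = h s" "y = h t" "s \<in> N \<inter> K" "t \<in> N \<inter> K" by auto
        then show ?thesis using h[of s t] cd by auto
      qed
      have di': "dist x y \<le> \<delta>" if "x \<in> h ` (N \<inter> K)" "y \<in> h ` (N \<inter> K)" for x y
      proof -
        from that obtain s t where "x = h s" "y = h t" "s \<in> N \<inter> K" "t \<in> N \<inter> K" by auto
        then show ?thesis using h[of s t] Dd[OF K, of s t] by auto
      qed
      have "bounded (h ` (N \<inter> K))" unfolding bounded_two_points using di by blast
      moreover have "measure lebesgue K = d - c" using cd \<open>c \<le> d\<close> by simp
      moreover have "diameter (h ` (N \<inter> K)) \<le> d - c"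
        using di \<open>c \<le> d\<close> by (intro diameter_le_dist) auto
      moreover have "diameter (h ` (N \<inter> K)) \<le> \<delta>"
        using di' \<delta> by (intro diameter_le_dist) auto
      ultimately show ?thesis by auto
    qed
    have A0: "bounded (A j) \<and> diameter (A j) \<le> \<delta>" for j
    proof (cases "j \<in> idx ` D")
      case True
      then show ?thesis using dia Aidx by auto
    qed (use \<delta> in \<open>auto simp: A_def\<close>)
    have partial: "(\<Sum>j\<in>F. diameter (A j)) \<le> e" if F: "finite F" for F
    proof -
      define C where "C = {K\<in>D. idx K \<in> F}"
      have finC: "finite C" using F idx
        by (rule_tac inj_on_finite[of idx C F]) (auto simp: C_def inj_on_def)
      have "(\<Sum>j\<in>F. diameter (A j)) = (\<Sum>j\<in>idx ` C. diameter (A j))"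
        using F by (intro sum.mono_neutral_right) (auto simp: C_def A_def)
      also have "\<dots> = (\<Sum>K\<in>C. diameter (h ` (N \<inter> K)))"
        by (subst sum.reindex) (use idx Aidx in \<open>auto simp: C_def inj_on_def\<close>)
      also have "\<dots> \<le> (\<Sum>K\<in>C. measure lebesgue K)"
        using dia by (intro sum_mono) (auto simp: C_def)
      also have "\<dots> = measure lebesgue (\<Union>C)"
      proof -
        have "C division_of \<Union>C"
        proof (rule division_ofI)
          show "K \<subseteq> \<Union>C" if "K \<in> C" for K using that by blast
          show "K \<noteq> {}" if "K \<in> C" for K using that D(2)[of K] by (auto simp: C_def)
          show "\<exists>c d. K = cbox c d" if "K \<in> C" for K using that D(2)[of K] by (auto simp: C_def)
          show "interior K \<inter> interior L = {}" if "K \<in> C" "L \<in> C" "K \<noteq> L" for K L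
            using that D(3) by (auto simp: C_def pairwise_def)
        qed (use finC in auto)
        from content_division[OF this] show ?thesis .
      qed
      also have "\<dots> \<le> measure lebesgue U"
      proof (rule measure_mono_fmeasurable)
        have "K \<in> sets lebesgue" if "K \<in> C" for K
          using that D(2)[of K] by (auto simp: C_def)
        then show "\<Union>C \<in> sets lebesgue" using finC by (intro sets.finite_Union) auto
      qed (use DU U in \<open>auto simp: C_def\<close>)
      finally show ?thesis using U by simp
    qed
    have "(\<Sum>j. ennreal (diameter (A j))) \<le> ennreal e"
      unfolding suminf_eq_SUP
      by (intro SUP_least) (use partial A0 in \<open>auto simp: sum_ennreal diameter_ge_0 intro!: ennreal_leI\<close>)
    moreover have "h ` N \<subseteq> (\<Union>j. A j)"
    proof
      fix z assume "z \<in> h ` N"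
      then obtain t K where "z = h t" "t \<in> N" "K \<in> D" "t \<in> K" using D(5) by auto
      then show "z \<in> (\<Union>j. A j)" using Aidx[of K] by blast
    qed
    ultimately show "\<exists>A. h ` N \<subseteq> (\<Union>j::nat. A j) \<and>
        (\<forall>j. bounded (A j) \<and> diameter (A j) \<le> \<delta>) \<and> (\<Sum>j. ennreal (diameter (A j))) \<le> ennreal e"
      using A0 by (intro exI[of _ A]) auto
  qed
qed

section \<open>Path families of modulus zero\<close>

text \<open>The weak and the strong modulus are the same infimum up to the paths on which
  admissibility is waived: a family of zero 2-modulus, or paths that meet the carpet in positive
  length. This predicate lets one argument handle both versions.\<close>

fun exceptional_paths :: "modulus_version \<Rightarrow> complex set \<Rightarrow> cpath set \<Rightarrow> bool" where
  "exceptional_paths Weak S \<Gamma> \<longleftrightarrow> mod2 \<Gamma> = 0"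
| "exceptional_paths Strong S \<Gamma> \<longleftrightarrow> (\<forall>\<gamma>\<in>\<Gamma>. hausdorff_measure 1 (trace \<gamma> \<inter> S) \<noteq> 0)"

lemma mod2_eq_0_iff:
  "mod2 \<Gamma> = 0 \<longleftrightarrow> (\<forall>e>0. \<exists>l\<in>borel_measurable borel.
     (\<forall>\<gamma>\<in>\<Gamma>. line_integral l \<gamma> \<ge> 1) \<and> (\<integral>\<^sup>+x. (l x)\<^sup>2 \<partial>lborel) < ennreal e)" (is "?L = ?R")
proof
  assume ?L
  show ?R
  proof (intro allI impI)
    fix e :: real assume "e > 0"
    then have "mod2 \<Gamma> < ennreal e" using \<open>?L\<close> by simp
    then show "\<exists>l\<in>borel_measurable borel.
     (\<forall>\<gamma>\<in>\<Gamma>. line_integral l \<gamma> \<ge> 1) \<and> (\<integral>\<^sup>+x. (l x)\<^sup>2 \<partial>lborel) < ennreal e"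
      unfolding mod2_def INF_less_iff by auto
  qed
next
  assume R: ?R
  have "mod2 \<Gamma> \<le> 0"
  proof (rule ennreal_le_epsilon)
    fix e :: real assume "e > 0"
    with R obtain l where l: "l \<in> borel_measurable borel"
      "\<forall>\<gamma>\<in>\<Gamma>. line_integral l \<gamma> \<ge> 1" "(\<integral>\<^sup>+x. (l x)\<^sup>2 \<partial>lborel) < ennreal e" by blast
    show "mod2 \<Gamma> \<le> 0 + ennreal e"
      unfolding mod2_def by (rule INF_lower2[of l]) (use l in auto)
  qed
  then show ?L by simp
qed

text \<open>In the strong version the waived subfamily can be taken to consist of all paths of
  \<open>\<Gamma>\<close> that meet the carpet in positive length; conversely no other path may be
  waived.\<close>

lemma carpet_modulus_eq:
  "carpet_modulus v \<Omega> Q \<Gamma> =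
     (INF \<rho>\<in>{\<rho> :: nat \<Rightarrow> real. (\<forall>i. \<rho> i \<ge> 0) \<and>
        (\<exists>\<Gamma>0\<subseteq>\<Gamma>. exceptional_paths v (carpet \<Omega> Q) \<Gamma>0 \<and> (\<forall>\<gamma>\<in>\<Gamma> - \<Gamma>0. path_sum Q \<rho> \<gamma> \<ge> 1))}.
        \<Sum>i. ennreal ((\<rho> i)\<^sup>2))"
proof (cases v)
  case Weak
  then show ?thesis by (simp add: weak_modulus_def)
next
  case Strong
  have "(\<forall>\<gamma>\<in>\<Gamma>. hausdorff_measure 1 (trace \<gamma> \<inter> carpet \<Omega> Q) = 0 \<longrightarrow> path_sum Q \<rho> \<gamma> \<ge> 1) \<longleftrightarrow>
    (\<exists>\<Gamma>0\<subseteq>\<Gamma>. exceptional_paths v (carpet \<Omega> Q) \<Gamma>0 \<and> (\<forall>\<gamma>\<in>\<Gamma> - \<Gamma>0. path_sum Q \<rho> \<gamma> \<ge> 1))" (is "?A \<longleftrightarrow> ?B") for \<rho>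
  proof
    assume ?A
    then show ?B using Strong
      by (intro exI[of _ "{\<gamma>\<in>\<Gamma>. hausdorff_measure 1 (trace \<gamma> \<inter> carpet \<Omega> Q) \<noteq> 0}"]) auto
  next
    assume ?B
    then show ?A using Strong by auto
  qed
  then show ?thesis using Strong by (simp add: strong_modulus_def)
qed

lemma carpet_modulus_eq_0_iff:
  "carpet_modulus v \<Omega> Q \<Gamma> = 0 \<longleftrightarrow>
     (\<forall>e>0. \<exists>\<rho> \<Gamma>0. (\<forall>i. \<rho> i \<ge> 0) \<and> \<Gamma>0 \<subseteq> \<Gamma> \<and> exceptional_paths v (carpet \<Omega> Q) \<Gamma>0 \<and>
        (\<forall>\<gamma>\<in>\<Gamma> - \<Gamma>0. path_sum Q \<rho> \<gamma> \<ge> 1) \<and> (\<Sum>i. ennreal ((\<rho> i)\<^sup>2)) < ennreal e)" (is "?L = ?R")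
proof
  assume L: ?L
  show ?R
  proof (intro allI impI)
    fix e :: real assume "e > 0"
    then have "carpet_modulus v \<Omega> Q \<Gamma> < ennreal e" using L by simp
    then show "\<exists>\<rho> \<Gamma>0. (\<forall>i. \<rho> i \<ge> 0) \<and> \<Gamma>0 \<subseteq> \<Gamma> \<and> exceptional_paths v (carpet \<Omega> Q) \<Gamma>0 \<and>
        (\<forall>\<gamma>\<in>\<Gamma> - \<Gamma>0. path_sum Q \<rho> \<gamma> \<ge> 1) \<and> (\<Sum>i. ennreal ((\<rho> i)\<^sup>2)) < ennreal e"
      unfolding carpet_modulus_eq INF_less_iff by blast
  qed
next
  assume R: ?R
  have "carpet_modulus v \<Omega> Q \<Gamma> \<le> 0"
  proof (rule ennreal_le_epsilon)
    fix e :: real assume "e > 0"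
    with R obtain \<rho> \<Gamma>0 where r: "\<forall>i. \<rho> i \<ge> 0" "\<Gamma>0 \<subseteq> \<Gamma>" "exceptional_paths v (carpet \<Omega> Q) \<Gamma>0"
        "\<forall>\<gamma>\<in>\<Gamma> - \<Gamma>0. path_sum Q \<rho> \<gamma> \<ge> 1" "(\<Sum>i. ennreal ((\<rho> i)\<^sup>2)) < ennreal e" by blast
    show "carpet_modulus v \<Omega> Q \<Gamma> \<le> 0 + ennreal e"
      unfolding carpet_modulus_eq by (rule INF_lower2[of \<rho>]) (use r in auto)
  qed
  then show ?L by simp
qed

lemma locally_rectifiable_subpath:
  "is_subpath \<gamma>' \<gamma> \<Longrightarrow> locally_rectifiable \<gamma> \<Longrightarrow> locally_rectifiable \<gamma>'"
  unfolding is_subpath_def locally_rectifiable_def by (metis subsetD)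

text \<open>If \<open>\<gamma>\<close> is not locally rectifiable, the right side is infinite.
  Otherwise the subpath is locally rectifiable too and its supremum runs over fewer subarcs.\<close>

lemma line_integral_mono:
  assumes "is_subpath \<gamma>' \<gamma>" "\<And>x. l x \<le> l' x"
  shows "line_integral l \<gamma>' \<le> line_integral l' \<gamma>"
proof (cases "locally_rectifiable \<gamma>")
  case True
  have *: "rectifiable_line_integral l f a b \<le> rectifiable_line_integral l' f a b" for f a b
    unfolding rectifiable_line_integral_def using assms(2)
    by (intro nn_integral_mono mult_right_mono) auto
  have "(SUP (a, b)\<in>{(a, b). a \<in> fst \<gamma>' \<and> b \<in> fst \<gamma>' \<and> a \<le> b}. rectifiable_line_integral l (snd \<gamma>') a b)
    \<le> (SUP (a, b)\<in>{(a, b). a \<in> fst \<gamma> \<and> b \<in> fst \<gamma> \<and> a \<le> b}. rectifiable_line_integral l' (snd \<gamma>) a b)"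
    by (rule SUP_mono) (use assms * in \<open>fastforce simp: is_subpath_def\<close>)
  then show ?thesis
    using True locally_rectifiable_subpath[OF assms(1)] by (simp add: line_integral_def)
qed (simp add: line_integral_def)

lemma is_subpath_refl: "is_cpath \<gamma> \<Longrightarrow> is_subpath \<gamma> \<gamma>"
  by (auto simp: is_cpath_def is_subpath_def)

lemma is_subpath_trans: "is_subpath a b \<Longrightarrow> is_subpath b c \<Longrightarrow> is_subpath a c"
  by (auto simp: is_subpath_def)

lemma trace_subpath: "is_subpath \<gamma>' \<gamma> \<Longrightarrow> trace \<gamma>' \<subseteq> trace \<gamma>"
  by (auto simp: is_subpath_def trace_def)

lemma is_cpath_subpath: assumes "is_subpath \<gamma>' \<gamma>" "is_cpath \<gamma>" shows "is_cpath \<gamma>'"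
proof -
  have sub: "fst \<gamma>' \<subseteq> fst \<gamma>" using assms(1) by (simp add: is_subpath_def)
  obtain h where h: "continuous_on (closure (fst \<gamma>)) h" "\<forall>t\<in>fst \<gamma>. h t = snd \<gamma> t"
    using assms(2) by (auto simp: is_cpath_def)
  have "continuous_on (closure (fst \<gamma>')) h"
    using h(1) closure_mono[OF sub] continuous_on_subset by blast
  moreover have "\<forall>t\<in>fst \<gamma>'. h t = snd \<gamma>' t" using h(2) sub assms(1) by (auto simp: is_subpath_def)
  moreover have "bounded (fst \<gamma>')" using assms sub bounded_subset by (auto simp: is_cpath_def)
  ultimately show ?thesis using assms by (auto simp: is_cpath_def is_subpath_def)
qed

lemma paths_in_subpath: "is_subpath \<gamma>' \<gamma> \<Longrightarrow> \<gamma> \<in> paths_in \<Omega> \<Longrightarrow> \<gamma>' \<in> paths_in \<Omega>"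
  unfolding paths_in_def using is_cpath_subpath trace_subpath by blast

lemma bounded_trace:
  assumes "is_cpath \<gamma>" shows "bounded (trace \<gamma>)"
proof -
  obtain h where h: "continuous_on (closure (fst \<gamma>)) h" "\<forall>t\<in>fst \<gamma>. h t = snd \<gamma> t" "bounded (fst \<gamma>)"
    using assms unfolding is_cpath_def by blast
  have "bounded (h ` closure (fst \<gamma>))"
    using h by (intro compact_imp_bounded compact_continuous_image) auto
  moreover have "trace \<gamma> \<subseteq> h ` closure (fst \<gamma>)"
    using h(2) closure_subset[of "fst \<gamma>"] by (force simp: trace_def)
  ultimately show ?thesis using bounded_subset by blast
qed

text \<open>Passing to longer paths only increases line integrals and the part of the trace in the
  carpet, so the same densities stay admissible and positive lengths stay positive.\<close>

lemma exceptional_paths_superpath: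
  assumes "exceptional_paths v S \<Gamma>" "\<And>\<gamma>. \<gamma> \<in> \<Gamma>' \<Longrightarrow> \<exists>\<gamma>'\<in>\<Gamma>. is_subpath \<gamma>' \<gamma>"
  shows "exceptional_paths v S \<Gamma>'"
proof (cases v)
  case Weak
  have "mod2 \<Gamma>' = 0" unfolding mod2_eq_0_iff
  proof (intro allI impI)
    fix e :: real assume "e > 0"
    with assms(1) Weak obtain l where l: "l \<in> borel_measurable borel"
      "\<forall>\<gamma>\<in>\<Gamma>. line_integral l \<gamma> \<ge> 1" "(\<integral>\<^sup>+x. (l x)\<^sup>2 \<partial>lborel) < ennreal e"
      unfolding exceptional_paths.simps mod2_eq_0_iff by (metis exceptional_paths.simps(1) mod2_eq_0_iff)
    have "line_integral l \<gamma> \<ge> 1" if \<gamma>: "\<gamma> \<in> \<Gamma>'" for \<gamma>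
    proof -
      obtain \<gamma>' where "\<gamma>' \<in> \<Gamma>" "is_subpath \<gamma>' \<gamma>" using assms(2)[OF \<gamma>] by auto
      then show ?thesis using l(2) line_integral_mono[of \<gamma>' \<gamma> l l] order_trans by blast
    qed
    then show "\<exists>l\<in>borel_measurable borel.
     (\<forall>\<gamma>\<in>\<Gamma>'. line_integral l \<gamma> \<ge> 1) \<and> (\<integral>\<^sup>+x. (l x)\<^sup>2 \<partial>lborel) < ennreal e" using l by blast
  qed
  then show ?thesis using Weak by simp
next
  case Strong
  have "hausdorff_measure 1 (trace \<gamma> \<inter> S) \<noteq> 0" if \<gamma>: "\<gamma> \<in> \<Gamma>'" for \<gamma>
  proof -
    obtain \<gamma>' where g: "\<gamma>' \<in> \<Gamma>" "is_subpath \<gamma>' \<gamma>" using assms(2)[OF \<gamma>] by auto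
    then have "trace \<gamma>' \<inter> S \<subseteq> trace \<gamma> \<inter> S" using trace_subpath by blast
    from hausdorff_measure_mono[OF this, of 1] show ?thesis using g assms(1) Strong by auto
  qed
  then show ?thesis using Strong by simp
qed

lemma exceptional_paths_Un:
  assumes "exceptional_paths v S \<Gamma>" "exceptional_paths v S \<Gamma>'"
    and P: "\<And>\<gamma>. \<gamma> \<in> \<Gamma> \<union> \<Gamma>' \<Longrightarrow> is_cpath \<gamma>"
  shows "exceptional_paths v S (\<Gamma> \<union> \<Gamma>')"
proof (cases v)
  case Weak
  have "mod2 (\<Gamma> \<union> \<Gamma>') = 0" unfolding mod2_eq_0_iff
  proof (intro allI impI)
    fix e :: real assume e: "e > 0"
    then have e4: "e/4 > 0" by simp
    have m: "mod2 \<Gamma> = 0" "mod2 \<Gamma>' = 0" using assms Weak by auto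
    from m(1)[unfolded mod2_eq_0_iff, rule_format, OF e4] obtain l where l: "l \<in> borel_measurable borel"
      "\<forall>\<gamma>\<in>\<Gamma>. line_integral l \<gamma> \<ge> 1" "(\<integral>\<^sup>+x. (l x)\<^sup>2 \<partial>lborel) < ennreal (e/4)" by blast
    from m(2)[unfolded mod2_eq_0_iff, rule_format, OF e4] obtain l' where l': "l' \<in> borel_measurable borel"
      "\<forall>\<gamma>\<in>\<Gamma>'. line_integral l' \<gamma> \<ge> 1" "(\<integral>\<^sup>+x. (l' x)\<^sup>2 \<partial>lborel) < ennreal (e/4)" by blast
    define L where "L x = max (l x) (l' x)" for x
    have [measurable]: "L \<in> borel_measurable borel" unfolding L_def using l(1) l'(1) by measurable
    have "line_integral L \<gamma> \<ge> 1" if "\<gamma> \<in> \<Gamma> \<union> \<Gamma>'" for \<gamma>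
    proof -
      have "is_subpath \<gamma> \<gamma>" using P[OF that] by (rule is_subpath_refl)
      then have "line_integral l \<gamma> \<le> line_integral L \<gamma>" "line_integral l' \<gamma> \<le> line_integral L \<gamma>"
        by (auto intro!: line_integral_mono simp: L_def)
      then show ?thesis using l(2) l'(2) that order_trans by blast
    qed
    moreover have "(\<integral>\<^sup>+x. (L x)\<^sup>2 \<partial>lborel) \<le> (\<integral>\<^sup>+x. (l x)\<^sup>2 + (l' x)\<^sup>2 \<partial>lborel)"
      by (intro nn_integral_mono) (auto simp: L_def max_def)
    moreover have "\<dots> = (\<integral>\<^sup>+x. (l x)\<^sup>2 \<partial>lborel) + (\<integral>\<^sup>+x. (l' x)\<^sup>2 \<partial>lborel)"
      using l(1) l'(1) by (intro nn_integral_add) auto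
    moreover have "\<dots> \<le> ennreal (e/4) + ennreal (e/4)" using l(3) l'(3) by (intro add_mono) auto
    moreover have "\<dots> < ennreal e" using e by (simp add: ennreal_plus[symmetric] ennreal_less_iff del: ennreal_plus)
    ultimately show "\<exists>l\<in>borel_measurable borel.
     (\<forall>\<gamma>\<in>\<Gamma>\<union>\<Gamma>'. line_integral l \<gamma> \<ge> 1) \<and> (\<integral>\<^sup>+x. (l x)\<^sup>2 \<partial>lborel) < ennreal e"
      by (intro bexI[of _ L]) auto
  qed
  then show ?thesis using Weak by simp
qed (use assms in auto)

text \<open>This allows an exceptional family to be closed under superpaths, after which a path
  outside it has no exceptional subpath.\<close>

lemma carpet_modulus_null_superpath:
  assumes "carpet_modulus v \<Omega> Q \<Gamma> = 0" "\<And>\<gamma>. \<gamma> \<in> \<Gamma>' \<Longrightarrow> \<exists>\<gamma>'\<in>\<Gamma>. is_subpath \<gamma>' \<gamma>"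
  shows "carpet_modulus v \<Omega> Q \<Gamma>' = 0"
  unfolding carpet_modulus_eq_0_iff
proof (intro allI impI)
  fix e :: real assume "e > 0"
  with assms(1) obtain \<rho> \<Gamma>0 where r: "\<forall>i. \<rho> i \<ge> 0" "\<Gamma>0 \<subseteq> \<Gamma>" "exceptional_paths v (carpet \<Omega> Q) \<Gamma>0"
      "\<forall>\<gamma>\<in>\<Gamma> - \<Gamma>0. path_sum Q \<rho> \<gamma> \<ge> 1" "(\<Sum>i. ennreal ((\<rho> i)\<^sup>2)) < ennreal e"
    unfolding carpet_modulus_eq_0_iff by blast
  define G where "G = {\<gamma>\<in>\<Gamma>'. \<exists>\<gamma>'\<in>\<Gamma>0. is_subpath \<gamma>' \<gamma>}"
  have "exceptional_paths v (carpet \<Omega> Q) G"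
    by (rule exceptional_paths_superpath[OF r(3)]) (auto simp: G_def)
  moreover have "path_sum Q \<rho> \<gamma> \<ge> 1" if \<gamma>: "\<gamma> \<in> \<Gamma>' - G" for \<gamma>
  proof -
    obtain \<gamma>' where g: "\<gamma>' \<in> \<Gamma>" "is_subpath \<gamma>' \<gamma>" using assms(2) \<gamma> by blast
    then have "\<gamma>' \<notin> \<Gamma>0" using \<gamma> by (auto simp: G_def)
    then have "1 \<le> path_sum Q \<rho> \<gamma>'" using r g by auto
    also have "\<dots> \<le> path_sum Q \<rho> \<gamma>" using trace_subpath[OF g(2)] by (intro path_sum_mono) auto
    finally show ?thesis .
  qed
  ultimately show "\<exists>\<rho> \<Gamma>0. (\<forall>i. \<rho> i \<ge> 0) \<and> \<Gamma>0 \<subseteq> \<Gamma>' \<and> exceptional_paths v (carpet \<Omega> Q) \<Gamma>0 \<and>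
        (\<forall>\<gamma>\<in>\<Gamma>' - \<Gamma>0. path_sum Q \<rho> \<gamma> \<ge> 1) \<and> (\<Sum>i. ennreal ((\<rho> i)\<^sup>2)) < ennreal e"
    using r by (intro exI[of _ \<rho>] exI[of _ G]) (auto simp: G_def)
qed

lemma carpet_modulus_null_Un:
  assumes "carpet_modulus v \<Omega> Q \<Gamma> = 0" "carpet_modulus v \<Omega> Q \<Gamma>' = 0"
    and P: "\<And>\<gamma>. \<gamma> \<in> \<Gamma> \<union> \<Gamma>' \<Longrightarrow> is_cpath \<gamma>"
  shows "carpet_modulus v \<Omega> Q (\<Gamma> \<union> \<Gamma>') = 0"
  unfolding carpet_modulus_eq_0_iff
proof (intro allI impI)
  fix e :: real assume e: "e > 0"
  then have e4: "e/4 > 0" by simp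
  from assms(1)[unfolded carpet_modulus_eq_0_iff, rule_format, OF e4] obtain \<rho> \<Gamma>0
    where r: "\<forall>i. \<rho> i \<ge> 0" "\<Gamma>0 \<subseteq> \<Gamma>" "exceptional_paths v (carpet \<Omega> Q) \<Gamma>0"
      "\<forall>\<gamma>\<in>\<Gamma> - \<Gamma>0. path_sum Q \<rho> \<gamma> \<ge> 1" "(\<Sum>i. ennreal ((\<rho> i)\<^sup>2)) < ennreal (e/4)" by blast
  from assms(2)[unfolded carpet_modulus_eq_0_iff, rule_format, OF e4] obtain \<rho>' \<Gamma>0'
    where r': "\<forall>i. \<rho>' i \<ge> 0" "\<Gamma>0' \<subseteq> \<Gamma>'" "exceptional_paths v (carpet \<Omega> Q) \<Gamma>0'"
      "\<forall>\<gamma>\<in>\<Gamma>' - \<Gamma>0'. path_sum Q \<rho>' \<gamma> \<ge> 1" "(\<Sum>i. ennreal ((\<rho>' i)\<^sup>2)) < ennreal (e/4)" by blast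
  define R where "R i = max (\<rho> i) (\<rho>' i)" for i
  have "path_sum Q R \<gamma> \<ge> 1" if "\<gamma> \<in> \<Gamma> \<union> \<Gamma>' - (\<Gamma>0 \<union> \<Gamma>0')" for \<gamma>
  proof -
    have "path_sum Q \<rho> \<gamma> \<le> path_sum Q R \<gamma>" "path_sum Q \<rho>' \<gamma> \<le> path_sum Q R \<gamma>"
      by (auto intro!: path_sum_mono simp: R_def)
    then show ?thesis using r(4) r'(4) that order_trans by blast
  qed
  moreover have "exceptional_paths v (carpet \<Omega> Q) (\<Gamma>0 \<union> \<Gamma>0')"
    using r r' P by (intro exceptional_paths_Un) auto
  moreover have "(\<Sum>i. ennreal ((R i)\<^sup>2)) \<le> (\<Sum>i. ennreal ((\<rho> i)\<^sup>2) + ennreal ((\<rho>' i)\<^sup>2))"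
    by (intro suminf_le) (auto simp: R_def max_def)
  moreover have "\<dots> = (\<Sum>i. ennreal ((\<rho> i)\<^sup>2)) + (\<Sum>i. ennreal ((\<rho>' i)\<^sup>2))"
    by (intro suminf_add[symmetric]) auto
  moreover have "\<dots> \<le> ennreal (e/4) + ennreal (e/4)" using r(5) r'(5) by (intro add_mono) auto
  moreover have "\<dots> < ennreal e" using e by (simp add: ennreal_plus[symmetric] ennreal_less_iff del: ennreal_plus)
  ultimately show "\<exists>\<rho> \<Gamma>0. (\<forall>i. \<rho> i \<ge> 0) \<and> \<Gamma>0 \<subseteq> \<Gamma> \<union> \<Gamma>' \<and> exceptional_paths v (carpet \<Omega> Q) \<Gamma>0 \<and>
        (\<forall>\<gamma>\<in>\<Gamma> \<union> \<Gamma>' - \<Gamma>0. path_sum Q \<rho> \<gamma> \<ge> 1) \<and> (\<Sum>i. ennreal ((\<rho> i)\<^sup>2)) < ennreal e"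
    using r r' by (intro exI[of _ R] exI[of _ "\<Gamma>0 \<union> \<Gamma>0'"]) (auto simp: R_def le_max_iff_disj)
qed

lemma exceptional_paths_empty [simp]: "exceptional_paths v S {}"
proof (cases v)
  case Weak
  have "mod2 {} = 0" unfolding mod2_eq_0_iff by (auto intro!: bexI[of _ "\<lambda>_. 0"])
  then show ?thesis using Weak by simp
qed auto

lemma carpet_modulus_null_if_exceptional:
  "exceptional_paths v (carpet \<Omega> Q) \<Gamma> \<Longrightarrow> carpet_modulus v \<Omega> Q \<Gamma> = 0"
  unfolding carpet_modulus_eq_0_iff
  by (intro allI impI exI[of _ "\<lambda>_. 0"] exI[of _ \<Gamma>]) auto

text \<open>The weights turn a locally square summable sequence into a square summable one, while on the
  disks met by a bounded path they are bounded below.\<close>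

lemma carpet_modulus_path_sum_infinite:
  assumes \<rho>: "\<And>i. \<rho> i \<ge> 0"
    and sq: "\<And>n::nat. (\<lambda>i. (\<rho> i)\<^sup>2) summable_on disks_meeting Q (ball 0 (real n))"
    and ne: "\<And>i. Q i \<noteq> {}"
  shows "carpet_modulus v \<Omega> Q {\<gamma>\<in>paths_in \<Omega>. path_sum Q \<rho> \<gamma> = \<infinity>} = 0"
  unfolding carpet_modulus_eq_0_iff
proof (intro allI impI)
  fix e :: real assume e: "e > 0"
  define E where "E n = infsum (\<lambda>i. (\<rho> i)\<^sup>2) (disks_meeting Q (ball 0 (real n)))" for n
  have E0: "E n \<ge> 0" for n unfolding E_def by (rule infsum_nonneg) auto
  \<comment> \<open>The layer of a disk: the first integer ball that it meets. The disks of layer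
    \<open>n\<close> have total energy at most \<open>E n\<close>.\<close>
  define N where "N i = (LEAST n. Q i \<inter> ball 0 (real n) \<noteq> {})" for i
  have exN: "\<exists>n. Q i \<inter> ball 0 (real n) \<noteq> {}" for i
  proof -
    obtain z where "z \<in> Q i" using ne by blast
    moreover obtain n where "norm z < real n" using reals_Archimedean2 by blast
    ultimately show ?thesis by (intro exI[of _ n]) auto
  qed
  have N: "Q i \<inter> ball 0 (real (N i)) \<noteq> {}" for i unfolding N_def using exN by (rule LeastI_ex)
  have Nle: "N i \<le> n" if "Q i \<inter> ball 0 (real n) \<noteq> {}" for i n
    unfolding N_def using that by (rule Least_le)
  \<comment> \<open>Chosen so that layer \<open>n\<close> contributes at most
    \<open>e/4 * (1/2)^n\<close> to the energy, hence \<open>e/2\<close> in total. The summand 1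
    guards against \<open>E n = 0\<close>.\<close>
  define c where "c n = sqrt (e/4 * (1/2)^n / (1 + E n))" for n
  have c0: "c n > 0" for n unfolding c_def using e E0[of n] by (simp add: add_nonneg_pos)
  define R where "R i = c (N i) * \<rho> i" for i
  have R0: "R i \<ge> 0" for i unfolding R_def using c0 \<rho> by (simp add: less_imp_le)
  have part: "(\<Sum>i<m. (R i)\<^sup>2) \<le> e/2" for m
  proof -
    have "(\<Sum>i<m. (R i)\<^sup>2) = (\<Sum>n\<in>N ` {..<m}. \<Sum>i\<in>{i\<in>{..<m}. N i = n}. (R i)\<^sup>2)"
      by (rule sum.image_gen) simp
    also have "\<dots> \<le> (\<Sum>n\<in>N ` {..<m}. e/4 * (1/2)^n)"
    proof (rule sum_mono)
      fix n assume "n \<in> N ` {..<m}"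
      have "(\<Sum>i\<in>{i\<in>{..<m}. N i = n}. (\<rho> i)\<^sup>2) \<le> E n"
        unfolding E_def
        by (rule finite_sum_le_infsum[OF sq]) (use N in \<open>auto simp: disks_meeting_def\<close>)
      then have "(\<Sum>i\<in>{i\<in>{..<m}. N i = n}. (R i)\<^sup>2) \<le> (c n)\<^sup>2 * E n"
        by (simp add: R_def power_mult_distrib flip: sum_distrib_left) (simp add: mult_left_mono)
      also have "(c n)\<^sup>2 = e/4 * (1/2)^n / (1 + E n)"
        unfolding c_def using e E0[of n] by (intro real_sqrt_pow2) simp
      also have "\<dots> * E n \<le> e/4 * (1/2)^n"
      proof -
        have "E n / (1 + E n) \<le> 1" using E0[of n] by simp
        then have "(e/4 * (1/2)^n) * (E n / (1 + E n)) \<le> (e/4 * (1/2)^n) * 1"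
          using e by (intro mult_left_mono) auto
        then show ?thesis by simp
      qed
      finally show "(\<Sum>i\<in>{i\<in>{..<m}. N i = n}. (R i)\<^sup>2) \<le> e/4 * (1/2)^n" .
    qed
    also have "\<dots> \<le> (\<Sum>n. e/4 * (1/2)^n)"
      using e by (intro sum_le_suminf summable_mult summable_geometric) auto
    also have "\<dots> = e/2"
      using sums_unique[OF sums_mult[OF geometric_sums[of "1/2 :: real"], of "e/4"]] by simp
    finally show ?thesis .
  qed
  have "(\<Sum>i. ennreal ((R i)\<^sup>2)) \<le> ennreal (e/2)"
    unfolding suminf_eq_SUP by (intro SUP_least) (use part in \<open>auto intro!: ennreal_leI\<close>)
  also have "\<dots> < ennreal e" using e by (simp add: ennreal_less_iff)
  finally have small: "(\<Sum>i. ennreal ((R i)\<^sup>2)) < ennreal e" .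
  have "path_sum Q R \<gamma> \<ge> 1" if "\<gamma> \<in> paths_in \<Omega>" "path_sum Q \<rho> \<gamma> = \<infinity>" for \<gamma>
  proof -
    have "bounded (trace \<gamma>)" using that(1) by (simp add: paths_in_def bounded_trace)
    then obtain b where b: "\<And>z. z \<in> trace \<gamma> \<Longrightarrow> norm z \<le> b" by (auto simp: bounded_iff)
    obtain n where n: "b < real n" using reals_Archimedean2 by blast
    have Nn: "N i \<le> n" if "i \<in> disks_meeting Q (trace \<gamma>)" for i
    proof (rule Nle)
      show "Q i \<inter> ball 0 (real n) \<noteq> {}" using that b n by (fastforce simp: disks_meeting_def)
    qed
    \<comment> \<open>A bounded path meets disks of finitely many layers only, so the weights are
      bounded below along it and the weighted sum stays infinite, in particular at least 1.\<close>
    define d where "d = Min (c ` {..n})"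
    have d: "d > 0" "\<And>k. k \<le> n \<Longrightarrow> d \<le> c k" unfolding d_def using c0 by (auto simp: Min_gr_iff)
    have "ennreal d * path_sum Q \<rho> \<gamma> = path_sum Q (\<lambda>i. d * \<rho> i) \<gamma>"
      unfolding path_sum_suminf using d \<rho>
      by (subst ennreal_suminf_cmult[symmetric]) (auto simp: ennreal_mult' mult.assoc)
    also have "\<dots> \<le> path_sum Q R \<gamma>"
      using Nn d(2) \<rho> by (intro path_sum_mono) (auto simp: R_def intro!: mult_right_mono)
    finally have "path_sum Q R \<gamma> = \<infinity>"
      using that d(1) by (simp add: ennreal_mult_top top_unique)
    then show ?thesis by simp
  qed
  then show "\<exists>\<rho>' \<Gamma>0. (\<forall>i. \<rho>' i \<ge> 0) \<and> \<Gamma>0 \<subseteq> {\<gamma>\<in>paths_in \<Omega>. path_sum Q \<rho> \<gamma> = \<infinity>} \<and> exceptional_paths v (carpet \<Omega> Q) \<Gamma>0 \<and>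
        (\<forall>\<gamma>\<in>{\<gamma>\<in>paths_in \<Omega>. path_sum Q \<rho> \<gamma> = \<infinity>} - \<Gamma>0. path_sum Q \<rho>' \<gamma> \<ge> 1) \<and> (\<Sum>i. ennreal ((\<rho>' i)\<^sup>2)) < ennreal e"
    using R0 small by (intro exI[of _ R] exI[of _ "{}"]) auto
qed

section \<open>Arc length\<close>

lemma path_length_upper:
  assumes "mono_on {..n} t" "t ` {..n} \<subseteq> {a..b}"
  shows "(\<Sum>k<n. ennreal (dist (f (t k)) (f (t (Suc k))))) \<le> path_length f a b"
  unfolding path_length_def
  by (rule SUP_upper2[of "(n, t)"]) (use assms in auto)

lemma path_length_least:
  assumes "\<And>n t. mono_on {..n} t \<Longrightarrow> t ` {..n} \<subseteq> {a..b} \<Longrightarrow>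
     (\<Sum>k<n. ennreal (dist (f (t k)) (f (t (Suc k))))) \<le> M"
  shows "path_length f a b \<le> M"
  unfolding path_length_def by (rule SUP_least) (use assms in auto)

lemma dist_le_path_length:
  assumes "a \<le> s" "s \<le> t" "t \<le> b"
  shows "ennreal (dist (f s) (f t)) \<le> path_length f a b"
proof -
  have "(\<Sum>k<1. ennreal (dist (f ((\<lambda>k. if k = (0::nat) then s else t) k)) (f ((\<lambda>k. if k = (0::nat) then s else t) (Suc k)))))
    \<le> path_length f a b"
    by (rule path_length_upper) (use assms in \<open>auto simp: mono_on_def\<close>)
  then show ?thesis by simp
qed

lemma path_length_mono: "a \<le> a' \<Longrightarrow> b' \<le> b \<Longrightarrow> path_length f a' b' \<le> path_length f a b"
  by (rule path_length_least, rule path_length_upper) (assumption, fastforce)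

lemma path_length_refl [simp]: "path_length f a a = 0"
proof -
  have "path_length f a a \<le> 0"
  proof (rule path_length_least)
    fix n and t :: "nat \<Rightarrow> real" assume "t ` {..n} \<subseteq> {a..a}"
    then have "t k = a" if "k \<le> n" for k using that by auto
    then show "(\<Sum>k<n. ennreal (dist (f (t k)) (f (t (Suc k))))) \<le> 0" by simp
  qed
  then show ?thesis by simp
qed

text \<open>Truncating the partition at \<open>b\<close> from both sides, by \<open>min\<close> and
  \<open>max\<close>, avoids inserting \<open>b\<close> into it. Only a step that straddles
  \<open>b\<close> needs the triangle inequality.\<close>

lemma path_length_le_add:
  assumes t: "mono_on {..n} t" "t ` {..n} \<subseteq> {a..c}" and b: "a \<le> b" "b \<le> c"
  shows "(\<Sum>k<n. ennreal (dist (f (t k)) (f (t (Suc k))))) \<le>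
     (\<Sum>k<n. ennreal (dist (f (min (t k) b)) (f (min (t (Suc k)) b)))) +
     (\<Sum>k<n. ennreal (dist (f (max (t k) b)) (f (max (t (Suc k)) b))))"
  unfolding sum.distrib[symmetric]
proof (rule sum_mono)
  fix k assume "k \<in> {..<n}"
  then have le: "t k \<le> t (Suc k)" using t(1) by (auto simp: mono_on_def)
  have "dist (f (t k)) (f (t (Suc k))) \<le> dist (f (min (t k) b)) (f (min (t (Suc k)) b)) +
    dist (f (max (t k) b)) (f (max (t (Suc k)) b))"
    using le dist_triangle[of "f (t k)" "f (t (Suc k))" "f b"] by (auto simp: min_def max_def)
  then show "ennreal (dist (f (t k)) (f (t (Suc k)))) \<le> ennreal (dist (f (min (t k) b)) (f (min (t (Suc k)) b))) +
    ennreal (dist (f (max (t k) b)) (f (max (t (Suc k)) b)))"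
    by (metis ennreal_leI ennreal_plus zero_le_dist)
qed

lemma mono_on_min_max:
  fixes t :: "nat \<Rightarrow> real"
  assumes "mono_on A t"
  shows "mono_on A (\<lambda>k. min (t k) b)" "mono_on A (\<lambda>k. max (t k) b)"
  by (rule mono_onI; rule min.mono max.mono; simp add: mono_onD[OF assms])+

lemma sum_lessThan_add:
  fixes g :: "nat \<Rightarrow> ennreal"
  shows "(\<Sum>k<n + m. g k) = (\<Sum>k<n. g k) + (\<Sum>k<m. g (n + k))"
  by (induction m) (auto simp: add.assoc)

lemma path_length_add:
  assumes "a \<le> b" "b \<le> c"
  shows "path_length f a c = path_length f a b + path_length f b c"
proof (rule antisym)
  show "path_length f a c \<le> path_length f a b + path_length f b c"
  proof (rule path_length_least)
    fix n :: nat and t assume t: "mono_on {..n} t" "t ` {..n} \<subseteq> {a..c}"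
    have "(\<Sum>k<n. ennreal (dist (f (min (t k) b)) (f (min (t (Suc k)) b)))) \<le> path_length f a b"
      by (rule path_length_upper[OF mono_on_min_max(1)[OF t(1)]]) (use t assms in auto)
    moreover have "(\<Sum>k<n. ennreal (dist (f (max (t k) b)) (f (max (t (Suc k)) b)))) \<le> path_length f b c"
      by (rule path_length_upper[OF mono_on_min_max(2)[OF t(1)]]) (use t assms in auto)
    ultimately show "(\<Sum>k<n. ennreal (dist (f (t k)) (f (t (Suc k))))) \<le> path_length f a b + path_length f b c"
      using path_length_le_add[OF t assms, of f] by (meson add_mono order_trans)
  qed
  have *: "(\<Sum>k<n. ennreal (dist (f (t k)) (f (t (Suc k))))) + (\<Sum>k<m. ennreal (dist (f (s k)) (f (s (Suc k)))))
      \<le> path_length f a c"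
    if t: "mono_on {..n} t" "t ` {..n} \<subseteq> {a..b}" and s: "mono_on {..m} s" "s ` {..m} \<subseteq> {b..c}" for n m :: nat and t s :: "nat \<Rightarrow> real"
  proof -
    \<comment> \<open>Concatenation: indices up to \<open>n\<close> run through \<open>t\<close>,
      the next \<open>m + 1\<close> through \<open>s\<close>. The additional step from
      \<open>t n\<close> to \<open>s 0\<close> can only increase the sum.\<close>
    define r where "r k = (if k \<le> n then t k else s (k - Suc n))" for k
    have t': "t k \<in> {a..b}" if "k \<le> n" for k using t that by auto
    have s': "s k \<in> {b..c}" if "k \<le> m" for k using s that by auto
    have "mono_on {..n + Suc m} r"
    proof (rule mono_onI)
      fix i j assume ij: "i \<in> {..n + Suc m}" "j \<in> {..n + Suc m}" "i \<le> j"
      consider "j \<le> n" | "i \<le> n" "n < j" | "n < i" by linarith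
      then show "r i \<le> r j"
      proof cases
        case 1
        then show ?thesis using t(1) ij by (auto simp: r_def mono_on_def)
      next
        case 2
        then have "t i \<le> b" "b \<le> s (j - Suc n)" using t'[of i] s'[of "j - Suc n"] ij by auto
        then show ?thesis using 2 by (auto simp: r_def)
      next
        case 3
        then have "s (i - Suc n) \<le> s (j - Suc n)" using 3 ij by (intro mono_onD[OF s(1)]) auto
        then show ?thesis using 3 ij by (simp add: r_def)
      qed
    qed
    moreover have "r ` {..n + Suc m} \<subseteq> {a..c}"
    proof
      fix x assume "x \<in> r ` {..n + Suc m}"
      then obtain k where k: "x = r k" "k \<le> n + Suc m" by auto
      then have "k \<le> n \<and> t k \<in> {a..b} \<or> \<not> k \<le> n \<and> s (k - Suc n) \<in> {b..c}"
        using t'[of k] s'[of "k - Suc n"] by auto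
      then show "x \<in> {a..c}" using assms k by (auto simp: r_def)
    qed
    ultimately have le: "(\<Sum>k<n + Suc m. ennreal (dist (f (r k)) (f (r (Suc k))))) \<le> path_length f a c"
      by (rule path_length_upper)
    have eq: "(\<Sum>k<n + Suc m. ennreal (dist (f (r k)) (f (r (Suc k))))) =
        (\<Sum>k<n. ennreal (dist (f (r k)) (f (r (Suc k))))) + (\<Sum>k<Suc m. ennreal (dist (f (r (n + k))) (f (r (Suc (n + k))))))"
      by (rule sum_lessThan_add)
    have "(\<Sum>k<n. ennreal (dist (f (r k)) (f (r (Suc k))))) + (\<Sum>k<Suc m. ennreal (dist (f (r (n + k))) (f (r (Suc (n + k))))))
      \<ge> (\<Sum>k<n. ennreal (dist (f (t k)) (f (t (Suc k))))) + (\<Sum>k<m. ennreal (dist (f (s k)) (f (s (Suc k)))))"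
    proof (rule add_mono)
      show "(\<Sum>k<n. ennreal (dist (f (t k)) (f (t (Suc k))))) \<le> (\<Sum>k<n. ennreal (dist (f (r k)) (f (r (Suc k)))))"
        by (intro sum_mono) (auto simp: r_def)
      show "(\<Sum>k<m. ennreal (dist (f (s k)) (f (s (Suc k))))) \<le> (\<Sum>k<Suc m. ennreal (dist (f (r (n + k))) (f (r (Suc (n + k))))))"
        unfolding sum.lessThan_Suc_shift by (rule add_increasing) (auto intro!: sum_mono simp: r_def)
    qed
    then show ?thesis using le unfolding eq by (rule order_trans)
  qed
  show "path_length f a b + path_length f b c \<le> path_length f a c"
  proof -
    let ?P = "\<lambda>a b. {(n :: nat, t :: nat \<Rightarrow> real). mono_on {..n} t \<and> t ` {..n} \<subseteq> {a..b}}"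
    let ?g = "\<lambda>(n, t). \<Sum>k<n. ennreal (dist (f (t k)) (f (t (Suc k))))"
    have ne: "?P a b \<noteq> {}" "?P b c \<noteq> {}"
      using assms by (auto intro!: exI[of _ 0] exI[of _ "\<lambda>_. b"] simp: mono_on_def)
    have "(SUP p\<in>?P a b. ?g p) + (SUP q\<in>?P b c. ?g q) = (SUP p\<in>?P a b. ?g p + (SUP q\<in>?P b c. ?g q))"
      using ne by (simp add: ennreal_SUP_add_left)
    also have "\<dots> = (SUP p\<in>?P a b. SUP q\<in>?P b c. ?g p + ?g q)"
      using ne by (simp add: ennreal_SUP_add_right)
    also have "\<dots> \<le> path_length f a c"
      using * by (intro SUP_least) (simp only: mem_Collect_eq case_prod_beta)
    finally show ?thesis by (simp add: path_length_def)
  qed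
qed

lemma path_length_reflect: "path_length (\<lambda>x. f (- x)) (- b) (- a) = path_length f a b"
proof -
  have *: "path_length (\<lambda>x. f (- x)) (- b) (- a) \<le> path_length f a b" for f a b
  proof (rule path_length_least)
    fix n and t :: "nat \<Rightarrow> real" assume t: "mono_on {..n} t" "t ` {..n} \<subseteq> {-b..-a}"
    define s where "s k = - t (n - k)" for k
    have "mono_on {..n} s" using t(1) by (auto simp: s_def mono_on_def)
    moreover have "s ` {..n} \<subseteq> {a..b}"
    proof
      fix x assume "x \<in> s ` {..n}"
      then obtain k where k: "x = s k" by auto
      have "t (n - k) \<in> {-b..-a}" using t(2) by (rule subsetD) auto
      then show "x \<in> {a..b}" using k by (auto simp: s_def)
    qed
    ultimately have "(\<Sum>k<n. ennreal (dist (f (s k)) (f (s (Suc k))))) \<le> path_length f a b"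
      by (rule path_length_upper)
    moreover have "(\<Sum>k<n. ennreal (dist (f (- t k)) (f (- t (Suc k))))) = (\<Sum>k<n. ennreal (dist (f (s k)) (f (s (Suc k)))))"
      by (subst sum.nat_diff_reindex[symmetric]) (auto simp: s_def Suc_diff_Suc dist_commute intro!: sum.cong)
    ultimately show "(\<Sum>k<n. ennreal (dist (f (- t k)) (f (- t (Suc k))))) \<le> path_length f a b" by simp
  qed
  show ?thesis using *[of f b a] *[of "\<lambda>x. f (- x)" "- a" "- b"] by simp
qed

text \<open>A monotone sequence with two values jumps at most once; the sum telescopes through the
  potential \<open>p\<close>.\<close>

lemma sum_dist_two_values:
  fixes s :: "nat \<Rightarrow> real"
  assumes "mono_on {..n} s" "\<And>k. k \<le> n \<Longrightarrow> s k = c \<or> s k = d" "c < d"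
  shows "(\<Sum>k<n. dist (f (s k)) (f (s (Suc k)))) \<le> dist (f c) (f d)"
proof -
  define p where "p x = (if x = c then 0 else dist (f c) (f d))" for x
  have "(\<Sum>k<n. dist (f (s k)) (f (s (Suc k)))) = (\<Sum>k<n. p (s (Suc k)) - p (s k))"
  proof (rule sum.cong)
    fix k assume "k \<in> {..<n}"
    then have "s k \<le> s (Suc k)" "s k = c \<or> s k = d" "s (Suc k) = c \<or> s (Suc k) = d"
      using assms by (auto simp: mono_on_def)
    then show "dist (f (s k)) (f (s (Suc k))) = p (s (Suc k)) - p (s k)"
      using assms(3) by (auto simp: p_def)
  qed simp
  also have "\<dots> = p (s n) - p (s 0)" by (rule sum_lessThan_telescope)
  also have "\<dots> \<le> dist (f c) (f d)" by (simp add: p_def)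
  finally show ?thesis .
qed

text \<open>This is right continuity of the length function. Take a partition of
  \<open>{c..b}\<close> whose sum is within \<open>e\<close> of the length, and \<open>d\<close> not
  beyond any of its points after \<open>c\<close>. Cut off at \<open>d\<close>, the partition has at
  most one step of nonzero size, which is at most \<open>e\<close> by continuity; so all but
  \<open>2 * e\<close> of the length lies in \<open>{d..b}\<close>.\<close>

lemma path_length_right_small:
  assumes f: "continuous_on {a..b} f" and fin: "path_length f a b < \<infinity>"
    and c: "a \<le> c" "c < b" and e: "e > 0"
  shows "\<exists>d. c < d \<and> d \<le> b \<and> path_length f c d \<le> ennreal (2 * e)"
proof -
  have fcb: "path_length f c b < \<infinity>" using path_length_mono[of a c b b f] c fin by (simp add: le_less_trans)
  have "\<exists>n t. mono_on {..n} t \<and> t ` {..n} \<subseteq> {c..b} \<and>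
     path_length f c b < (\<Sum>k<n. ennreal (dist (f (t k)) (f (t (Suc k))))) + ennreal e"
  proof (rule ccontr)
    assume *: "\<not> ?thesis"
    let ?P = "{(n :: nat, t :: nat \<Rightarrow> real). mono_on {..n} t \<and> t ` {..n} \<subseteq> {c..b}}"
    let ?g = "\<lambda>(n, t). \<Sum>k<n. ennreal (dist (f (t k)) (f (t (Suc k))))"
    have ne: "?P \<noteq> {}" using c by (auto intro!: exI[of _ 0] exI[of _ "\<lambda>_. b"] simp: mono_on_def)
    have "(SUP p\<in>?P. ?g p + ennreal e) \<le> path_length f c b"
    proof (rule SUP_least)
      fix p assume "p \<in> ?P"
      then show "?g p + ennreal e \<le> path_length f c b"
        using * by (cases p) (simp add: not_less)
    qed
    moreover have "(SUP p\<in>?P. ?g p + ennreal e) = path_length f c b + ennreal e"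
      using ne by (simp add: ennreal_SUP_add_left path_length_def)
    ultimately have "path_length f c b + ennreal e \<le> path_length f c b" by simp
    moreover obtain r where "path_length f c b = ennreal r" "r \<ge> 0" using fcb by (cases "path_length f c b") auto
    ultimately show False using e by (simp add: ennreal_plus[symmetric] del: ennreal_plus)
  qed
  then obtain n t where t: "mono_on {..n} t" "t ` {..n} \<subseteq> {c..b}"
    and big: "path_length f c b < (\<Sum>k<n. ennreal (dist (f (t k)) (f (t (Suc k))))) + ennreal e" by blast
  from f c obtain h where h: "h > 0" "\<And>x. x \<in> {a..b} \<Longrightarrow> dist x c < h \<Longrightarrow> dist (f x) (f c) < e"
    unfolding continuous_on_iff using e by (metis atLeastAtMost_iff less_eq_real_def)
  \<comment> \<open>The minimum is at most \<open>b\<close>, at most every partition point beyond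
    \<open>c\<close>, and within the continuity distance \<open>h\<close> of
    \<open>c\<close>.\<close>
  define F where "F = insert b (insert (c + h/2) (t ` {k. k \<le> n \<and> t k > c}))"
  define d where "d = Min F"
  have finF: "finite F" "F \<noteq> {}" by (auto simp: F_def)
  have dc: "c < d" unfolding d_def using finF c h by (auto simp: Min_gr_iff F_def)
  have dF: "d \<le> x" if "x \<in> F" for x unfolding d_def using finF that by auto
  have db: "d \<le> b" "d \<le> c + h/2" using dF by (auto simp: F_def)
  have tk: "min (t k) d = c \<or> min (t k) d = d" if "k \<le> n" for k
  proof (cases "t k > c")
    case True
    then have "d \<le> t k" using that by (intro dF) (auto simp: F_def)
    then show ?thesis by auto
  next
    case False
    then have "t k = c" using t(2) that by force
    then show ?thesis using dc by auto
  qed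
  have "(\<Sum>k<n. dist (f (min (t k) d)) (f (min (t (Suc k)) d))) \<le> dist (f c) (f d)"
    by (rule sum_dist_two_values[OF mono_on_min_max(1)[OF t(1)] tk dc])
  also have "dist (f c) (f d) \<le> e" using h(2)[of d] db dc c h(1) by (auto simp: dist_commute dist_real_def)
  finally have s1: "(\<Sum>k<n. ennreal (dist (f (min (t k) d)) (f (min (t (Suc k)) d)))) \<le> ennreal e"
    by (simp add: sum_ennreal ennreal_leI)
  have s2: "(\<Sum>k<n. ennreal (dist (f (max (t k) d)) (f (max (t (Suc k)) d)))) \<le> path_length f d b"
    by (rule path_length_upper[OF mono_on_min_max(2)[OF t(1)]]) (use t db in auto)
  have "path_length f c d + path_length f d b = path_length f c b"
    using path_length_add[of c d b f] dc db by simp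
  also have "\<dots> \<le> (ennreal e + path_length f d b) + ennreal e"
  proof -
    have "(\<Sum>k<n. ennreal (dist (f (t k)) (f (t (Suc k))))) \<le> ennreal e + path_length f d b"
      using path_length_le_add[OF t, of d f] dc db add_mono[OF s1 s2] by (meson less_imp_le order_trans)
    from add_right_mono[OF this, of "ennreal e"] show ?thesis using big by (meson less_imp_le order_trans)
  qed
  also have "\<dots> = ennreal (2 * e) + path_length f d b" using e by (simp add: ac_simps ennreal_mult' flip: mult_2)
  finally have "path_length f c d + path_length f d b \<le> ennreal (2 * e) + path_length f d b" .
  moreover have "path_length f d b < \<infinity>" using path_length_mono[of c d b b f] dc fcb by (simp add: le_less_trans)
  ultimately have "path_length f c d \<le> ennreal (2 * e)"
    by (metis add.commute ennreal_add_left_cancel_le infinity_ennreal_def less_irrefl)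
  then show ?thesis using dc db by blast
qed

lemma path_length_left_small:
  assumes f: "continuous_on {a..b} f" and fin: "path_length f a b < \<infinity>"
    and c: "a < c" "c \<le> b" and e: "e > 0"
  shows "\<exists>d. a \<le> d \<and> d < c \<and> path_length f d c \<le> ennreal (2 * e)"
proof -
  have "continuous_on {-b..-a} (\<lambda>x. f (- x))"
    by (rule continuous_on_compose2[OF f]) (auto intro!: continuous_intros)
  moreover have "path_length (\<lambda>x. f (- x)) (-b) (-a) < \<infinity>" using fin path_length_reflect[of f b a] by simp
  ultimately obtain d where d: "- c < d" "d \<le> - a" "path_length (\<lambda>x. f (- x)) (- c) d \<le> ennreal (2 * e)"
    using path_length_right_small[of "-b" "-a" "\<lambda>x. f (- x)" "-c" e] c e by auto
  then show ?thesis using path_length_reflect[of f c "- d"] by (intro exI[of _ "- d"]) auto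
qed

lemma continuous_on_path_length:
  assumes f: "continuous_on {a..b} f" and fin: "path_length f a b < \<infinity>" and ab: "a \<le> b"
  shows "continuous_on {a..b} (\<lambda>t. enn2real (path_length f a t))"
proof -
  define V where "V t = enn2real (path_length f a t)" for t
  have finV: "path_length f s t < \<infinity>" if "a \<le> s" "t \<le> b" for s t
    using path_length_mono[OF that, of f] fin by (simp add: le_less_trans)
  have Vd: "V t = V s + enn2real (path_length f s t)" if "a \<le> s" "s \<le> t" "t \<le> b" for s t
    unfolding V_def using path_length_add[of a s t f] finV[of a s] finV[of s t] that by (simp add: enn2real_plus)
  have "\<exists>\<delta>>0. \<forall>x\<in>{a..b}. \<bar>x - c\<bar> < \<delta> \<longrightarrow> \<bar>V x - V c\<bar> < e" if c: "c \<in> {a..b}" and e: "e > 0" for c e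
  proof -
    have "\<exists>\<delta>>0. \<forall>x\<in>{a..b}. c \<le> x \<and> x - c < \<delta> \<longrightarrow> \<bar>V x - V c\<bar> < e"
    proof (cases "c < b")
      case True
      then obtain d where d: "c < d" "d \<le> b" "path_length f c d \<le> ennreal (2 * (e/3))"
        using path_length_right_small[OF f fin, of c "e/3"] c e by auto
      have "\<bar>V x - V c\<bar> < e" if "x \<in> {a..b}" "c \<le> x" "x - c < d - c" for x
      proof -
        have "path_length f c x \<le> ennreal (2 * (e/3))" using path_length_mono[of c c x d f] d that by auto
        then have "enn2real (path_length f c x) \<le> 2 * (e/3)" using e by (intro enn2real_leI) auto
        then show ?thesis using Vd[of c x] that c e enn2real_nonneg[of "path_length f c x"] by auto
      qed
      then show ?thesis using d by (intro exI[of _ "d - c"]) auto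
    next
      case False
      then show ?thesis using e by (intro exI[of _ 1]) (use c in force)
    qed
    then obtain d1 where d1: "d1 > 0" "\<forall>x\<in>{a..b}. c \<le> x \<and> x - c < d1 \<longrightarrow> \<bar>V x - V c\<bar> < e" by blast
    have "\<exists>\<delta>>0. \<forall>x\<in>{a..b}. x \<le> c \<and> c - x < \<delta> \<longrightarrow> \<bar>V x - V c\<bar> < e"
    proof (cases "a < c")
      case True
      then obtain d where d: "a \<le> d" "d < c" "path_length f d c \<le> ennreal (2 * (e/3))"
        using path_length_left_small[OF f fin, of c "e/3"] c e by auto
      have "\<bar>V x - V c\<bar> < e" if "x \<in> {a..b}" "x \<le> c" "c - x < c - d" for x
      proof -
        have "path_length f x c \<le> ennreal (2 * (e/3))" using path_length_mono[of d x c c f] d that by auto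
        then have "enn2real (path_length f x c) \<le> 2 * (e/3)" using e by (intro enn2real_leI) auto
        then show ?thesis using Vd[of x c] that c e enn2real_nonneg[of "path_length f x c"] by auto
      qed
      then show ?thesis using d by (intro exI[of _ "c - d"]) auto
    next
      case False
      then show ?thesis using e by (intro exI[of _ 1]) (use c in force)
    qed
    then obtain d2 where d2: "d2 > 0" "\<forall>x\<in>{a..b}. x \<le> c \<and> c - x < d2 \<longrightarrow> \<bar>V x - V c\<bar> < e" by blast
    show ?thesis
    proof (intro exI[of _ "min d1 d2"] conjI ballI impI)
      fix x assume "x \<in> {a..b}" "\<bar>x - c\<bar> < min d1 d2"
      then show "\<bar>V x - V c\<bar> < e" using d1 d2 by (cases "c \<le> x") auto
    qed (use d1 d2 in auto)
  qed
  then have "continuous_on {a..b} V" unfolding continuous_on_iff dist_real_def by blast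
  then show ?thesis unfolding V_def .
qed

text \<open>The density is infinite on \<open>S\<close>, so an integral below 1 vanishes and the
  arc-length parameters of points in \<open>S\<close> form a null set. The arc-length
  parametrization is 1-Lipschitz and maps it to a set of zero length.\<close>

lemma hausdorff_null_if_line_integral_small:
  assumes S: "closed S" and f: "continuous_on {a..b} f" and fin: "path_length f a b < \<infinity>" and ab: "a \<le> b"
    and small: "rectifiable_line_integral (\<lambda>x. \<infinity> * indicator S x) f a b < 1"
  shows "hausdorff_measure 1 (f ` {a..b} \<inter> S) = 0"
proof -
  define V where "V t = enn2real (path_length f a t)" for t
  define len where "len = V b"
  define al where "al = arclength_param f a b"
  have finV: "path_length f s t < \<infinity>" if "a \<le> s" "t \<le> b" for s t
    using path_length_mono[OF that, of f] fin by (simp add: le_less_trans)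
  have LV: "path_length f a t = ennreal (V t)" if "t \<in> {a..b}" for t
    unfolding V_def using finV[of a t] that by simp
  have V0: "V t \<ge> 0" for t unfolding V_def by simp
  have dV: "dist (f s) (f t) \<le> \<bar>V s - V t\<bar>" if "s \<in> {a..b}" "t \<in> {a..b}" for s t
  proof -
    have *: "dist (f s) (f t) \<le> V t - V s" if "s \<in> {a..b}" "t \<in> {a..b}" "s \<le> t" for s t
    proof -
      have "ennreal (V s) + ennreal (dist (f s) (f t)) \<le> path_length f a s + path_length f s t"
        using LV[of s] dist_le_path_length[of s s t t f] that by (intro add_mono) auto
      also have "\<dots> = ennreal (V t)" using path_length_add[of a s t f] LV[of t] that by simp
      finally show ?thesis using V0[of s] V0[of t] by (simp flip: ennreal_plus)
    qed
    show ?thesis using *[of s t] *[of t s] that by (cases "s \<le> t") (auto simp: dist_commute)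
  qed
  have Vcont: "continuous_on {a..b} V" unfolding V_def by (rule continuous_on_path_length[OF f fin ab])
  \<comment> \<open>By continuity of the length function every \<open>s\<close> up to the full
    length is the length of an initial arc, so the choice in \<open>arclength_param\<close> has a
    witness.\<close>
  have surj: "\<exists>t\<in>{a..b}. V t = s" if "s \<in> {0..len}" for s
  proof -
    have "V a \<le> s" "s \<le> V b" using that by (auto simp: V_def len_def)
    from IVT'[OF this ab Vcont] show ?thesis by auto
  qed
  have alV: "\<exists>t\<in>{a..b}. V t = s \<and> al s = f t" if s: "s \<in> {0..len}" for s
  proof -
    obtain t where t: "t \<in> {a..b}" "V t = s" using surj[OF s] by blast
    define t' where "t' = (SOME t. t \<in> {a..b} \<and> path_length f a t = ennreal s)"
    have "t' \<in> {a..b} \<and> path_length f a t' = ennreal s" unfolding t'_def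
      by (rule someI[of _ t]) (use t LV in auto)
    then have "t' \<in> {a..b} \<and> V t' = s" using s unfolding V_def by simp
    moreover have "al s = f t'" unfolding al_def arclength_param_def t'_def ..
    ultimately show ?thesis by blast
  qed
  have lip: "dist (al s) (al s') \<le> \<bar>s - s'\<bar>" if s: "s \<in> {0..len}" "s' \<in> {0..len}" for s s'
  proof -
    obtain t where t: "t \<in> {a..b}" "V t = s" "al s = f t" using alV[OF s(1)] by blast
    obtain t' where t': "t' \<in> {a..b}" "V t' = s'" "al s' = f t'" using alV[OF s(2)] by blast
    show ?thesis using dV[OF t(1) t'(1)] t t' by simp
  qed
  define A where "A = {s\<in>{0..len}. al s \<in> S}"
  have "continuous_on {0..len} al"
    unfolding continuous_on_iff
  proof (intro ballI allI impI)
    fix x and e :: real assume "x \<in> {0..len}" "e > 0"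
    then show "\<exists>d>0. \<forall>x'\<in>{0..len}. dist x' x < d \<longrightarrow> dist (al x') (al x) < e"
      using lip by (intro exI[of _ e]) (fastforce simp: dist_real_def)
  qed
  then have "closed A" unfolding A_def using S continuous_closed_preimage[of "{0..len}" al S]
    by (simp add: vimage_def Int_def)
  then have Ab: "A \<in> sets lborel" by simp
  have "rectifiable_line_integral (\<lambda>x. \<infinity> * indicator S x) f a b = (\<integral>\<^sup>+s. \<infinity> * indicator A s \<partial>lborel)"
    unfolding rectifiable_line_integral_def
    by (intro nn_integral_cong) (auto simp: A_def al_def[symmetric] len_def V_def split: split_indicator)
  also have "\<dots> = \<infinity> * emeasure lborel A" using Ab by (simp add: nn_integral_cmult_indicator)
  finally have "\<infinity> * emeasure lborel A < 1" using small by simp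
  then have "emeasure lborel A = 0" by (metis ennreal_top_mult infinity_ennreal_def not_less top_greatest)
  then have "A \<in> null_sets lborel" using Ab by (auto simp: null_sets_def)
  then have "negligible A" by (simp add: negligible_iff_null_sets null_sets_completionI)
  then have "hausdorff_measure 1 (al ` A) = 0"
    by (rule hausdorff_null_image[of A 0 len]) (use lip in \<open>auto simp: A_def\<close>)
  moreover have "f ` {a..b} \<inter> S \<subseteq> al ` A"
  proof
    fix z assume z: "z \<in> f ` {a..b} \<inter> S"
    then obtain t where t: "t \<in> {a..b}" "z = f t" by auto
    have Vt: "V t \<in> {0..len}"
    proof -
      have "path_length f a t \<le> path_length f a b" using t by (intro path_length_mono) auto
      then show ?thesis using fin V0[of t] unfolding V_def len_def by (auto intro!: enn2real_mono)
    qed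
    \<comment> \<open>The chosen parameter may differ from \<open>t\<close>, but equal lengths force
      equal points.\<close>
    obtain t' where t': "t' \<in> {a..b}" "V t' = V t" "al (V t) = f t'" using alV[OF Vt] by blast
    then have "al (V t) = z" using dV[of t t'] t by simp
    then show "z \<in> al ` A" using Vt z by (auto simp: A_def intro!: image_eqI[of _ _ "V t"])
  qed
  ultimately show ?thesis using hausdorff_measure_mono[of "f ` {a..b} \<inter> S" "al ` A" 1] by simp
qed

lemma continuous_on_cpath:
  assumes "is_cpath \<gamma>" "A \<subseteq> fst \<gamma>" shows "continuous_on A (snd \<gamma>)"
proof -
  obtain h where h: "continuous_on (closure (fst \<gamma>)) h" "\<forall>t\<in>fst \<gamma>. h t = snd \<gamma> t"
    using assms(1) unfolding is_cpath_def by blast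
  have "continuous_on A h" using h(1) assms(2) closure_subset continuous_on_subset by (metis subset_trans)
  then show ?thesis by (rule continuous_on_eq) (use h assms in auto)
qed

lemma cpath_interval_subset:
  assumes "is_cpath \<gamma>" "a \<in> fst \<gamma>" "b \<in> fst \<gamma>" shows "{a..b} \<subseteq> fst \<gamma>"
  using assms unfolding is_cpath_def is_interval_1 by (meson atLeastAtMost_iff subsetI)

text \<open>The density that is infinite on the carpet has zero energy because the carpet has zero
  area, and in the weak version it is admissible for this family. The condition is put on compact
  subarcs, where finite length makes the length function continuous.\<close>

lemma carpet_modulus_non_hausdorff_null:
  assumes S: "closed (carpet \<Omega> Q)" "emeasure lborel (carpet \<Omega> Q) = 0"
  shows "carpet_modulus v \<Omega> Q {\<gamma>\<in>paths_in \<Omega>. \<exists>a\<in>fst \<gamma>. \<exists>b\<in>fst \<gamma>. a \<le> b \<and>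
     hausdorff_measure 1 (snd \<gamma> ` {a..b} \<inter> carpet \<Omega> Q) \<noteq> 0} = 0" (is "carpet_modulus v \<Omega> Q ?G = 0")
proof (rule carpet_modulus_null_if_exceptional)
  let ?S = "carpet \<Omega> Q"
  show "exceptional_paths v ?S ?G"
  proof (cases v)
    case Weak
    define l :: "complex \<Rightarrow> ennreal" where "l = (\<lambda>x. \<infinity> * indicator ?S x)"
    have lm: "l \<in> borel_measurable borel" unfolding l_def using S(1) by (intro borel_measurable_times_ennreal borel_measurable_indicator) auto
    have "(\<integral>\<^sup>+x. (l x)\<^sup>2 \<partial>lborel) = (\<integral>\<^sup>+x. \<infinity> * indicator ?S x \<partial>lborel)"
      by (intro nn_integral_cong) (auto simp: l_def power2_eq_square split: split_indicator)
    also have "\<dots> = 0" using S by (subst nn_integral_cmult_indicator) auto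
    finally have l0: "(\<integral>\<^sup>+x. (l x)\<^sup>2 \<partial>lborel) = 0" .
    have "line_integral l \<gamma> \<ge> 1" if "\<gamma> \<in> ?G" for \<gamma>
    proof (rule ccontr)
      assume "\<not> ?thesis"
      then have lt: "line_integral l \<gamma> < 1" by simp
      then have rec: "locally_rectifiable \<gamma>" unfolding line_integral_def by (auto split: if_splits)
      from that obtain a b where ab: "a \<in> fst \<gamma>" "b \<in> fst \<gamma>" "a \<le> b" and cp: "is_cpath \<gamma>"
        and ne: "hausdorff_measure 1 (snd \<gamma> ` {a..b} \<inter> ?S) \<noteq> 0" unfolding paths_in_def by blast
      have "rectifiable_line_integral l (snd \<gamma>) a b \<le> line_integral l \<gamma>"
        unfolding line_integral_def using rec ab by (auto intro!: SUP_upper2[of "(a, b)"])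
      then have "rectifiable_line_integral l (snd \<gamma>) a b < 1" using lt by simp
      then have "hausdorff_measure 1 (snd \<gamma> ` {a..b} \<inter> ?S) = 0"
        using S ab rec continuous_on_cpath[OF cp cpath_interval_subset[OF cp ab(1,2)]] unfolding l_def
        by (intro hausdorff_null_if_line_integral_small) (auto simp: locally_rectifiable_def)
      then show False using ne by simp
    qed
    then have "mod2 ?G = 0" unfolding mod2_eq_0_iff using lm l0 by (intro allI impI bexI[of _ l]) auto
    then show ?thesis using Weak by simp
  next
    case Strong
    have "hausdorff_measure 1 (trace \<gamma> \<inter> ?S) \<noteq> 0" if "\<gamma> \<in> ?G" for \<gamma>
    proof -
      from that obtain a b where ab: "a \<in> fst \<gamma>" "b \<in> fst \<gamma>" "a \<le> b" and cp: "is_cpath \<gamma>"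
        and ne: "hausdorff_measure 1 (snd \<gamma> ` {a..b} \<inter> ?S) \<noteq> 0" unfolding paths_in_def by blast
      have "snd \<gamma> ` {a..b} \<inter> ?S \<subseteq> trace \<gamma> \<inter> ?S"
        using cpath_interval_subset[OF cp ab(1,2)] by (auto simp: trace_def)
      from hausdorff_measure_mono[OF this, of 1] ne show ?thesis by auto
    qed
    then show ?thesis using Strong by simp
  qed
qed

section \<open>Geometry of the disks\<close>

lemma negligible_Collect_AE:
  assumes "AE x in lborel. P (x :: 'a::euclidean_space)"
  shows "negligible {x. \<not> P x}"
proof -
  obtain N where N: "{x \<in> space lborel. \<not> P x} \<subseteq> N" "emeasure lborel N = 0" "N \<in> sets lborel"
    using assms by (rule AE_E)
  then have "N \<in> null_sets (completion lborel)" by (intro null_sets_completionI) (auto simp: null_sets_def)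
  then have "negligible N" by (simp add: negligible_iff_null_sets)
  then show ?thesis using N(1) by (elim negligible_subset) auto
qed

lemma null_set_of_negligible:
  fixes N :: "'a::euclidean_space set"
  assumes "negligible N"
  obtains M where "N \<subseteq> M" "M \<in> null_sets lborel"
proof -
  have "N \<in> null_sets (completion lborel)" using assms by (simp add: negligible_iff_null_sets)
  then show ?thesis using that by (auto simp: null_sets_completion_iff2)
qed

lemma disks_meetingE:
  assumes "i \<in> disks_meeting Q V"
  obtains z where "z \<in> Q i" "z \<in> V"
  using assms by (auto simp: disks_meeting_def)

locale planar_carpet =
  fixes Q :: "nat \<Rightarrow> complex set"
  assumes rel_carpet: "relative_sierpinski_carpet UNIV Q"
begin

abbreviation S where "S \<equiv> carpet UNIV Q"

lemma Q_open: "open (Q i)"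
proof -
  have "open_jordan_region (Q i)" using rel_carpet by (simp add: relative_sierpinski_carpet_def)
  then obtain c where "simple_path c" "Q i = inside (path_image c)" by (auto simp: open_jordan_region_def)
  then show ?thesis by (simp add: closed_path_image open_inside simple_path_imp_path)
qed

lemma Q_bounded: "bounded (Q i)"
proof -
  have "compactly_contained (Q i) UNIV" using rel_carpet by (simp add: relative_sierpinski_carpet_def)
  then show ?thesis by (meson bounded_subset closure_subset compact_imp_bounded compactly_contained_def)
qed

lemma round_disks: "\<exists>K0\<ge>1. \<forall>i. \<exists>x r R. 0 < r \<and> R / r \<le> K0 \<and> ball x r \<subseteq> Q i \<and> Q i \<subseteq> ball x R"
  using rel_carpet by (simp add: relative_sierpinski_carpet_def)

lemma Q_nonempty: "Q i \<noteq> {}"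
proof -
  obtain x r where "0 < (r::real)" "ball x r \<subseteq> Q i" using round_disks by blast
  then show ?thesis using centre_in_ball by blast
qed

lemma closure_disjoint: "i \<noteq> j \<Longrightarrow> closure (Q i) \<inter> closure (Q j) = {}"
  using rel_carpet unfolding relative_sierpinski_carpet_def by blast

lemma Q_disjoint: "i \<noteq> j \<Longrightarrow> Q i \<inter> Q j = {}"
  using closure_disjoint[of i j] closure_subset by blast

lemma carpet_eq: "S = - (\<Union>i. Q i)" by (auto simp: carpet_def)

lemma S_closed: "closed S"
  unfolding carpet_eq using Q_open by (intro closed_Compl open_UN) auto

lemma S_null: "emeasure lborel S = 0"
  using rel_carpet by (simp add: relative_sierpinski_carpet_def)

lemma frontier_subset: "frontier (Q i) \<subseteq> S"
proof
  fix x assume x: "x \<in> frontier (Q i)"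
  have "x \<notin> Q j" for j
  proof (cases "j = i")
    case True
    then show ?thesis using x Q_open[of i] by (simp add: frontier_def interior_open)
  next
    case False
    then show ?thesis using x closure_disjoint[of i j] closure_subset[of "Q j"] by (auto simp: frontier_def)
  qed
  then show "x \<in> S" by (simp add: carpet_eq)
qed

lemma frontier_nonempty: "frontier (Q i) \<noteq> {}"
  by (metis Q_bounded Q_nonempty frontier_not_empty not_bounded_UNIV)

lemma frontier_subset_closure: "frontier (Q i) \<subseteq> closure (Q i)"
  by (simp add: frontier_def)

lemma carpet_interior_iff: "x \<in> carpet_interior UNIV Q \<longleftrightarrow> (\<forall>i. x \<notin> closure (Q i))"
proof -
  have "x \<in> closure (Q i) \<longleftrightarrow> x \<in> Q i \<or> x \<in> frontier (Q i)" for i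
    using Q_open[of i] closure_subset[of "Q i"] by (auto simp: frontier_def interior_open)
  then show ?thesis by (auto simp: carpet_interior_def carpet_eq)
qed

lemma diameter_pos: "0 < diameter (Q i)"
proof -
  obtain x where x: "x \<in> Q i" using Q_nonempty by blast
  then obtain e where e: "e > 0" "ball x e \<subseteq> Q i" using Q_open openE by blast
  have "x + complex_of_real (e/2) \<in> ball x e" using e by (simp add: dist_norm)
  then have "dist x (x + complex_of_real (e/2)) \<le> diameter (Q i)"
    using x e Q_bounded by (intro diameter_bounded_bound) auto
  then show ?thesis using e by (simp add: dist_norm)
qed

lemma dist_le_diameter: "x \<in> closure (Q i) \<Longrightarrow> y \<in> closure (Q i) \<Longrightarrow> dist x y \<le> diameter (Q i)"
  using diameter_bounded_bound[of "closure (Q i)" x y] Q_bounded[of i]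
  by (simp add: diameter_closure bounded_closure)

text \<open>With \<open>m\<close> the truncated diameter, each disk has a piece of area at least
  \<open>K1 * (m/2)^2\<close> within distance \<open>m/2\<close> of one of its points in the ball.
  The truncation at \<open>2 * R\<close> keeps these disjoint pieces in
  \<open>ball x (2 * R)\<close>, and comparing areas gives the constant
  \<open>16 * pi / K1\<close>.\<close>

lemma fatness_exists:
  "\<exists>C>0. \<forall>x R. \<forall>F. R > 0 \<longrightarrow> finite F \<longrightarrow> F \<subseteq> disks_meeting Q (ball x R) \<longrightarrow>
     (\<Sum>k\<in>F. (min (diameter (Q k)) (2 * R))\<^sup>2) \<le> C * R\<^sup>2"
proof -
  obtain K1 where K1: "K1 > 0" "\<And>i x r. x \<in> Q i \<Longrightarrow> 0 < r \<Longrightarrow> r < diameter (Q i) \<Longrightarrow>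
        emeasure lborel (ball x r \<inter> Q i) \<ge> ennreal (K1 * r\<^sup>2)"
    using rel_carpet unfolding relative_sierpinski_carpet_def by metis
  show ?thesis
  proof (intro exI[of _ "16 * pi / K1"] conjI allI impI)
    show "16 * pi / K1 > 0" using K1 by simp
    fix x :: complex and R :: real and F
    assume R: "R > 0" and F: "finite F" "F \<subseteq> disks_meeting Q (ball x R)"
    let ?m = "\<lambda>k. min (diameter (Q k)) (2 * R)"
    have le: "ennreal (K1 * (?m k / 2)\<^sup>2) \<le> emeasure lborel (ball x (2 * R) \<inter> Q k)" if k: "k \<in> F" for k
    proof -
      obtain z where z: "z \<in> Q k" "z \<in> ball x R" using F(2) k by (meson disks_meetingE subsetD)
      have m: "0 < ?m k / 2" "?m k / 2 < diameter (Q k)" "?m k / 2 \<le> R"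
        using diameter_pos[of k] R by (auto simp: min_def)
      have "ennreal (K1 * (?m k / 2)\<^sup>2) \<le> emeasure lborel (ball z (?m k / 2) \<inter> Q k)"
        by (rule K1(2)) (use z m in auto)
      also have "\<dots> \<le> emeasure lborel (ball x (2 * R) \<inter> Q k)"
      proof (rule emeasure_mono)
        have "dist x y < 2 * R" if "dist z y < ?m k / 2" for y
          using dist_triangle[of x y z] z(2) that m(3) by simp
        then show "ball z (?m k / 2) \<inter> Q k \<subseteq> ball x (2 * R) \<inter> Q k" by auto
      qed (use Q_open[of k] in auto)
      finally show ?thesis .
    qed
    have "ennreal (\<Sum>k\<in>F. K1 * (?m k / 2)\<^sup>2) = (\<Sum>k\<in>F. ennreal (K1 * (?m k / 2)\<^sup>2))"
      using K1 by (intro sum_ennreal[symmetric]) auto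
    also have "\<dots> \<le> (\<Sum>k\<in>F. emeasure lborel (ball x (2 * R) \<inter> Q k))" by (intro sum_mono le)
    also have "\<dots> = emeasure lborel (\<Union>k\<in>F. ball x (2 * R) \<inter> Q k)"
      using F(1) Q_disjoint Q_open by (intro sum_emeasure) (auto simp: disjoint_family_on_def)
    also have "\<dots> \<le> emeasure lborel (ball x (2 * R))" by (intro emeasure_mono) auto
    also have "\<dots> = ennreal (pi * (2 * R)\<^sup>2)" using R by (simp add: emeasure_ball unit_ball_vol_2)
    finally have "(\<Sum>k\<in>F. K1 * (?m k / 2)\<^sup>2) \<le> pi * (2 * R)\<^sup>2"
      by (subst (asm) ennreal_le_iff) auto
    then show "(\<Sum>k\<in>F. (?m k)\<^sup>2) \<le> 16 * pi / K1 * R\<^sup>2"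
      using K1(1) by (simp add: power_divide field_simps flip: sum_distrib_left sum_divide_distrib)
  qed
qed

definition fatness where
  "fatness = (SOME C. C > 0 \<and> (\<forall>x R. \<forall>F. R > 0 \<longrightarrow> finite F \<longrightarrow> F \<subseteq> disks_meeting Q (ball x R) \<longrightarrow>
     (\<Sum>k\<in>F. (min (diameter (Q k)) (2 * R))\<^sup>2) \<le> C * R\<^sup>2))"

lemma fatness: "fatness > 0"
  "R > 0 \<Longrightarrow> finite F \<Longrightarrow> F \<subseteq> disks_meeting Q (ball x R) \<Longrightarrow>
     (\<Sum>k\<in>F. (min (diameter (Q k)) (2 * R))\<^sup>2) \<le> fatness * R\<^sup>2"
  using someI_ex[OF fatness_exists, folded fatness_def] by blast+

text \<open>Each of these disks takes at least \<open>(min d (2 * R))^2\<close> of the bounded sum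
  in the fatness estimate.\<close>

lemma finite_large_disks:
  assumes "d > 0"
  shows "finite {k \<in> disks_meeting Q (ball x R). diameter (Q k) \<ge> d}" (is "finite ?B")
proof (cases "R > 0")
  case True
  let ?e = "(min d (2 * R))\<^sup>2"
  have e: "?e > 0" using True assms by (simp add: zero_less_power)
  have "card F \<le> nat \<lceil>fatness * R\<^sup>2 / ?e\<rceil>" if F: "F \<subseteq> ?B" "finite F" for F
  proof -
    have "real (card F) * ?e = (\<Sum>k\<in>F. ?e)" by simp
    also have "\<dots> \<le> (\<Sum>k\<in>F. (min (diameter (Q k)) (2 * R))\<^sup>2)"
      using F True assms by (intro sum_mono power_mono) auto
    also have "\<dots> \<le> fatness * R\<^sup>2" using F True by (intro fatness) auto
    finally have "real (card F) \<le> fatness * R\<^sup>2 / ?e" using e by (simp only: pos_le_divide_eq)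
    then show ?thesis by linarith
  qed
  then show ?thesis using finite_if_finite_subsets_card_bdd[of ?B] by blast
next
  case False
  then show ?thesis by (simp add: disks_meeting_def ball_empty)
qed

text \<open>Only finitely many disks of diameter at least \<open>r/2\<close> come near
  \<open>x\<close>, and their closures stay at a positive distance from it. Every other disk near
  \<open>x\<close> is too small to leave the ball.\<close>

lemma disks_near_small:
  assumes "x \<in> carpet_interior UNIV Q" "r > 0"
  shows "\<exists>r'>0. r' \<le> r \<and> (\<forall>k. Q k \<inter> ball x r' \<noteq> {} \<longrightarrow> Q k \<subseteq> ball x r)"
proof -
  define B where "B = {k \<in> disks_meeting Q (ball x 1). diameter (Q k) \<ge> r/2}"
  have "finite B" unfolding B_def using assms by (intro finite_large_disks) simp
  then have "open (- (\<Union>k\<in>B. closure (Q k)))" by (intro open_Compl closed_UN) auto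
  moreover have "x \<in> - (\<Union>k\<in>B. closure (Q k))" using assms by (simp add: carpet_interior_iff)
  ultimately obtain e where e: "e > 0" "ball x e \<subseteq> - (\<Union>k\<in>B. closure (Q k))" using openE by blast
  define r' where "r' = min (min e 1) (r/2)"
  have "Q k \<subseteq> ball x r" if k: "Q k \<inter> ball x r' \<noteq> {}" for k
  proof -
    obtain z where z: "z \<in> Q k" "dist x z < r'" using k by auto
    have "k \<notin> B"
    proof
      assume "k \<in> B"
      moreover have "z \<in> ball x e" "z \<in> closure (Q k)" using z closure_subset by (auto simp: r'_def)
      ultimately show False using e(2) by blast
    qed
    moreover have "k \<in> disks_meeting Q (ball x 1)" using z by (auto simp: disks_meeting_def r'_def)
    ultimately have "diameter (Q k) < r/2" by (auto simp: B_def)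
    moreover have "dist z y \<le> diameter (Q k)" if "y \<in> Q k" for y
      using z that closure_subset by (intro dist_le_diameter) auto
    moreover have "dist x z < r/2" using z by (simp add: r'_def)
    ultimately have "dist x y < r" if "y \<in> Q k" for y
      using that dist_triangle[of x y z] by fastforce
    then show ?thesis by auto
  qed
  moreover have "r' > 0" "r' \<le> r" using e assms by (auto simp: r'_def)
  ultimately show ?thesis by blast
qed

text \<open>All but finitely many of these disks have diameter below 1. The lemma also provides the
  next, much larger scale in the construction of the cutoffs.\<close>

lemma disks_meeting_ball_bounded: "\<exists>R'\<ge>R. \<forall>k\<in>disks_meeting Q (ball x R). closure (Q k) \<subseteq> ball x R'"
proof -
  define B where "B = {k \<in> disks_meeting Q (ball x R). diameter (Q k) \<ge> 1}"
  have "finite B" unfolding B_def by (intro finite_large_disks) simp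
  define D where "D = 1 + (\<Sum>k\<in>B. diameter (Q k))"
  have "diameter (Q k) \<le> D" if "k \<in> disks_meeting Q (ball x R)" for k
  proof (cases "k \<in> B")
    case True
    then have "diameter (Q k) \<le> (\<Sum>k\<in>B. diameter (Q k))"
      using \<open>finite B\<close> diameter_pos by (intro member_le_sum) (auto intro: less_imp_le)
    then show ?thesis by (simp add: D_def)
  next
    case False
    moreover have "(\<Sum>k\<in>B. diameter (Q k)) \<ge> 0" using diameter_pos by (intro sum_nonneg) (auto intro: less_imp_le)
    ultimately show ?thesis using that by (auto simp: B_def D_def)
  qed
  moreover have "D \<ge> 0" unfolding D_def using diameter_pos by (intro add_nonneg_nonneg sum_nonneg) (auto intro: less_imp_le)
  moreover have "closure (Q k) \<subseteq> ball x (R + D)" if k: "k \<in> disks_meeting Q (ball x R)" and D: "diameter (Q k) \<le> D" for k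
  proof
    fix y assume y: "y \<in> closure (Q k)"
    obtain z where z: "z \<in> Q k" "dist x z < R" using k by (auto elim: disks_meetingE)
    have "dist z y \<le> diameter (Q k)" using z y closure_subset by (intro dist_le_diameter) auto
    then show "y \<in> ball x (R + D)" using dist_triangle[of x y z] z D by simp
  qed
  ultimately show ?thesis by (intro exI[of _ "R + D"]) auto
qed

lemma summable_diameter: "(\<lambda>k. (diameter (Q k))\<^sup>2) summable_on disks_meeting Q (ball x R)"
proof (cases "R > 0")
  case True
  obtain R' where R': "R' \<ge> R" "\<forall>k\<in>disks_meeting Q (ball x R). closure (Q k) \<subseteq> ball x R'"
    using disks_meeting_ball_bounded by blast
  have "diameter (Q k) \<le> 2 * R'" if "k \<in> disks_meeting Q (ball x R)" for k
  proof -
    have "Q k \<subseteq> ball x R'" using R' that closure_subset by blast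
    then have "diameter (Q k) \<le> diameter (ball x R')" by (intro diameter_subset) auto
    also have "\<dots> \<le> 2 * R'" using True R' by simp
    finally show ?thesis .
  qed
  then have m: "min (diameter (Q k)) (2 * R') = diameter (Q k)" if "k \<in> disks_meeting Q (ball x R)" for k
    using that by (simp add: min_absorb1)
  have "(\<Sum>k\<in>F. (diameter (Q k))\<^sup>2) \<le> fatness * R'\<^sup>2" if F: "F \<subseteq> disks_meeting Q (ball x R)" "finite F" for F
  proof -
    have "(\<Sum>k\<in>F. (diameter (Q k))\<^sup>2) = (\<Sum>k\<in>F. (min (diameter (Q k)) (2 * R'))\<^sup>2)"
      using F m by (intro sum.cong) auto
    also have "\<dots> \<le> fatness * R'\<^sup>2"
      using F True R' disks_meeting_mono[OF subset_ball[OF R'(1)], of Q x] by (intro fatness(2)[where x=x]) auto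
    finally show ?thesis .
  qed
  then show ?thesis by (intro nonneg_bdd_above_summable_on bdd_aboveI) auto
next
  case False
  then show ?thesis by (simp add: disks_meeting_def ball_empty)
qed

text \<open>Finitely many disks carry all but \<open>e\<close> of the sum and \<open>x\<close> lies
  off their closures, so a small ball meets none of them. The conclusion is phrased with finite sums
  because the length-area estimate consumes it in this form.\<close>

lemma small_energy_near:
  assumes x: "x \<in> carpet_interior UNIV Q"
    and f: "f summable_on disks_meeting Q (ball x R0)" "\<And>k. f k \<ge> (0::real)" and R0: "R0 > 0" and e: "e > 0"
  shows "\<exists>r>0. r \<le> R0 \<and> (\<forall>F. finite F \<longrightarrow> F \<subseteq> disks_meeting Q (ball x r) \<longrightarrow> sum f F \<le> e)"
proof -
  let ?A = "disks_meeting Q (ball x R0)"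
  have "(sum f \<longlongrightarrow> infsum f ?A) (finite_subsets_at_top ?A)"
    using f(1) has_sum_infsum by (simp add: has_sum_def)
  then have "\<forall>\<^sub>F F in finite_subsets_at_top ?A. dist (sum f F) (infsum f ?A) < e"
    using e by (rule tendstoD)
  then obtain F0 where F0: "finite F0" "F0 \<subseteq> ?A" "dist (sum f F0) (infsum f ?A) < e"
    by (auto simp: eventually_finite_subsets_at_top)
  have "open (- (\<Union>k\<in>F0. closure (Q k)))" using F0 by (intro open_Compl closed_UN) auto
  moreover have "x \<in> - (\<Union>k\<in>F0. closure (Q k))" using x by (simp add: carpet_interior_iff)
  ultimately obtain d where d: "d > 0" "ball x d \<subseteq> - (\<Union>k\<in>F0. closure (Q k))" using openE by blast
  define r where "r = min d R0"
  have "sum f F \<le> e" if F: "finite F" "F \<subseteq> disks_meeting Q (ball x r)" for F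
  proof -
    have disj: "F \<inter> F0 = {}"
    proof -
      have False if kF: "k \<in> F" "k \<in> F0" for k
      proof -
        obtain z where "z \<in> Q k" "z \<in> ball x r" using F kF by (meson disks_meetingE subsetD)
        then have "z \<in> ball x d" "z \<in> closure (Q k)" using closure_subset by (auto simp: r_def)
        then show False using d(2) kF by blast
      qed
      then show ?thesis by blast
    qed
    have "F \<subseteq> ?A" using F disks_meeting_mono[OF subset_ball[of r R0 x], of Q] by (auto simp: r_def)
    then have "sum f (F \<union> F0) \<le> infsum f ?A"
      using F0 F f by (intro finite_sum_le_infsum) auto
    then show ?thesis using F0 F disj by (simp add: sum.union_disjoint dist_real_def)
  qed
  then show ?thesis using d R0 by (intro exI[of _ r]) (auto simp: r_def)
qed

end

section \<open>Almost every segment\<close>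

text \<open>The flag tells vertical from horizontal lines, so that each statement about segments covers both.\<close>

definition pt :: "bool \<Rightarrow> real \<Rightarrow> real \<Rightarrow> complex" where
  "pt d t s = (if d then Complex t s else Complex s t)"

definition seg :: "bool \<Rightarrow> real \<Rightarrow> real \<Rightarrow> real \<Rightarrow> cpath" where
  "seg d t a b = ({a..b}, pt d t)"

definition coord :: "bool \<Rightarrow> complex \<Rightarrow> real" where
  "coord d z = (if d then Re z else Im z)"

lemma coord_pt [simp]: "coord d (pt d t s) = t" "coord (\<not> d) (pt d t s) = s"
  by (auto simp: coord_def pt_def)

lemma coord_0 [simp]: "coord d 0 = 0"
  by (simp add: coord_def)

lemma coord_le_dist: "\<bar>coord d z - coord d w\<bar> \<le> dist z w"
  using abs_Re_le_cmod[of "z - w"] abs_Im_le_cmod[of "z - w"] by (auto simp: coord_def dist_norm)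

lemma dist_pt: "dist (pt d t s) (pt d t s') = \<bar>s - s'\<bar>"
  by (auto simp: pt_def dist_norm cmod_def)

lemma dist_le_coords: "dist z w \<le> \<bar>coord d z - coord d w\<bar> + \<bar>coord (\<not> d) z - coord (\<not> d) w\<bar>"
  using cmod_le[of "z - w"] by (auto simp: coord_def dist_norm)

lemma continuous_on_pt: "continuous_on A (pt d t)"
  unfolding continuous_on_iff by (metis dist_pt dist_real_def)

lemma continuous_on_pt_snd: "continuous_on A (\<lambda>t. pt d t s)"
proof -
  have "dist (pt d t s) (pt d t' s) = dist t t'" for t t' by (auto simp: pt_def dist_norm cmod_def)
  then show ?thesis unfolding continuous_on_iff by metis
qed

lemma borel_measurable_pt [measurable]: "(\<lambda>(t, s). pt d t s) \<in> borel_measurable (borel \<Otimes>\<^sub>M borel)"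
  unfolding pt_def Complex_eq by (cases d) (auto simp: case_prod_beta)

lemma lborel_eq_distr_pt: "lborel = distr (lborel \<Otimes>\<^sub>M lborel) borel (\<lambda>(t, s). pt d t s)"
proof (rule lborel_eqI)
  have m: "(\<lambda>(t, s). pt d t s) \<in> lborel \<Otimes>\<^sub>M lborel \<rightarrow>\<^sub>M borel"
    using borel_measurable_pt[of d] by (simp cong: measurable_cong_sets)
  fix l u :: complex assume le: "\<And>b. b \<in> Basis \<Longrightarrow> l \<bullet> b \<le> u \<bullet> b"
  have le': "coord d l \<le> coord d u" "coord (\<not> d) l \<le> coord (\<not> d) u"
    using le[of 1] le[of \<i>] by (auto simp: Basis_complex_def coord_def)
  have "(\<lambda>(t, s). pt d t s) -` box l u \<inter> space (lborel \<Otimes>\<^sub>M lborel) =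
      {coord d l<..<coord d u} \<times> {coord (\<not> d) l<..<coord (\<not> d) u}"
    by (auto simp: box_def Basis_complex_def coord_def pt_def space_pair_measure)
  then have "emeasure (distr (lborel \<Otimes>\<^sub>M lborel) borel (\<lambda>(t, s). pt d t s)) (box l u) =
      emeasure (lborel \<Otimes>\<^sub>M lborel) ({coord d l<..<coord d u} \<times> {coord (\<not> d) l<..<coord (\<not> d) u})"
    using m by (subst emeasure_distr) auto
  also have "\<dots> = ennreal ((coord d u - coord d l) * (coord (\<not> d) u - coord (\<not> d) l))"
    using le' by (subst lborel.emeasure_pair_measure_Times) (auto simp: ennreal_mult)
  also have "(coord d u - coord d l) * (coord (\<not> d) u - coord (\<not> d) l) = (\<Prod>b\<in>Basis. (u - l) \<bullet> b)"
    by (auto simp: Basis_complex_def coord_def complex_eq_iff)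
  finally show "emeasure (distr (lborel \<Otimes>\<^sub>M lborel) borel (\<lambda>(t, s). pt d t s)) (box l u) =
      ennreal (\<Prod>b\<in>Basis. (u - l) \<bullet> b)" .
qed simp

lemma nn_integral_pt:
  assumes [measurable]: "f \<in> borel_measurable borel"
  shows "(\<lambda>t. \<integral>\<^sup>+s. f (pt d t s) \<partial>lborel) \<in> borel_measurable borel"
    "(\<integral>\<^sup>+z. f z \<partial>lborel) = (\<integral>\<^sup>+t. \<integral>\<^sup>+s. f (pt d t s) \<partial>lborel \<partial>lborel)"
proof -
  have m: "(\<lambda>(t, s). pt d t s) \<in> lborel \<Otimes>\<^sub>M lborel \<rightarrow>\<^sub>M borel"
    using borel_measurable_pt[of d] by (simp cong: measurable_cong_sets)
  then have m2: "(\<lambda>(t, s). f (pt d t s)) \<in> borel_measurable (lborel \<Otimes>\<^sub>M lborel)"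
    using measurable_compose[OF m assms] by (simp add: case_prod_beta)
  show "(\<lambda>t. \<integral>\<^sup>+s. f (pt d t s) \<partial>lborel) \<in> borel_measurable borel"
    using lborel.borel_measurable_nn_integral[OF m2] by simp
  have "(\<integral>\<^sup>+z. f z \<partial>lborel) = (\<integral>\<^sup>+p. f (case p of (t, s) \<Rightarrow> pt d t s) \<partial>(lborel \<Otimes>\<^sub>M lborel))"
    by (subst lborel_eq_distr_pt[of d]) (use m in \<open>simp add: nn_integral_distr\<close>)
  also have "\<dots> = (\<integral>\<^sup>+t. \<integral>\<^sup>+s. f (pt d t s) \<partial>lborel \<partial>lborel)"
    using lborel.nn_integral_fst[OF m2] by (simp add: case_prod_beta split_beta')
  finally show "(\<integral>\<^sup>+z. f z \<partial>lborel) = (\<integral>\<^sup>+t. \<integral>\<^sup>+s. f (pt d t s) \<partial>lborel \<partial>lborel)" .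
qed

lemma trace_seg: "trace (seg d t a b) = pt d t ` {a..b}"
  by (simp add: trace_def seg_def)

lemma is_cpath_seg: "a \<le> b \<Longrightarrow> is_cpath (seg d t a b)"
  unfolding is_cpath_def seg_def using continuous_on_pt is_interval_cc by (auto intro!: exI[of _ "pt d t"])

lemma seg_in_paths: "a \<le> b \<Longrightarrow> seg d t a b \<in> paths_in UNIV"
  by (simp add: paths_in_def is_cpath_seg)

lemma path_length_pt: assumes "a \<le> b" shows "path_length (pt d t) a b = ennreal (b - a)"
proof (rule antisym)
  show "path_length (pt d t) a b \<le> ennreal (b - a)"
  proof (rule path_length_least)
    fix n :: nat and r :: "nat \<Rightarrow> real" assume r: "mono_on {..n} r" "r ` {..n} \<subseteq> {a..b}"
    have "(\<Sum>k<n. dist (pt d t (r k)) (pt d t (r (Suc k)))) = (\<Sum>k<n. r (Suc k) - r k)"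
      using r(1) by (intro sum.cong) (auto simp: dist_pt mono_on_def)
    also have "\<dots> = r n - r 0" by (rule sum_lessThan_telescope)
    also have "\<dots> \<le> b - a"
      using r(2) atMost_iff image_subset_iff by (metis atLeastAtMost_iff diff_mono le0 order_refl)
    finally show "(\<Sum>k<n. ennreal (dist (pt d t (r k)) (pt d t (r (Suc k))))) \<le> ennreal (b - a)"
      by (simp add: sum_ennreal ennreal_leI)
  qed
  show "ennreal (b - a) \<le> path_length (pt d t) a b"
    using dist_le_path_length[of a a b b "pt d t"] assms by (simp add: dist_pt)
qed

lemma line_integral_seg_le:
  assumes [measurable]: "l \<in> borel_measurable borel"
  shows "line_integral l (seg d t a b) \<le> (\<integral>\<^sup>+s. l (pt d t s) * indicator {a..b} s \<partial>lborel)"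
proof -
  have m: "pt d t \<in> borel_measurable borel" by (rule borel_measurable_continuous_onI[OF continuous_on_pt])
  have lm [measurable]: "(\<lambda>s. l (pt d t s)) \<in> borel_measurable borel" using measurable_compose[OF m assms] .
  have "locally_rectifiable (seg d t a b)" unfolding locally_rectifiable_def by (auto simp: seg_def path_length_pt)
  moreover have "rectifiable_line_integral l (pt d t) x y \<le> (\<integral>\<^sup>+s. l (pt d t s) * indicator {a..b} s \<partial>lborel)"
    if "x \<in> {a..b}" "y \<in> {a..b}" "x \<le> y" for x y
  proof -
    have al: "arclength_param (pt d t) x y s = pt d t (x + s)" if s: "s \<in> {0..y - x}" for s
    proof -
      have "(SOME r. r \<in> {x..y} \<and> path_length (pt d t) x r = ennreal s) = x + s"
        by (rule some_equality) (use s in \<open>auto simp: path_length_pt\<close>)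
      then show ?thesis by (simp add: arclength_param_def)
    qed
    have "rectifiable_line_integral l (pt d t) x y = (\<integral>\<^sup>+s. l (pt d t (x + s)) * indicator {x..y} (x + s) \<partial>lborel)"
      unfolding rectifiable_line_integral_def using that
      by (intro nn_integral_cong) (auto simp: path_length_pt al split: split_indicator)
    also have "\<dots> = (\<integral>\<^sup>+s. l (pt d t s) * indicator {x..y} s \<partial>lborel)"
      using nn_integral_real_affine[of "\<lambda>s. l (pt d t s) * indicator {x..y} s" 1 x] by simp
    also have "\<dots> \<le> (\<integral>\<^sup>+s. l (pt d t s) * indicator {a..b} s \<partial>lborel)"
      using that by (intro nn_integral_mono) (auto split: split_indicator)
    finally show ?thesis .
  qed
  ultimately show ?thesis unfolding line_integral_def by (auto simp: seg_def intro!: SUP_least)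
qed

lemma emeasure_le_of_pairwise:
  fixes X :: "real set"
  assumes "X \<in> sets borel" "\<And>x y. x \<in> X \<Longrightarrow> y \<in> X \<Longrightarrow> \<bar>x - y\<bar> \<le> D" "D \<ge> 0"
  shows "emeasure lborel X \<le> ennreal D"
proof (cases "X = {}")
  case False
  have "bounded X" unfolding bounded_two_points using assms(2) by (auto simp: dist_real_def)
  then have bdd: "bdd_below X" "bdd_above X" by (auto simp: bounded_imp_bdd_below bounded_imp_bdd_above)
  have "x \<le> Inf X + D" if "x \<in> X" for x
  proof -
    have "x - D \<le> Inf X" using False assms(2)[OF that] by (intro cInf_greatest) (auto simp: abs_le_iff algebra_simps)
    then show ?thesis by simp
  qed
  then have "X \<subseteq> {Inf X..Inf X + D}" using bdd by (auto intro: cInf_lower)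
  then have "emeasure lborel X \<le> emeasure lborel {Inf X..Inf X + D}" by (intro emeasure_mono) auto
  then show ?thesis using assms(3) by simp
qed simp

section \<open>Segments in families of modulus zero\<close>

context planar_carpet
begin

text \<open>Fubini for the indicator of the carpet: almost every line meets it in a null set of
  parameters, and the parametrization of a segment is isometric.\<close>

lemma negligible_seg_hausdorff:
  "negligible {t. hausdorff_measure 1 (trace (seg d t a b) \<inter> S) \<noteq> 0}"
proof -
  have "(\<integral>\<^sup>+z. indicator S z \<partial>lborel) = (0::ennreal)"
    using S_null S_closed by simp
  moreover have im: "indicator S \<in> borel_measurable (borel :: complex measure)"
    using S_closed by (intro borel_measurable_indicator) auto
  ultimately have "(\<integral>\<^sup>+t. \<integral>\<^sup>+s. indicator S (pt d t s) \<partial>lborel \<partial>lborel) = (0::ennreal)"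
    using nn_integral_pt(2)[OF im, of d] by simp
  then have "AE t in lborel. (\<integral>\<^sup>+s. indicator S (pt d t s) \<partial>lborel) = (0::ennreal)"
    using nn_integral_pt(1)[OF im, of d] by (subst (asm) nn_integral_0_iff_AE) auto
  then have "AE t in lborel. hausdorff_measure 1 (trace (seg d t a b) \<inter> S) = 0"
  proof (rule AE_mp, intro AE_I2 impI)
    fix t assume 0: "(\<integral>\<^sup>+s. indicator S (pt d t s) \<partial>lborel) = (0::ennreal)"
    define N where "N = {s \<in> {a..b}. pt d t s \<in> S}"
    have "closed N" unfolding N_def
      using continuous_closed_preimage[OF continuous_on_pt[of "{a..b}" d t] _ S_closed] by (simp add: vimage_def Int_def)
    then have Nb: "N \<in> sets lborel" by simp
    have "emeasure lborel N = (\<integral>\<^sup>+s. indicator N s \<partial>lborel)" using Nb by simp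
    also have "\<dots> \<le> (\<integral>\<^sup>+s. indicator S (pt d t s) \<partial>lborel)"
      by (intro nn_integral_mono) (auto simp: N_def split: split_indicator)
    finally have "N \<in> null_sets lborel" using 0 Nb by (auto simp: null_sets_def)
    then have "negligible N" by (simp add: negligible_iff_null_sets null_sets_completionI)
    then have "hausdorff_measure 1 (pt d t ` N) = 0"
      by (rule hausdorff_null_image[of N a b]) (auto simp: N_def dist_pt)
    moreover have "trace (seg d t a b) \<inter> S = pt d t ` N" by (auto simp: trace_seg N_def)
    ultimately show "hausdorff_measure 1 (trace (seg d t a b) \<inter> S) = 0" by simp
  qed
  then show ?thesis by (rule negligible_Collect_AE)
qed

text \<open>By Fubini the density has energy \<open>G t\<close> on the line with parameter
  \<open>t\<close>. For a segment of the family this energy is at least \<open>1 / (b - a)\<close>,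
  so Markov's inequality bounds the measure of such parameters by \<open>b - a\<close> times the
  total energy.\<close>

lemma negligible_seg_exceptional:
  assumes E: "exceptional_paths v S \<Gamma>" and ab: "a < b"
  shows "negligible {t. seg d t a b \<in> \<Gamma>}"
proof (cases v)
  case Strong
  then show ?thesis using E
    by (intro negligible_subset[OF negligible_seg_hausdorff[of d a b]]) auto
next
  case Weak
  show ?thesis
  proof (rule negligible_if_small_covers)
    fix e :: real assume e: "e > 0"
    have "mod2 \<Gamma> = 0" using E Weak by simp
    moreover have "e / (b - a) > 0" using e ab by simp
    ultimately obtain l where lm: "l \<in> borel_measurable borel" and l1: "\<forall>\<gamma>\<in>\<Gamma>. line_integral l \<gamma> \<ge> 1"
      and small: "(\<integral>\<^sup>+x. (l x)\<^sup>2 \<partial>lborel) < ennreal (e / (b - a))" unfolding mod2_eq_0_iff by blast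
    define G where "G t = (\<integral>\<^sup>+s. (l (pt d t s))\<^sup>2 \<partial>lborel)" for t
    have l2m: "(\<lambda>z. (l z)\<^sup>2) \<in> borel_measurable borel" using lm by measurable
    have Gm [measurable]: "G \<in> borel_measurable borel" unfolding G_def by (rule nn_integral_pt(1)[OF l2m])
    have G: "(\<integral>\<^sup>+t. G t \<partial>lborel) < ennreal (e / (b - a))"
      using small nn_integral_pt(2)[OF l2m, of d] by (simp add: G_def)
    define U where "U = {t. ennreal (1 / (b - a)) \<le> G t}"
    have Ub: "U \<in> sets borel" unfolding U_def by measurable
    have sub: "{t. seg d t a b \<in> \<Gamma>} \<subseteq> U"
    proof
      fix t assume "t \<in> {t. seg d t a b \<in> \<Gamma>}"
      then have "1 \<le> line_integral l (seg d t a b)" using l1 by auto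
      also have "\<dots> \<le> (\<integral>\<^sup>+s. l (pt d t s) * indicator {a..b} s \<partial>lborel)"
        by (rule line_integral_seg_le[OF lm])
      also have "\<dots> \<le> (\<integral>\<^sup>+s. ennreal (1 / (2 * (b - a))) * indicator {a..b} s + ennreal ((b - a) / 2) * (l (pt d t s))\<^sup>2 \<partial>lborel)"
      proof (rule nn_integral_mono)
        fix s
        \<comment> \<open>The arithmetic-geometric mean inequality in place of Cauchy-Schwarz:
          integrated over \<open>{a..b}\<close> the first term gives \<open>1/2\<close>, which
          leaves at least \<open>1/2\<close> for the energy term.\<close>
        have "l (pt d t s) \<le> ennreal (1 / (2 * (b - a))) + ennreal ((b - a) / 2) * (l (pt d t s))\<^sup>2"
        proof (cases "l (pt d t s)")
          case (real r)
          have "r \<le> 1 / (2 * (b - a)) + (b - a) / 2 * r\<^sup>2"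
          proof -
            have "0 \<le> ((b - a) * r - 1)\<^sup>2" by simp
            then have "2 * (b - a) * r \<le> 1 + (b - a)\<^sup>2 * r\<^sup>2" by (simp add: power2_eq_square algebra_simps)
            then show ?thesis using ab by (simp add: field_simps power2_eq_square)
          qed
          then have "ennreal r \<le> ennreal (1 / (2 * (b - a)) + (b - a) / 2 * r\<^sup>2)" by (rule ennreal_leI)
          also have "\<dots> = ennreal (1 / (2 * (b - a))) + ennreal ((b - a) / 2) * (ennreal r)\<^sup>2"
            using ab real by (simp add: ennreal_plus ennreal_power ennreal_mult'[symmetric])
          finally show ?thesis using real by simp
        next
          case top
          then show ?thesis using ab by (simp add: ennreal_mult_top)
        qed
        then show "l (pt d t s) * indicator {a..b} s \<le> ennreal (1 / (2 * (b - a))) * indicator {a..b} s + ennreal ((b - a) / 2) * (l (pt d t s))\<^sup>2"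
          by (auto split: split_indicator)
      qed
      also have "\<dots> = ennreal (1/2) + ennreal ((b - a) / 2) * G t"
      proof -
        have m: "pt d t \<in> borel_measurable borel" by (rule borel_measurable_continuous_onI[OF continuous_on_pt])
        have [measurable]: "(\<lambda>s. (l (pt d t s))\<^sup>2) \<in> borel_measurable borel" using measurable_compose[OF m l2m] .
        have "ennreal (1 / (2 * (b - a))) * ennreal (b - a) = ennreal (1/2)"
        proof -
          have "1 / (2 * (b - a)) * (b - a) = 1/2" using ab by (simp add: field_simps)
          then show ?thesis using ab by (subst ennreal_mult'[symmetric]) (simp_all only:, simp)
        qed
        then show ?thesis using ab unfolding G_def
          by (simp add: nn_integral_add nn_integral_cmult nn_integral_cmult_indicator)
      qed
      finally have le: "1 \<le> ennreal (1/2) + ennreal ((b - a) / 2) * G t" .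
      show "t \<in> U" unfolding U_def
      proof (rule CollectI, rule ccontr)
        assume n: "\<not> ennreal (1 / (b - a)) \<le> G t"
        then obtain g where g: "G t = ennreal g" "g \<ge> 0" "g < 1 / (b - a)" 
          using ab by (cases "G t") (auto simp: ennreal_le_iff2 not_le)
        have A: "ennreal ((b - a) / 2) * ennreal g = ennreal ((b - a) / 2 * g)"
          by (rule ennreal_mult'[symmetric]) (use ab in auto)
        have B: "ennreal (1/2) + ennreal ((b - a) / 2 * g) = ennreal (1/2 + (b - a) / 2 * g)"
          by (rule ennreal_plus[symmetric]) (use g ab in auto)
        have "ennreal 1 \<le> ennreal (1/2 + (b - a) / 2 * g)"
          using le unfolding g(1) A B by (simp only: ennreal_1)
        then have "1 \<le> 1/2 + (b - a) / 2 * g" using g ab by (subst (asm) ennreal_le_iff) auto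
        moreover have "(b - a) * g < 1" using g(3) ab by (simp add: pos_less_divide_eq mult.commute)
        ultimately show False by linarith
      qed
    qed
    have "ennreal (1 / (b - a)) * emeasure lborel U \<le> (\<integral>\<^sup>+t. G t \<partial>lborel)"
    proof -
      have "ennreal (1 / (b - a)) * emeasure lborel U = (\<integral>\<^sup>+t. ennreal (1 / (b - a)) * indicator U t \<partial>lborel)"
        using Ub by (simp add: nn_integral_cmult_indicator)
      also have "\<dots> \<le> (\<integral>\<^sup>+t. G t \<partial>lborel)"
        by (intro nn_integral_mono) (auto simp: U_def split: split_indicator)
      finally show ?thesis .
    qed
    also have "\<dots> \<le> ennreal (e / (b - a))" using G by simp
    finally have "ennreal (b - a) * (ennreal (1 / (b - a)) * emeasure lborel U) \<le> ennreal (b - a) * ennreal (e / (b - a))"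
      by (rule mult_left_mono) simp
    moreover have "ennreal (b - a) * ennreal (1 / (b - a)) = 1" "ennreal (b - a) * ennreal (e / (b - a)) = ennreal e"
      using ab e by (simp_all add: ennreal_mult'[symmetric])
    ultimately have "emeasure lborel U \<le> ennreal e" by (simp add: mult.assoc[symmetric])
    then show "\<exists>U\<in>sets borel. {t. seg d t a b \<in> \<Gamma>} \<subseteq> U \<and> emeasure lborel U \<le> ennreal e"
      using Ub sub by blast
  qed
qed

text \<open>The shadow of the disk \<open>Q k\<close>: the part of it in the strip, projected to the
  transversal coordinate. Path sums over parallel segments are weighted sums of indicators of
  shadows, which is what makes them measurable in \<open>t\<close> and easy to integrate.\<close>

definition hits :: "bool \<Rightarrow> real \<Rightarrow> real \<Rightarrow> nat \<Rightarrow> real set" where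
  "hits d a b k = {t. k \<in> disks_meeting Q (trace (seg d t a b))}"

lemma hits_iff: "t \<in> hits d a b k \<longleftrightarrow> (\<exists>s\<in>{a..b}. pt d t s \<in> Q k)"
  unfolding hits_def disks_meeting_def trace_seg by blast

lemma hits_eq:
  assumes "a < b" shows "hits d a b k = (\<Union>s\<in>{a<..<b}. (\<lambda>t. pt d t s) -` Q k)"
proof
  show "hits d a b k \<subseteq> (\<Union>s\<in>{a<..<b}. (\<lambda>t. pt d t s) -` Q k)"
  proof
    fix t assume "t \<in> hits d a b k"
    then obtain s where s: "s \<in> {a..b}" "pt d t s \<in> Q k"
      unfolding hits_iff by blast
    have "open (pt d t -` Q k)"
      using Q_open continuous_on_pt[of UNIV d t] by (simp add: continuous_on_open_vimage)
    moreover have "s \<in> closure {a<..<b}" using s assms by simp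
    ultimately have "pt d t -` Q k \<inter> {a<..<b} \<noteq> {}"
      using s(2) open_Int_closure_eq_empty[of "pt d t -` Q k" "{a<..<b}"] by auto
    then show "t \<in> (\<Union>s\<in>{a<..<b}. (\<lambda>t. pt d t s) -` Q k)" by auto
  qed
next
  show "(\<Union>s\<in>{a<..<b}. (\<lambda>t. pt d t s) -` Q k) \<subseteq> hits d a b k"
  proof
    fix t assume "t \<in> (\<Union>s\<in>{a<..<b}. (\<lambda>t. pt d t s) -` Q k)"
    then obtain s where "s \<in> {a<..<b}" "pt d t s \<in> Q k" by auto
    then show "t \<in> hits d a b k" unfolding hits_iff by (intro bexI[of _ s]) auto
  qed
qed

lemma hits_open: "a < b \<Longrightarrow> open (hits d a b k)"
  unfolding hits_eq using Q_open continuous_on_pt_snd[of UNIV d]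
  by (intro open_UN ballI) (simp add: continuous_on_open_vimage)

lemma hits_dist: "t \<in> hits d a b k \<Longrightarrow> t' \<in> hits d a b k \<Longrightarrow> \<bar>t - t'\<bar> \<le> diameter (Q k)"
proof -
  assume "t \<in> hits d a b k" "t' \<in> hits d a b k"
  then obtain s s' where "pt d t s \<in> Q k" "pt d t' s' \<in> Q k"
    unfolding hits_iff by blast
  then have "dist (pt d t s) (pt d t' s') \<le> diameter (Q k)"
    using closure_subset by (intro dist_le_diameter) auto
  then show ?thesis using coord_le_dist[of d "pt d t s" "pt d t' s'"] by simp
qed

lemma path_sum_seg: "path_sum Q \<rho> (seg d t a b) = (\<Sum>k. ennreal (\<rho> k) * indicator (hits d a b k) t)"
  unfolding path_sum_suminf by (rule suminf_cong) (simp add: hits_def indicator_def)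

lemma borel_measurable_path_sum_seg:
  assumes "a < b" shows "(\<lambda>t. path_sum Q \<rho> (seg d t a b)) \<in> borel_measurable borel"
proof -
  have [measurable]: "hits d a b k \<in> sets borel" for k using hits_open[OF assms] by auto
  show ?thesis unfolding path_sum_seg by measurable
qed

text \<open>The length-area estimate: by Cauchy-Schwarz and fatness, the path sums over a family of parallel
  segments of size \<open>R\<close> are small in the mean as soon as the energy is small.\<close>

lemma length_area:
  assumes ab: "a < b" and R: "R > 0" and len: "\<beta> - \<alpha> \<le> 2 * R" "\<alpha> \<le> \<beta>" and \<rho>: "\<And>k. \<rho> k \<ge> 0" and \<eta>: "\<eta> \<ge> 0"
    and inside: "\<And>t s. t \<in> {\<alpha><..<\<beta>} \<Longrightarrow> s \<in> {a..b} \<Longrightarrow> pt d t s \<in> ball x R"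
    and energy: "\<And>F. finite F \<Longrightarrow> F \<subseteq> disks_meeting Q (ball x R) \<Longrightarrow> (\<Sum>k\<in>F. (\<rho> k)\<^sup>2) \<le> \<eta>\<^sup>2"
    and \<epsilon>: "\<epsilon> > 0"
  shows "emeasure lborel {t \<in> {\<alpha><..<\<beta>}. ennreal \<epsilon> \<le> path_sum Q \<rho> (seg d t a b)} \<le> ennreal (sqrt fatness * R * \<eta> / \<epsilon>)"
proof -
  let ?I = "{\<alpha><..<\<beta>}"
  let ?m = "\<lambda>k. min (diameter (Q k)) (2 * R)"
  have hb [measurable]: "hits d a b k \<in> sets borel" for k using hits_open[OF ab] by auto
  \<comment> \<open>A shadow is no longer than the diameter of the disk, and within the interval of
    parameters no longer than \<open>2 * R\<close>. This is the truncated diameter of the fatness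
    estimate.\<close>
  have em: "emeasure lborel (hits d a b k \<inter> ?I) \<le> ennreal (?m k)" for k
  proof (rule emeasure_le_of_pairwise)
    show "\<bar>t - t'\<bar> \<le> ?m k" if "t \<in> hits d a b k \<inter> ?I" "t' \<in> hits d a b k \<inter> ?I" for t t'
      using hits_dist[of t d a b k t'] that len by auto
    show "0 \<le> ?m k" using diameter_pos[of k] R by auto
  qed auto
  have emp: "hits d a b k \<inter> ?I = {}" if k: "k \<notin> disks_meeting Q (ball x R)" for k
  proof -
    have False if t: "t \<in> hits d a b k" "t \<in> ?I" for t
    proof -
      obtain s where "s \<in> {a..b}" "pt d t s \<in> Q k" using t(1) unfolding hits_iff by blast
      then have "k \<in> disks_meeting Q (ball x R)" using inside[OF t(2)] by (auto simp: disks_meeting_def)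
      then show False using k by blast
    qed
    then show ?thesis by blast
  qed
  have "(\<integral>\<^sup>+t. path_sum Q \<rho> (seg d t a b) * indicator ?I t \<partial>lborel) =
      (\<integral>\<^sup>+t. (\<Sum>k. ennreal (\<rho> k) * indicator (hits d a b k \<inter> ?I) t) \<partial>lborel)"
    unfolding path_sum_seg by (intro nn_integral_cong) (auto simp: indicator_def)
  also have "\<dots> = (\<Sum>k. \<integral>\<^sup>+t. ennreal (\<rho> k) * indicator (hits d a b k \<inter> ?I) t \<partial>lborel)"
    by (intro nn_integral_suminf) auto
  also have "\<dots> = (\<Sum>k. ennreal (\<rho> k) * emeasure lborel (hits d a b k \<inter> ?I))"
    by (intro suminf_cong nn_integral_cmult_indicator) auto
  also have "\<dots> \<le> ennreal (sqrt fatness * R * \<eta>)"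
    unfolding suminf_eq_SUP
  proof (rule SUP_least)
    fix n :: nat
    define F where "F = {k\<in>{..<n}. k \<in> disks_meeting Q (ball x R)}"
    have F: "finite F" "F \<subseteq> disks_meeting Q (ball x R)" by (auto simp: F_def)
    have "(\<Sum>k<n. ennreal (\<rho> k) * emeasure lborel (hits d a b k \<inter> ?I)) = (\<Sum>k\<in>F. ennreal (\<rho> k) * emeasure lborel (hits d a b k \<inter> ?I))"
      by (intro sum.mono_neutral_right) (auto simp: F_def emp)
    also have "\<dots> \<le> (\<Sum>k\<in>F. ennreal (\<rho> k * ?m k))"
      using em \<rho> by (intro sum_mono) (auto simp: ennreal_mult' intro!: mult_left_mono)
    also have "\<dots> = ennreal (\<Sum>k\<in>F. \<rho> k * ?m k)"
      using \<rho> diameter_pos R by (intro sum_ennreal mult_nonneg_nonneg) (auto intro: less_imp_le)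
    also have "\<dots> \<le> ennreal (sqrt fatness * R * \<eta>)"
    proof (rule ennreal_leI)
      have "(\<Sum>k\<in>F. \<rho> k * ?m k)\<^sup>2 \<le> (\<Sum>k\<in>F. (\<rho> k)\<^sup>2) * (\<Sum>k\<in>F. (?m k)\<^sup>2)"
        by (rule Cauchy_Schwarz_ineq_sum)
      also have "\<dots> \<le> \<eta>\<^sup>2 * (fatness * R\<^sup>2)"
        using energy[OF F] fatness(2)[OF R F] by (intro mult_mono sum_nonneg) auto
      also have "\<dots> = (sqrt fatness * R * \<eta>)\<^sup>2"
        using fatness(1) by (simp add: power_mult_distrib)
      finally show "(\<Sum>k\<in>F. \<rho> k * ?m k) \<le> sqrt fatness * R * \<eta>"
        by (rule power2_le_imp_le) (use R \<eta> fatness(1) in auto)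
    qed
    finally show "(\<Sum>k<n. ennreal (\<rho> k) * emeasure lborel (hits d a b k \<inter> ?I)) \<le> ennreal (sqrt fatness * R * \<eta>)" .
  qed
  finally have int: "(\<integral>\<^sup>+t. path_sum Q \<rho> (seg d t a b) * indicator ?I t \<partial>lborel) \<le> ennreal (sqrt fatness * R * \<eta>)" .
  let ?U = "{t \<in> ?I. ennreal \<epsilon> \<le> path_sum Q \<rho> (seg d t a b)}"
  have Ub: "?U \<in> sets borel" using borel_measurable_path_sum_seg[OF ab, of \<rho> d] by measurable
  have "ennreal \<epsilon> * emeasure lborel ?U = (\<integral>\<^sup>+t. ennreal \<epsilon> * indicator ?U t \<partial>lborel)"
    using Ub by (simp add: nn_integral_cmult_indicator)
  also have "\<dots> \<le> (\<integral>\<^sup>+t. path_sum Q \<rho> (seg d t a b) * indicator ?I t \<partial>lborel)"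
    by (intro nn_integral_mono) (auto split: split_indicator)
  also note int
  finally have "ennreal (1/\<epsilon>) * (ennreal \<epsilon> * emeasure lborel ?U) \<le> ennreal (1/\<epsilon>) * ennreal (sqrt fatness * R * \<eta>)"
    by (rule mult_left_mono) simp
  moreover have "ennreal (1/\<epsilon>) * ennreal \<epsilon> = 1" using \<epsilon> by (simp add: ennreal_mult'[symmetric])
  moreover have "ennreal (1/\<epsilon>) * ennreal (sqrt fatness * R * \<eta>) = ennreal (sqrt fatness * R * \<eta> / \<epsilon>)"
    using \<epsilon> by (simp add: ennreal_mult'[symmetric])
  ultimately show ?thesis by (simp add: mult.assoc[symmetric])
qed

lemma sum_le_of_suminf:
  assumes "(\<Sum>k. ennreal ((\<rho> k)\<^sup>2)) \<le> ennreal e" "e \<ge> 0" "finite F"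
  shows "(\<Sum>k\<in>F. (\<rho> k)\<^sup>2) \<le> e"
proof -
  have "ennreal (\<Sum>k\<in>F. (\<rho> k)\<^sup>2) = (\<Sum>k\<in>F. ennreal ((\<rho> k)\<^sup>2))" by (simp add: sum_ennreal)
  also have "\<dots> \<le> (\<Sum>k. ennreal ((\<rho> k)\<^sup>2))" by (intro sum_le_suminf) (use assms in auto)
  also note assms(1)
  finally show ?thesis using assms(2) by simp
qed

text \<open>An admissible sequence of energy below \<open>\<eta>^2\<close> has path sum at least 1
  on every segment of \<open>\<Gamma>\<close> outside an exceptional subfamily, so the length-area
  estimate with threshold 1 bounds the measure of their parameters.\<close>

lemma negligible_seg_null:
  assumes G: "carpet_modulus v UNIV Q \<Gamma> = 0" and ab: "a < b"
  shows "negligible {t. seg d t a b \<in> \<Gamma>}"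
proof -
  have "negligible {t\<in>{-real n<..<real n}. seg d t a b \<in> \<Gamma>}" for n
  proof (rule negligible_if_small_covers)
    fix e :: real assume e: "e > 0"
    define R where "R = real n + \<bar>a\<bar> + \<bar>b\<bar> + 1"
    have R: "R > 0" by (simp add: R_def add_nonneg_pos)
    \<comment> \<open>Makes the length-area bound \<open>sqrt fatness * R * \<eta>\<close> equal to
      \<open>e\<close>. The radius \<open>R\<close> is such that one ball contains all the segments
      with parameter between \<open>-n\<close> and \<open>n\<close>.\<close>
    define \<eta> where "\<eta> = e / (sqrt fatness * R)"
    have \<eta>: "\<eta> > 0" using e R fatness(1) by (simp add: \<eta>_def)
    then have "\<eta>\<^sup>2 > 0" by simp
    with G obtain \<rho> \<Gamma>0 where r: "\<forall>i. \<rho> i \<ge> 0" "\<Gamma>0 \<subseteq> \<Gamma>" "exceptional_paths v S \<Gamma>0"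
      "\<forall>\<gamma>\<in>\<Gamma> - \<Gamma>0. path_sum Q \<rho> \<gamma> \<ge> 1" "(\<Sum>i. ennreal ((\<rho> i)\<^sup>2)) < ennreal (\<eta>\<^sup>2)"
      unfolding carpet_modulus_eq_0_iff by blast
    obtain N where N: "{t. seg d t a b \<in> \<Gamma>0} \<subseteq> N" "N \<in> null_sets lborel"
      using null_set_of_negligible[OF negligible_seg_exceptional[OF r(3) ab]] by blast
    let ?U = "{t \<in> {-real n<..<real n}. ennreal 1 \<le> path_sum Q \<rho> (seg d t a b)}"
    have "emeasure lborel ?U \<le> ennreal (sqrt fatness * R * \<eta> / 1)"
    proof (rule length_area[OF ab R])
      show "pt d t s \<in> ball 0 R" if "t \<in> {- real n<..<real n}" "s \<in> {a..b}" for t s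
      proof -
        have "dist (pt d t s) 0 \<le> \<bar>t\<bar> + \<bar>s\<bar>"
          using dist_le_coords[of "pt d t s" 0 d] by simp
        then have "dist 0 (pt d t s) < R" using that by (auto simp: R_def dist_commute)
        then show ?thesis by simp
      qed
      show "sum (\<lambda>k. (\<rho> k)\<^sup>2) F \<le> \<eta>\<^sup>2" if "finite F" for F
        by (rule sum_le_of_suminf) (use r(5) that in auto)
    qed (use r \<eta> in \<open>auto simp: R_def\<close>)
    also have "\<dots> = ennreal e" using R fatness(1) by (simp add: \<eta>_def)
    finally have U: "emeasure lborel ?U \<le> ennreal e" .
    have Ub: "?U \<in> sets borel" using borel_measurable_path_sum_seg[OF ab, of \<rho> d] by measurable
    have "emeasure lborel (?U \<union> N) = emeasure lborel ?U"
      using N Ub by (intro emeasure_Un_null_set) auto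
    moreover have "{t\<in>{-real n<..<real n}. seg d t a b \<in> \<Gamma>} \<subseteq> ?U \<union> N"
      using r(4) N(1) by auto
    ultimately show "\<exists>U\<in>sets borel. {t\<in>{-real n<..<real n}. seg d t a b \<in> \<Gamma>} \<subseteq> U \<and> emeasure lborel U \<le> ennreal e"
      using U N Ub by (intro bexI[of _ "?U \<union> N"]) (auto simp: null_sets_def)
  qed
  then have "negligible (\<Union>n. {t\<in>{-real n<..<real n}. seg d t a b \<in> \<Gamma>})"
    by (intro negligible_countable_Union) auto
  moreover have "{t. seg d t a b \<in> \<Gamma>} \<subseteq> (\<Union>n. {t\<in>{-real n<..<real n}. seg d t a b \<in> \<Gamma>})"
  proof
    fix t assume "t \<in> {t. seg d t a b \<in> \<Gamma>}"
    moreover obtain n where "\<bar>t\<bar> < real n" using reals_Archimedean2 by blast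
    ultimately show "t \<in> (\<Union>n. {t\<in>{-real n<..<real n}. seg d t a b \<in> \<Gamma>})" by (auto intro!: exI[of _ n])
  qed
  ultimately show ?thesis by (rule negligible_subset)
qed

end

section \<open>Oscillations as upper gradients\<close>

lemma suminf_ennreal_tail_small:
  assumes "(\<Sum>k. ennreal (r k)) < \<infinity>" "\<And>k. r k \<ge> 0" "e > 0"
  shows "\<exists>N. (\<Sum>k. ennreal (r k) * indicator {N..} k) \<le> ennreal e"
proof -
  have s: "summable r" using assms by (intro summable_suminf_not_top) auto
  obtain N where N: "norm (\<Sum>k. r (k + N)) < e"
    using suminf_exist_split[OF assms(3) s] by blast
  have sh: "summable (\<lambda>k. r (k + N))" using s by (simp add: summable_iff_shift)
  have "(\<Sum>k. ennreal (r k) * indicator {N..} k) =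
      (\<Sum>k. ennreal (r (k + N)) * indicator {N..} (k + N)) + (\<Sum>k<N. ennreal (r k) * indicator {N..} k)"
    by (rule suminf_offset) auto
  also have "\<dots> = (\<Sum>k. ennreal (r (k + N)))" by simp
  also have "\<dots> = ennreal (\<Sum>k. r (k + N))" using sh assms(2) by (intro suminf_ennreal2) auto
  also have "\<dots> \<le> ennreal e" using N by (intro ennreal_leI) auto
  finally show ?thesis by blast
qed

section \<open>Shortening a path by jumps through disks\<close>

context planar_carpet
begin

definition met :: "(real \<Rightarrow> complex) \<Rightarrow> real \<Rightarrow> real \<Rightarrow> nat set" where
  "met h s t = disks_meeting Q (h ` {s..t})"

lemma trace_interval: "trace ({s..t}, h) = h ` {s..t}" by (simp add: trace_def)

lemma met_mono: "s \<le> s' \<Longrightarrow> t' \<le> t \<Longrightarrow> met h s' t' \<subseteq> met h s t"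
  unfolding met_def by (intro disks_meeting_mono image_mono) auto

lemma notin_disk: "x \<in> S \<Longrightarrow> x \<notin> Q k"
  by (auto simp: carpet_eq)

text \<open>The start is outside \<open>Q k\<close> and the disk is open, so at the first time in
  its closure the path is on its boundary and has not yet entered it.\<close>

lemma first_hit:
  assumes h: "continuous_on {s..t} h" and hs: "h s \<notin> Q k" and k: "k \<in> met h s t"
  shows "\<exists>\<sigma>\<in>{s..t}. h \<sigma> \<in> frontier (Q k) \<and> k \<notin> met h s \<sigma>"
proof -
  define Z where "Z = {r \<in> {s..t}. h r \<in> closure (Q k)}"
  have "closed Z" unfolding Z_def
    using continuous_closed_preimage[OF h] by (simp add: vimage_def Int_def)
  moreover obtain r0 where r0: "r0 \<in> {s..t}" "h r0 \<in> Q k"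
    using k unfolding met_def by (auto elim: disks_meetingE)
  then have "Z \<noteq> {}" using closure_subset by (auto simp: Z_def)
  moreover have bdd: "bdd_below Z" by (auto simp: Z_def bdd_below_def)
  ultimately have inZ: "Inf Z \<in> Z" by (intro closed_contains_Inf) auto
  define \<sigma> where "\<sigma> = Inf Z"
  have \<sigma>: "\<sigma> \<in> {s..t}" "h \<sigma> \<in> closure (Q k)" using inZ by (auto simp: Z_def \<sigma>_def)
  have before: "h r \<notin> closure (Q k)" if "s \<le> r" "r < \<sigma>" for r
  proof
    assume "h r \<in> closure (Q k)"
    then have "r \<in> Z" using that \<sigma> by (auto simp: Z_def)
    then show False using that bdd cInf_lower[of r Z] by (simp add: \<sigma>_def)
  qed
  have notin: "h \<sigma> \<notin> Q k"
  proof
    assume in1: "h \<sigma> \<in> Q k"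
    then have "s \<noteq> \<sigma>" using hs by auto
    then have "s < \<sigma>" using \<sigma> by simp
    obtain e where e: "e > 0" "ball (h \<sigma>) e \<subseteq> Q k" using in1 Q_open openE by blast
    obtain d where d: "d > 0" "\<And>r. r \<in> {s..t} \<Longrightarrow> dist r \<sigma> < d \<Longrightarrow> dist (h r) (h \<sigma>) < e"
      using h \<sigma>(1) e(1) unfolding continuous_on_iff by metis
    define r where "r = max s (\<sigma> - d/2)"
    have "s \<le> r" "r < \<sigma>" "dist r \<sigma> < d" using \<open>s < \<sigma>\<close> d(1) by (auto simp: r_def dist_real_def)
    then have "h r \<in> ball (h \<sigma>) e" using d(2)[of r] \<sigma> by (auto simp: dist_commute)
    then show False using e(2) before[OF \<open>s \<le> r\<close> \<open>r < \<sigma>\<close>] closure_subset by blast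
  qed
  have "h \<sigma> \<in> frontier (Q k)" using \<sigma>(2) notin Q_open by (simp add: frontier_def interior_open)
  moreover have "k \<notin> met h s \<sigma>"
  proof
    assume "k \<in> met h s \<sigma>"
    then obtain r where r: "r \<in> {s..\<sigma>}" "h r \<in> Q k" unfolding met_def by (auto elim: disks_meetingE)
    then show False using before[of r] notin closure_subset[of "Q k"] by (cases "r = \<sigma>") auto
  qed
  ultimately show ?thesis using \<sigma>(1) by blast
qed

lemma last_hit:
  assumes h: "continuous_on {s..t} h" and ht: "h t \<notin> Q k" and k: "k \<in> met h s t"
  shows "\<exists>\<sigma>\<in>{s..t}. h \<sigma> \<in> frontier (Q k) \<and> k \<notin> met h \<sigma> t"
proof -
  have im: "(\<lambda>x. h (- x)) ` {-y..-x} = h ` {x..y}" for x y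
  proof -
    have "(\<lambda>x. h (- x)) ` {-y..-x} = h ` (uminus ` {-y..-x})" by (simp only: image_image)
    then show ?thesis by (simp only: image_uminus_atLeastAtMost minus_minus)
  qed
  have "continuous_on {-t..-s} (\<lambda>x. h (- x))"
    by (rule continuous_on_compose2[OF h]) (auto intro!: continuous_intros)
  moreover have "k \<in> met (\<lambda>x. h (- x)) (-t) (-s)" using k by (simp add: met_def im)
  ultimately obtain \<sigma> where \<sigma>: "\<sigma> \<in> {-t..-s}" "h (- \<sigma>) \<in> frontier (Q k)" "k \<notin> met (\<lambda>x. h (- x)) (-t) \<sigma>"
    using first_hit[of "-t" "-s" "\<lambda>x. h (- x)" k] ht by auto
  then show ?thesis using im[of t "- \<sigma>"] by (intro bexI[of _ "- \<sigma>"]) (auto simp: met_def)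
qed

text \<open>Only the end of \<open>p\<close> and the start of \<open>q\<close> enter, so an interval
  can be refined without affecting the neighbouring jumps. The disk is always one met by the
  original path, and the price of the jump is its oscillation.\<close>

definition jump :: "(real \<Rightarrow> complex) \<Rightarrow> nat set \<Rightarrow> real \<times> real \<Rightarrow> real \<times> real \<Rightarrow> bool" where
  "jump h M p q \<longleftrightarrow> (\<exists>k\<in>M. h (snd p) \<in> frontier (Q k) \<and> h (fst q) \<in> frontier (Q k))"

definition good_interval :: "(real \<Rightarrow> complex) \<Rightarrow> nat \<Rightarrow> real \<Rightarrow> real \<Rightarrow> real \<times> real \<Rightarrow> bool" where
  "good_interval h N a b p \<longleftrightarrow> a \<le> fst p \<and> fst p \<le> snd p \<and> snd p \<le> b \<and> h (fst p) \<in> S \<and> h (snd p) \<in> S \<and>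
     met h (fst p) (snd p) \<inter> {..<N} = {}"

definition chain :: "(real \<Rightarrow> complex) \<Rightarrow> nat \<Rightarrow> real \<Rightarrow> real \<Rightarrow> (real \<times> real) list \<Rightarrow> bool" where
  "chain h N a b L \<longleftrightarrow> L \<noteq> [] \<and> (\<forall>p\<in>set L. good_interval h N a b p) \<and> successively (jump h (met h a b)) L \<and>
     fst (hd L) = a \<and> snd (last L) = b"

lemma concat_map_chain:
  assumes "L \<noteq> []" "successively (jump h M) L"
    and "\<And>p. p \<in> set L \<Longrightarrow> g p \<noteq> [] \<and> successively (jump h M) (g p) \<and> fst (hd (g p)) = fst p \<and> snd (last (g p)) = snd p"
  shows "concat (map g L) \<noteq> [] \<and> successively (jump h M) (concat (map g L)) \<and>
    fst (hd (concat (map g L))) = fst (hd L) \<and> snd (last (concat (map g L))) = snd (last L)"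
  using assms
proof (induction L)
  case (Cons p L)
  show ?case
  proof (cases "L = []")
    case True
    then show ?thesis using Cons.prems by auto
  next
    case False
    have IH: "concat (map g L) \<noteq> [] \<and> successively (jump h M) (concat (map g L)) \<and>
      fst (hd (concat (map g L))) = fst (hd L) \<and> snd (last (concat (map g L))) = snd (last L)"
      using Cons.prems False by (intro Cons.IH) (auto simp: successively_Cons)
    have "jump h M p (hd L)" using Cons.prems(2) False by (auto simp: successively_Cons)
    then have "jump h M (last (g p)) (hd (concat (map g L)))"
      using IH Cons.prems(3)[of p] by (simp add: jump_def)
    then show ?thesis using IH False Cons.prems(3)[of p] by (simp add: successively_append_iff)
  qed
qed simp

text \<open>If the arc meets disk \<open>N\<close>, everything between the first and the last
  contact is cut out and replaced by one jump through this disk.\<close>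

lemma good_interval_split:
  assumes h: "continuous_on {a..b} h" and g: "good_interval h N a b p"
  shows "\<exists>L. L \<noteq> [] \<and> successively (jump h (met h a b)) L \<and> fst (hd L) = fst p \<and> snd (last L) = snd p \<and>
    (\<forall>q\<in>set L. good_interval h (Suc N) a b q)"
proof (cases "N \<in> met h (fst p) (snd p)")
  case False
  then have "met h (fst p) (snd p) \<inter> {..<Suc N} = {}"
    using g unfolding good_interval_def lessThan_Suc by blast
  then show ?thesis using g by (intro exI[of _ "[p]"]) (auto simp: good_interval_def)
next
  case True
  obtain s t where p: "p = (s, t)" by (cases p)
  have st: "a \<le> s" "s \<le> t" "t \<le> b" "h s \<in> S" "h t \<in> S" "met h s t \<inter> {..<N} = {}"
    using g by (auto simp: p good_interval_def)
  have hc: "continuous_on {s..t} h" by (rule continuous_on_subset[OF h]) (use st in auto)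
  obtain \<sigma> where \<sigma>: "\<sigma> \<in> {s..t}" "h \<sigma> \<in> frontier (Q N)" "N \<notin> met h s \<sigma>"
    using first_hit[OF hc notin_disk[OF st(4)], of N] True by (auto simp: p)
  obtain \<tau> where \<tau>: "\<tau> \<in> {s..t}" "h \<tau> \<in> frontier (Q N)" "N \<notin> met h \<tau> t"
    using last_hit[OF hc notin_disk[OF st(5)], of N] True by (auto simp: p)
  have "met h s \<sigma> \<subseteq> met h s t" "met h \<tau> t \<subseteq> met h s t"
    using met_mono[of s s \<sigma> t h] met_mono[of s \<tau> t t h] \<sigma>(1) \<tau>(1) by simp_all
  then have "met h s \<sigma> \<inter> {..<Suc N} = {}" "met h \<tau> t \<inter> {..<Suc N} = {}"
    using \<sigma>(3) \<tau>(3) st(6) unfolding lessThan_Suc by blast+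
  moreover have "N \<in> met h a b" using True met_mono[of a s t b h] st by (auto simp: p)
  moreover have "h \<sigma> \<in> S" "h \<tau> \<in> S" using \<sigma> \<tau> frontier_subset by blast+
  ultimately show ?thesis using \<sigma> \<tau> st
    by (intro exI[of _ "[(s, \<sigma>), (\<tau>, t)]"]) (auto simp: p good_interval_def jump_def)
qed

lemma chain_exists:
  assumes h: "continuous_on {a..b} h" and ab: "a \<le> b" "h a \<in> S" "h b \<in> S"
  shows "\<exists>L. chain h N a b L"
proof (induction N)
  case 0
  show ?case using ab by (intro exI[of _ "[(a, b)]"]) (auto simp: chain_def good_interval_def)
next
  case (Suc N)
  then obtain L where L: "chain h N a b L" by blast
  have "\<exists>g. \<forall>p\<in>set L. g p \<noteq> [] \<and> successively (jump h (met h a b)) (g p) \<and> fst (hd (g p)) = fst p \<and>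
      snd (last (g p)) = snd p \<and> (\<forall>q\<in>set (g p). good_interval h (Suc N) a b q)"
    using L good_interval_split[OF h] unfolding chain_def by (intro bchoice) blast
  then obtain g where g: "\<And>p. p \<in> set L \<Longrightarrow> g p \<noteq> [] \<and> successively (jump h (met h a b)) (g p) \<and> fst (hd (g p)) = fst p \<and>
      snd (last (g p)) = snd p \<and> (\<forall>q\<in>set (g p). good_interval h (Suc N) a b q)" by blast
  have "concat (map g L) \<noteq> [] \<and> successively (jump h (met h a b)) (concat (map g L)) \<and>
    fst (hd (concat (map g L))) = fst (hd L) \<and> snd (last (concat (map g L))) = snd (last L)"
    by (rule concat_map_chain) (use L g in \<open>auto simp: chain_def\<close>)
  then have "chain h (Suc N) a b (concat (map g L))" using L g unfolding chain_def by auto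
  then show ?case by blast
qed

text \<open>In a chain with the fewest possible intervals no disk meets two non-consecutive intervals and no
  disk is jumped through twice, as otherwise one could take a shortcut through it. Hence the terms
  of the disks that are not jumped through are counted at most twice.\<close>

lemma shortest_chain:
  assumes h: "continuous_on {a..b} h" and L: "chain h N a b L"
    and min: "\<And>L'. chain h N a b L' \<Longrightarrow> length L \<le> length L'"
  shows "i < j \<Longrightarrow> j < length L \<Longrightarrow> k \<in> met h (fst (L ! i)) (snd (L ! i)) \<Longrightarrow>
      k \<in> met h (fst (L ! j)) (snd (L ! j)) \<Longrightarrow> j = Suc i"
    and "i < j \<Longrightarrow> Suc j < length L \<Longrightarrow> h (snd (L ! i)) \<in> frontier (Q k) \<Longrightarrow> h (fst (L ! Suc j)) \<in> frontier (Q k) \<Longrightarrow>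
      k \<in> met h a b \<Longrightarrow> False"
proof -
  have good: "good_interval h N a b (L ! i)" if "i < length L" for i using L that by (auto simp: chain_def)
  have suc: "successively (jump h (met h a b)) L" using L by (simp add: chain_def)
  have take_s: "successively (jump h (met h a b)) (take n L)" and drop_s: "successively (jump h (met h a b)) (drop n L)" for n
    using suc append_take_drop_id[of n L] by (metis successively_append_iff)+
  { assume ij: "i < j" "j < length L" and k: "k \<in> met h (fst (L ! i)) (snd (L ! i))" "k \<in> met h (fst (L ! j)) (snd (L ! j))"
    obtain s t where p: "L ! i = (s, t)" by (cases "L ! i")
    obtain s' t' where q: "L ! j = (s', t')" by (cases "L ! j")
    have st: "a \<le> s" "s \<le> t" "t \<le> b" "h s \<in> S" "h t \<in> S" "met h s t \<inter> {..<N} = {}"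
      using good[of i] ij by (auto simp: p good_interval_def)
    have st': "a \<le> s'" "s' \<le> t'" "t' \<le> b" "h s' \<in> S" "h t' \<in> S" "met h s' t' \<inter> {..<N} = {}"
      using good[of j] ij by (auto simp: q good_interval_def)
    have hc: "continuous_on {s..t} h" "continuous_on {s'..t'} h"
      by (rule continuous_on_subset[OF h]; use st st' in auto)+
    obtain \<sigma> where \<sigma>: "\<sigma> \<in> {s..t}" "h \<sigma> \<in> frontier (Q k)"
      using first_hit[OF hc(1) notin_disk[OF st(4)], of k] k by (auto simp: p)
    obtain \<tau> where \<tau>: "\<tau> \<in> {s'..t'}" "h \<tau> \<in> frontier (Q k)"
      using last_hit[OF hc(2) notin_disk[OF st'(5)], of k] k by (auto simp: q)
    have kM: "k \<in> met h a b" using k met_mono[of a s t b h] st by (auto simp: p)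
    have m: "met h s \<sigma> \<inter> {..<N} = {}" "met h \<tau> t' \<inter> {..<N} = {}"
      using met_mono[of s s \<sigma> t h] met_mono[of s' \<tau> t' t' h] \<sigma> \<tau> st(6) st'(6) by fastforce+
    have hS: "h \<sigma> \<in> S" "h \<tau> \<in> S" using \<sigma> \<tau> frontier_subset by blast+
    \<comment> \<open>Shortcut: stop at the first contact of interval \<open>i\<close> with
      \<open>Q k\<close>, jump, and resume at the last contact of interval \<open>j\<close>. The new
      list has \<open>j - i - 1\<close> fewer entries.\<close>
    define L' where "L' = take i L @ [(s, \<sigma>), (\<tau>, t')] @ drop (Suc j) L"
    have j1: "jump h (met h a b) (last (take i L)) (s, \<sigma>)" if "i > 0"
    proof -
      have "last (take i L) = L ! (i - 1)"
        using that ij take_Suc_conv_app_nth[of "i - 1" L] by simp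
      moreover have "jump h (met h a b) (L ! (i - 1)) (L ! i)"
        using successively_nth[OF suc, of "i - 1"] that ij by simp
      ultimately show ?thesis by (simp add: jump_def p)
    qed
    have j2: "jump h (met h a b) (\<tau>, t') (hd (drop (Suc j) L))" if "Suc j < length L"
    proof -
      have "hd (drop (Suc j) L) = L ! Suc j" using that by (simp add: hd_drop_conv_nth)
      moreover have "jump h (met h a b) (L ! j) (L ! Suc j)"
        using successively_nth[OF suc, of j] that by simp
      ultimately show ?thesis by (simp add: jump_def q)
    qed
    have j3: "jump h (met h a b) (s, \<sigma>) (\<tau>, t')" using \<sigma> \<tau> kM by (auto simp: jump_def)
    have "successively (jump h (met h a b)) L'"
      unfolding L'_def successively_append_iff using take_s[of i] drop_s[of "Suc j"] j1 j2 j3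
      by (cases "Suc j < length L"; cases "i = 0") auto
    moreover have "good_interval h N a b x" if "x \<in> set L'" for x
    proof -
      from that have "x \<in> set L \<or> x = (s, \<sigma>) \<or> x = (\<tau>, t')"
        unfolding L'_def by (auto dest: in_set_takeD in_set_dropD)
      then show ?thesis using L m hS st st' \<sigma> \<tau> by (auto simp: chain_def good_interval_def)
    qed
    moreover have "fst (hd L') = a"
    proof (cases "i = 0")
      case True
      moreover have "hd L = L ! 0" using L by (intro hd_conv_nth) (simp add: chain_def)
      ultimately show ?thesis using L p by (simp add: L'_def chain_def)
    next
      case False
      then have "take i L \<noteq> []" using ij by auto
      moreover have "hd (take i L) = hd L" using False by simp
      ultimately show ?thesis using L by (simp add: L'_def chain_def)
    qed
    moreover have "snd (last L') = b"
    proof (cases "Suc j < length L")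
      case True
      then show ?thesis using L by (simp add: L'_def chain_def last_drop)
    next
      case False
      then have "length L - 1 = j" "L \<noteq> []" using ij by auto
      then have "last L = L ! j" using last_conv_nth by metis
      then show ?thesis using L q False by (simp add: L'_def chain_def)
    qed
    ultimately have "chain h N a b L'" by (simp add: chain_def L'_def)
    then have "length L \<le> length L'" by (rule min)
    then have "j \<le> Suc i" using ij by (simp add: L'_def)
    then show "j = Suc i" using ij by simp }
  { assume ij: "i < j" "Suc j < length L" and k: "h (snd (L ! i)) \<in> frontier (Q k)" "h (fst (L ! Suc j)) \<in> frontier (Q k)"
      "k \<in> met h a b"
    \<comment> \<open>One jump through \<open>Q k\<close> from the end of interval \<open>i\<close>
      straight to the start of interval \<open>j + 1\<close> shortens the list by
      \<open>j - i\<close>.\<close>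
    define L' where "L' = take (Suc i) L @ drop (Suc j) L"
    have "last (take (Suc i) L) = L ! i" using ij by (simp add: take_Suc_conv_app_nth)
    moreover have "hd (drop (Suc j) L) = L ! Suc j" using ij by (simp add: hd_drop_conv_nth)
    ultimately have "jump h (met h a b) (last (take (Suc i) L)) (hd (drop (Suc j) L))"
      using k by (auto simp: jump_def)
    then have "successively (jump h (met h a b)) L'"
      unfolding L'_def successively_append_iff using take_s[of "Suc i"] drop_s[of "Suc j"] by auto
    moreover have "\<forall>x\<in>set L'. good_interval h N a b x"
      using L unfolding L'_def chain_def by (auto dest: in_set_takeD in_set_dropD)
    moreover have "fst (hd L') = a" "snd (last L') = b" "L' \<noteq> []"
      using L ij by (auto simp: L'_def chain_def last_drop)
    ultimately have "chain h N a b L'" by (simp add: chain_def)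
    then have "length L \<le> length L'" by (rule min)
    then show False using ij by (simp add: L'_def) }
qed

lemma chain_variation:
  fixes f :: "complex \<Rightarrow> real"
  assumes "\<And>j. j < length L \<Longrightarrow> ennreal \<bar>f (h (fst (L ! j))) - f (h (snd (L ! j)))\<bar> \<le> I j"
    and "\<And>j. Suc j < length L \<Longrightarrow> ennreal \<bar>f (h (snd (L ! j))) - f (h (fst (L ! Suc j)))\<bar> \<le> J j"
  shows "m < length L \<Longrightarrow> ennreal \<bar>f (h (fst (L ! 0))) - f (h (snd (L ! m)))\<bar> \<le> (\<Sum>j<Suc m. I j) + (\<Sum>j<m. J j)"
proof (induction m)
  case 0
  then show ?case using assms(1)[of 0] by simp
next
  case (Suc m)
  let ?x = "f (h (fst (L ! 0)))" and ?y = "f (h (snd (L ! m)))"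
  let ?z = "f (h (fst (L ! Suc m)))" and ?w = "f (h (snd (L ! Suc m)))"
  have "\<bar>?x - ?w\<bar> \<le> \<bar>?x - ?y\<bar> + (\<bar>?y - ?z\<bar> + \<bar>?z - ?w\<bar>)" by linarith
  then have "ennreal \<bar>?x - ?w\<bar> \<le> ennreal \<bar>?x - ?y\<bar> + (ennreal \<bar>?y - ?z\<bar> + ennreal \<bar>?z - ?w\<bar>)"
    by (simp add: ennreal_leI flip: ennreal_plus)
  also have "\<dots> \<le> ((\<Sum>j<Suc m. I j) + (\<Sum>j<m. J j)) + (J m + I (Suc m))"
    using Suc assms(1)[of "Suc m"] assms(2)[of m] by (intro add_mono) auto
  also have "\<dots> = (\<Sum>j<Suc (Suc m). I j) + (\<Sum>j<Suc m. J j)" by (simp add: ac_simps)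
  finally show ?case .
qed

text \<open>A shortest chain avoiding the first \<open>N\<close> disks consists of intervals,
  estimated by \<open>\<rho>\<close>, and of jumps, estimated by \<open>o'\<close>. The jumps go
  through distinct disks met by the path, while the intervals cost at most twice a tail of the
  convergent sum of \<open>\<rho>\<close>; so the contribution of \<open>\<rho>\<close> can be made
  arbitrarily small.\<close>

proposition oscillation_bound_along_path:
  fixes f :: "complex \<Rightarrow> real"
  assumes h: "continuous_on {a..b} h" and ab: "a \<le> b" "h a \<in> S" "h b \<in> S"
    and \<rho>: "\<And>k. \<rho> k \<ge> 0" and fin: "path_sum Q \<rho> ({a..b}, h) < \<infinity>"
    and ug: "\<And>s t. a \<le> s \<Longrightarrow> s \<le> t \<Longrightarrow> t \<le> b \<Longrightarrow> h s \<in> S \<Longrightarrow> h t \<in> S \<Longrightarrow>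
      ennreal \<bar>f (h s) - f (h t)\<bar> \<le> path_sum Q \<rho> ({s..t}, h)"
    and o: "\<And>k x y. x \<in> frontier (Q k) \<Longrightarrow> y \<in> frontier (Q k) \<Longrightarrow> \<bar>f x - f y\<bar> \<le> o' k"
  shows "ennreal \<bar>f (h a) - f (h b)\<bar> \<le> path_sum Q o' ({a..b}, h)"
proof (rule ennreal_le_epsilon)
  fix e :: real assume e: "e > 0"
  have ps: "path_sum Q r ({s..t}, h) = (\<Sum>k. ennreal (r k) * indicator (met h s t) k)" for r s t
    by (simp add: path_sum_suminf trace_interval met_def)
  define r where "r k = \<rho> k * indicator (met h a b) k" for k
  have "(\<Sum>k. ennreal (r k)) = path_sum Q \<rho> ({a..b}, h)"
    unfolding ps r_def by (intro suminf_cong) (auto split: split_indicator)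
  then have "(\<Sum>k. ennreal (r k)) < \<infinity>" using fin by simp
  moreover have "r k \<ge> 0" for k using \<rho> by (simp add: r_def)
  \<comment> \<open>Half of \<open>e\<close>, since a disk can be met by two intervals of the
    chain.\<close>
  ultimately obtain N where N: "(\<Sum>k. ennreal (r k) * indicator {N..} k) \<le> ennreal (e/2)"
    using suminf_ennreal_tail_small[of r "e/2"] e by auto
  define L where "L = arg_min length (chain h N a b)"
  obtain L0 where "chain h N a b L0" using chain_exists[OF h ab] by blast
  then have L: "chain h N a b L" and min: "\<And>L'. chain h N a b L' \<Longrightarrow> length L \<le> length L'"
    unfolding L_def by (auto intro: arg_min_natI arg_min_nat_le)
  have Lne: "L \<noteq> []" using L by (simp add: chain_def)
  have good: "good_interval h N a b (L ! j)" if "j < length L" for j using L that by (auto simp: chain_def)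
  have "\<forall>j. Suc j < length L \<longrightarrow> (\<exists>k\<in>met h a b. h (snd (L ! j)) \<in> frontier (Q k) \<and> h (fst (L ! Suc j)) \<in> frontier (Q k))"
    using L by (auto simp: chain_def jump_def dest: successively_nth)
  then obtain \<kappa> where \<kappa>: "\<And>j. Suc j < length L \<Longrightarrow> \<kappa> j \<in> met h a b \<and> h (snd (L ! j)) \<in> frontier (Q (\<kappa> j)) \<and>
      h (fst (L ! Suc j)) \<in> frontier (Q (\<kappa> j))" by metis
  define m where "m = length L - 1"
  have m: "length L = Suc m" using Lne by (cases L) (auto simp: m_def)
  have inj: "inj_on \<kappa> {..<m}"
  proof (rule linorder_inj_onI)
    fix i j assume ij: "i < j" "i \<in> {..<m}" "j \<in> {..<m}"
    show "\<kappa> i \<noteq> \<kappa> j"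
    proof
      assume eq: "\<kappa> i = \<kappa> j"
      show False
        by (rule shortest_chain(2)[OF h L min, of i j "\<kappa> i"]) (use \<kappa>[of i] \<kappa>[of j] eq ij m in auto)
    qed
  qed auto
  let ?M = "\<lambda>j. met h (fst (L ! j)) (snd (L ! j))"
  \<comment> \<open>An interval meeting disk \<open>k\<close> is either the first such interval or
    its successor, hence the factor 2. Only disks of index at least \<open>N\<close> occur, because
    all intervals avoid the others.\<close>
  have card2: "(\<Sum>j<Suc m. indicator (?M j) k :: ennreal) \<le> 2 * indicator ({N..} \<inter> met h a b) k" for k
  proof -
    define A where "A = {j\<in>{..<Suc m}. k \<in> ?M j}"
    have sA: "(\<Sum>j<Suc m. indicator (?M j) k :: ennreal) = of_nat (card A)"
    proof -
      have "(\<Sum>j\<in>B. indicator (?M j) k :: ennreal) = of_nat (card {j\<in>B. k \<in> ?M j})" if "finite B" for B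
        using that by (simp add: indicator_def sum.If_cases Int_def)
      then show ?thesis unfolding A_def by blast
    qed
    show ?thesis
    proof (cases "A = {}")
      case False
      define i where "i = Min A"
      have i: "i \<in> A" "\<And>j. j \<in> A \<Longrightarrow> i \<le> j" 
      proof -
        have "finite A" by (simp add: A_def)
        then show "i \<in> A" "\<And>j. j \<in> A \<Longrightarrow> i \<le> j" unfolding i_def using False by auto
      qed
      have "j = i \<or> j = Suc i" if j: "j \<in> A" for j
      proof (cases "i < j")
        case True
        then show ?thesis using shortest_chain(1)[OF h L min True, of k] j i(1) m by (auto simp: A_def)
      next
        case False
        then show ?thesis using i(2)[OF j] by simp
      qed
      then have "A \<subseteq> {i, Suc i}" by blast
      then have "card A \<le> card {i, Suc i}" by (intro card_mono) auto
      then have "card A \<le> 2" by simp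
      then have "of_nat (card A) \<le> (of_nat 2 :: ennreal)" by (rule of_nat_mono)
      moreover have "k \<in> {N..} \<inter> met h a b"
      proof -
        have "good_interval h N a b (L ! i)" "k \<in> ?M i" using i(1) good m by (auto simp: A_def)
        then show ?thesis using met_mono[of a "fst (L ! i)" "snd (L ! i)" b h]
          by (fastforce simp: good_interval_def not_less)
      qed
      ultimately show ?thesis using sA by simp
    qed (use sA in simp)
  qed
  have "(\<Sum>j<Suc m. path_sum Q \<rho> ({fst (L ! j)..snd (L ! j)}, h)) =
      (\<Sum>k. \<Sum>j<Suc m. ennreal (\<rho> k) * indicator (?M j) k)"
    unfolding ps by (rule suminf_sum[symmetric]) auto
  also have "\<dots> \<le> (\<Sum>k. 2 * (ennreal (r k) * indicator {N..} k))"
  proof (intro suminf_le allI)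
    fix k
    have "(\<Sum>j<Suc m. ennreal (\<rho> k) * indicator (?M j) k) = ennreal (\<rho> k) * (\<Sum>j<Suc m. indicator (?M j) k)"
      by (rule sum_distrib_left[symmetric])
    also have "\<dots> \<le> ennreal (\<rho> k) * (2 * indicator ({N..} \<inter> met h a b) k)" by (intro mult_left_mono card2) auto
    also have "\<dots> = 2 * (ennreal (r k) * indicator {N..} k)"
      by (auto simp: r_def mult.commute split: split_indicator)
    finally show "(\<Sum>j<Suc m. ennreal (\<rho> k) * indicator (?M j) k) \<le> 2 * (ennreal (r k) * indicator {N..} k)" .
  qed auto
  also have "\<dots> = 2 * (\<Sum>k. ennreal (r k) * indicator {N..} k)" by simp
  also have "\<dots> \<le> 2 * ennreal (e/2)" by (intro mult_left_mono N) auto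
  also have "\<dots> = ennreal e" using e by (metis ennreal_mult' ennreal_numeral field_sum_of_halves mult_2 zero_le_numeral)
  finally have tail: "(\<Sum>j<Suc m. path_sum Q \<rho> ({fst (L ! j)..snd (L ! j)}, h)) \<le> ennreal e" .
  have o0: "o' k \<ge> 0" for k using o[of _ k] frontier_nonempty[of k] by fastforce
  have "(\<Sum>j<m. ennreal (o' (\<kappa> j))) = (\<Sum>k\<in>\<kappa> ` {..<m}. ennreal (o' k))"
    using inj by (simp add: sum.reindex)
  also have "\<dots> = (\<Sum>k\<in>\<kappa> ` {..<m}. ennreal (o' k) * indicator (met h a b) k)"
    using \<kappa> m by (intro sum.cong) auto
  also have "\<dots> \<le> path_sum Q o' ({a..b}, h)" unfolding ps by (intro sum_le_suminf) auto
  finally have jumps: "(\<Sum>j<m. ennreal (o' (\<kappa> j))) \<le> path_sum Q o' ({a..b}, h)" .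
  have "ennreal \<bar>f (h (fst (L ! 0))) - f (h (snd (L ! m)))\<bar> \<le>
      (\<Sum>j<Suc m. path_sum Q \<rho> ({fst (L ! j)..snd (L ! j)}, h)) + (\<Sum>j<m. ennreal (o' (\<kappa> j)))"
  proof (rule chain_variation)
    fix j assume "j < length L"
    then show "ennreal \<bar>f (h (fst (L ! j))) - f (h (snd (L ! j)))\<bar> \<le> path_sum Q \<rho> ({fst (L ! j)..snd (L ! j)}, h)"
      using good[of j] by (intro ug) (auto simp: good_interval_def)
  next
    fix j assume "Suc j < length L"
    then show "ennreal \<bar>f (h (snd (L ! j))) - f (h (fst (L ! Suc j)))\<bar> \<le> ennreal (o' (\<kappa> j))"
      using \<kappa>[of j] by (intro ennreal_leI o) auto
  qed (use m in simp)
  moreover have "fst (L ! 0) = a" "snd (L ! m) = b"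
    using L m Lne by (auto simp: chain_def hd_conv_nth last_conv_nth)
  ultimately show "ennreal \<bar>f (h a) - f (h b)\<bar> \<le> path_sum Q o' ({a..b}, h) + ennreal e"
    using add_mono[OF tail jumps] by (simp add: add.commute)
qed

end

lemma ennreal_le_iff_ereal: "0 \<le> r \<Longrightarrow> ennreal r \<le> X \<longleftrightarrow> ereal r \<le> enn2ereal X"
  by (simp add: less_eq_ennreal.rep_eq enn2ereal_ennreal)

lemma is_subpath_interval:
  assumes "is_cpath \<gamma>" "s \<in> fst \<gamma>" "t \<in> fst \<gamma>" "s \<le> t"
  shows "is_subpath ({s..t}, snd \<gamma>) \<gamma>"
  using assms cpath_interval_subset[OF assms(1-3)] by (auto simp: is_subpath_def is_interval_cc)

lemma ball_compactly_contained: "compactly_contained (ball x r) UNIV"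
  by (simp add: compactly_contained_def compact_eq_bounded_closed bounded_closure)

section \<open>From some upper gradient to the oscillations\<close>

context planar_carpet
begin

text \<open>The exceptional family is enlarged by all paths that have a subpath in it, so a path
  outside it satisfies the inequality on each of its closed subintervals. The shortening argument
  needs it there.\<close>

lemma upper_gradientD:
  assumes "upper_gradient v UNIV Q \<rho> g"
  obtains \<Gamma> where "\<Gamma> \<subseteq> paths_in UNIV" "carpet_modulus v UNIV Q \<Gamma> = 0"
    "\<And>\<gamma> s t. \<gamma> \<in> paths_in UNIV - \<Gamma> \<Longrightarrow> s \<in> fst \<gamma> \<Longrightarrow> t \<in> fst \<gamma> \<Longrightarrow> s \<le> t \<Longrightarrow> snd \<gamma> s \<in> S \<Longrightarrow> snd \<gamma> t \<in> S \<Longrightarrow>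
       \<bar>g (snd \<gamma> s)\<bar> \<noteq> \<infinity> \<and> \<bar>g (snd \<gamma> t)\<bar> \<noteq> \<infinity> \<and>
       \<bar>g (snd \<gamma> s) - g (snd \<gamma> t)\<bar> \<le> enn2ereal (path_sum Q \<rho> ({s..t}, snd \<gamma>))"
proof -
  from assms obtain \<Gamma>0 where G0: "\<Gamma>0 \<subseteq> paths_in UNIV" "carpet_modulus v UNIV Q \<Gamma>0 = 0"
    "\<forall>\<gamma>\<in>paths_in UNIV - \<Gamma>0. \<forall>x\<in>trace \<gamma> \<inter> S. \<forall>y\<in>trace \<gamma> \<inter> S.
           \<bar>g x\<bar> \<noteq> \<infinity> \<and> \<bar>g y\<bar> \<noteq> \<infinity> \<and> \<bar>g x - g y\<bar> \<le> enn2ereal (path_sum Q \<rho> \<gamma>)"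
    unfolding upper_gradient_def by blast
  define \<Gamma> where "\<Gamma> = {\<gamma>\<in>paths_in UNIV. \<exists>\<gamma>'\<in>\<Gamma>0. is_subpath \<gamma>' \<gamma>}"
  have "carpet_modulus v UNIV Q \<Gamma> = 0"
    by (rule carpet_modulus_null_superpath[OF G0(2)]) (simp add: \<Gamma>_def)
  moreover have "\<bar>g (snd \<gamma> s)\<bar> \<noteq> \<infinity> \<and> \<bar>g (snd \<gamma> t)\<bar> \<noteq> \<infinity> \<and>
       \<bar>g (snd \<gamma> s) - g (snd \<gamma> t)\<bar> \<le> enn2ereal (path_sum Q \<rho> ({s..t}, snd \<gamma>))"
    if \<gamma>: "\<gamma> \<in> paths_in UNIV - \<Gamma>" and st: "s \<in> fst \<gamma>" "t \<in> fst \<gamma>" "s \<le> t" "snd \<gamma> s \<in> S" "snd \<gamma> t \<in> S" for \<gamma> s t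
  proof -
    have cp: "is_cpath \<gamma>" using \<gamma> by (simp add: paths_in_def)
    have sub: "is_subpath ({s..t}, snd \<gamma>) \<gamma>" by (rule is_subpath_interval[OF cp st(1-3)])
    then have "({s..t}, snd \<gamma>) \<in> paths_in UNIV" using \<gamma> paths_in_subpath by blast
    moreover have "({s..t}, snd \<gamma>) \<notin> \<Gamma>0" using sub \<gamma> by (auto simp: \<Gamma>_def)
    moreover have "snd \<gamma> s \<in> trace ({s..t}, snd \<gamma>) \<inter> S" "snd \<gamma> t \<in> trace ({s..t}, snd \<gamma>) \<inter> S"
      using st by (auto simp: trace_def)
    ultimately show ?thesis using G0(3)[rule_format, of "({s..t}, snd \<gamma>)" "snd \<gamma> s" "snd \<gamma> t"] by simp
  qed
  moreover have "\<Gamma> \<subseteq> paths_in UNIV" by (auto simp: \<Gamma>_def)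
  ultimately show ?thesis using that by blast
qed

text \<open>Paths with infinite \<open>\<rho>\<close>-sum have modulus zero since
  \<open>\<rho>\<close> is locally square summable. Along the other paths the shortening argument
  replaces \<open>\<rho>\<close> by the bound \<open>o'\<close> of the oscillations.\<close>

lemma upper_gradient_oscillationI:
  fixes f :: "complex \<Rightarrow> real"
  assumes \<rho>: "\<And>k. \<rho> k \<ge> 0"
    and sq: "\<And>n::nat. (\<lambda>i. (\<rho> i)\<^sup>2) summable_on disks_meeting Q (ball 0 (real n))"
    and \<Gamma>: "\<Gamma> \<subseteq> paths_in UNIV" "carpet_modulus v UNIV Q \<Gamma> = 0"
    and ug: "\<And>\<gamma> s t. \<gamma> \<in> paths_in UNIV - \<Gamma> \<Longrightarrow> s \<in> fst \<gamma> \<Longrightarrow> t \<in> fst \<gamma> \<Longrightarrow> s \<le> t \<Longrightarrow> snd \<gamma> s \<in> S \<Longrightarrow> snd \<gamma> t \<in> S \<Longrightarrow>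
       ennreal \<bar>f (snd \<gamma> s) - f (snd \<gamma> t)\<bar> \<le> path_sum Q \<rho> ({s..t}, snd \<gamma>)"
    and o: "\<And>k x y. x \<in> frontier (Q k) \<Longrightarrow> y \<in> frontier (Q k) \<Longrightarrow> \<bar>f x - f y\<bar> \<le> o' k"
  shows "upper_gradient v UNIV Q o' (\<lambda>x. ereal (f x))"
  unfolding upper_gradient_def
proof (intro conjI exI[of _ "\<Gamma> \<union> {\<gamma>\<in>paths_in UNIV. path_sum Q \<rho> \<gamma> = \<infinity>}"] allI ballI)
  show "0 \<le> o' i" for i using o[of _ i] frontier_nonempty[of i] by fastforce
  show "carpet_modulus v UNIV Q (\<Gamma> \<union> {\<gamma> \<in> paths_in UNIV. path_sum Q \<rho> \<gamma> = \<infinity>}) = 0"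
    by (intro carpet_modulus_null_Un \<Gamma>(2) carpet_modulus_path_sum_infinite \<rho> sq Q_nonempty)
       (use \<Gamma>(1) in \<open>auto simp: paths_in_def\<close>)
  fix \<gamma> x y assume \<gamma>: "\<gamma> \<in> paths_in UNIV - (\<Gamma> \<union> {\<gamma>\<in>paths_in UNIV. path_sum Q \<rho> \<gamma> = \<infinity>})"
    and xy: "x \<in> trace \<gamma> \<inter> S" "y \<in> trace \<gamma> \<inter> S"
  have cp: "is_cpath \<gamma>" using \<gamma> by (simp add: paths_in_def)
  have fin: "path_sum Q \<rho> \<gamma> < \<infinity>" using \<gamma> by (auto simp: less_top)
  have *: "ennreal \<bar>f (snd \<gamma> s) - f (snd \<gamma> t)\<bar> \<le> path_sum Q o' \<gamma>"
    if st: "s \<in> fst \<gamma>" "t \<in> fst \<gamma>" "s \<le> t" "snd \<gamma> s \<in> S" "snd \<gamma> t \<in> S" for s t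
  proof -
    have sub: "is_subpath ({s..t}, snd \<gamma>) \<gamma>" by (rule is_subpath_interval[OF cp st(1-3)])
    have inc: "{s..t} \<subseteq> fst \<gamma>" by (rule cpath_interval_subset[OF cp st(1,2)])
    have "ennreal \<bar>f (snd \<gamma> s) - f (snd \<gamma> t)\<bar> \<le> path_sum Q o' ({s..t}, snd \<gamma>)"
    proof (rule oscillation_bound_along_path[where \<rho>=\<rho>])
      show "continuous_on {s..t} (snd \<gamma>)" by (rule continuous_on_cpath[OF cp inc])
      show "path_sum Q \<rho> ({s..t}, snd \<gamma>) < \<infinity>"
        using path_sum_mono[OF trace_subpath[OF sub], of Q \<rho> \<rho>] fin by (simp add: le_less_trans)
      show "ennreal \<bar>f (snd \<gamma> s') - f (snd \<gamma> t')\<bar> \<le> path_sum Q \<rho> ({s'..t'}, snd \<gamma>)"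
        if "s \<le> s'" "s' \<le> t'" "t' \<le> t" "snd \<gamma> s' \<in> S" "snd \<gamma> t' \<in> S" for s' t'
        using that \<gamma> inc by (intro ug) auto
    qed (use st \<rho> o in auto)
    also have "\<dots> \<le> path_sum Q o' \<gamma>" by (rule path_sum_mono[OF trace_subpath[OF sub]]) simp
    finally show ?thesis .
  qed
  obtain s t where st: "s \<in> fst \<gamma>" "t \<in> fst \<gamma>" "x = snd \<gamma> s" "y = snd \<gamma> t" using xy by (auto simp: trace_def)
  have "ennreal \<bar>f x - f y\<bar> \<le> path_sum Q o' \<gamma>"
    using *[of s t] *[of t s] st xy by (cases "s \<le> t") (auto simp: abs_minus_commute)
  then show "\<bar>ereal (f x) - ereal (f y)\<bar> \<le> enn2ereal (path_sum Q o' \<gamma>)"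
    by (simp add: ennreal_le_iff_ereal)
qed (use \<Gamma>(1) in auto)

text \<open>Along the path the distance from \<open>h s\<close> takes all values up to
  \<open>dist (h s) (h t)\<close>. Carpet points account for a null set of values, and each disk for
  an interval as long as its diameter. So multiples of the diameters serve as upper gradients of
  Lipschitz functions.\<close>

lemma dist_le_path_sum_diameter:
  assumes h: "continuous_on {s..t} h" and st: "s \<le> t" and null: "hausdorff_measure 1 (h ` {s..t} \<inter> S) = 0"
  shows "ennreal (dist (h s) (h t)) \<le> path_sum Q (\<lambda>k. diameter (Q k)) ({s..t}, h)"
proof -
  let ?p = "\<lambda>z. dist (h s) z" and ?M = "disks_meeting Q (h ` {s..t})"
  have "negligible (?p ` (h ` {s..t} \<inter> S))"
    by (rule negligible_image_hausdorff_null[OF null]) (metis abs_dist_diff_le dist_commute)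
  then obtain N where N: "?p ` (h ` {s..t} \<inter> S) \<subseteq> N" "N \<in> null_sets lborel" by (rule null_set_of_negligible)
  define J where "J k = {Inf (?p ` Q k)..Inf (?p ` Q k) + diameter (Q k)}" for k
  have J: "?p z \<in> J k" if z: "z \<in> Q k" for z k
  proof -
    have "bdd_below (?p ` Q k)" by (auto intro!: bdd_belowI[of _ 0])
    then have "Inf (?p ` Q k) \<le> ?p z" using z by (intro cInf_lower) auto
    moreover have "?p z - diameter (Q k) \<le> Inf (?p ` Q k)"
    proof (rule cInf_greatest)
      show "?p ` Q k \<noteq> {}" using Q_nonempty by simp
      fix r assume "r \<in> ?p ` Q k"
      then obtain w where w: "w \<in> Q k" "r = ?p w" by auto
      have "dist w z \<le> diameter (Q k)" using w z closure_subset by (intro dist_le_diameter) auto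
      then show "?p z - diameter (Q k) \<le> r" using w dist_triangle[of "h s" z w] by simp
    qed
    ultimately show ?thesis by (auto simp: J_def)
  qed
  have cov: "{0..dist (h s) (h t)} \<subseteq> N \<union> (\<Union>k\<in>?M. J k)"
  proof
    fix r assume r: "r \<in> {0..dist (h s) (h t)}"
    have "continuous_on {s..t} (\<lambda>x. ?p (h x))" using h by (intro continuous_intros)
    then obtain x where x: "s \<le> x" "x \<le> t" "?p (h x) = r"
      using IVT'[of "\<lambda>x. ?p (h x)" s r t] r st by auto
    show "r \<in> N \<union> (\<Union>k\<in>?M. J k)"
    proof (cases "h x \<in> S")
      case True
      then show ?thesis using N x by auto
    next
      case False
      then obtain k where k: "h x \<in> Q k" by (auto simp: carpet_eq)
      then have "k \<in> ?M" using x by (auto simp: disks_meeting_def)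
      then show ?thesis using J[OF k] x by auto
    qed
  qed
  have "ennreal (dist (h s) (h t)) = emeasure lborel {0..dist (h s) (h t)}" by simp
  also have "\<dots> \<le> emeasure lborel (N \<union> (\<Union>k\<in>?M. J k))"
    using N by (intro emeasure_mono[OF cov]) (auto simp: J_def null_sets_def)
  also have "\<dots> = emeasure lborel ((\<Union>k\<in>?M. J k) \<union> N)" by (simp add: Un_commute)
  also have "\<dots> = emeasure lborel (\<Union>k\<in>?M. J k)" using N by (intro emeasure_Un_null_set) (auto simp: J_def)
  also have "(\<Union>k\<in>?M. J k) = (\<Union>k. if k \<in> ?M then J k else {})" by auto
  also have "emeasure lborel \<dots> \<le> (\<Sum>k. emeasure lborel (if k \<in> ?M then J k else {}))"
    by (rule emeasure_subadditive_countably) (auto simp: J_def)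
  also have "\<dots> = path_sum Q (\<lambda>k. diameter (Q k)) ({s..t}, h)"
    unfolding path_sum_suminf trace_interval using diameter_pos
    by (intro suminf_cong) (auto simp: J_def less_imp_le)
  finally show ?thesis .
qed

text \<open>The real counterpart of \<open>osc\<close>, used for functions bounded on the circle,
  where real \<open>Sup\<close> and \<open>Inf\<close> are meaningful.\<close>

definition real_osc :: "(complex \<Rightarrow> real) \<Rightarrow> nat \<Rightarrow> real" where
  "real_osc f k = Sup (f ` frontier (Q k)) - Inf (f ` frontier (Q k))"

lemma
  assumes "bounded (f ` frontier (Q k))"
  shows Mdisk_real: "Mdisk (\<lambda>x. ereal (f x)) (Q k) = ereal (Sup (f ` frontier (Q k)))"
    and mdisk_real: "mdisk (\<lambda>x. ereal (f x)) (Q k) = ereal (Inf (f ` frontier (Q k)))"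
    and osc_real: "osc (\<lambda>x. ereal (f x)) (Q k) = ereal (real_osc f k)"
    and real_osc_upper: "x \<in> frontier (Q k) \<Longrightarrow> y \<in> frontier (Q k) \<Longrightarrow> \<bar>f x - f y\<bar> \<le> real_osc f k"
    and real_osc_nonneg: "real_osc f k \<ge> 0"
proof -
  let ?A = "f ` frontier (Q k)"
  have ne: "?A \<noteq> {}" using frontier_nonempty by simp
  have bdd: "bdd_above ?A" "bdd_below ?A" using assms by (auto simp: bounded_imp_bdd_above bounded_imp_bdd_below)
  have up: "f x \<le> Sup ?A" "Inf ?A \<le> f x" if "x \<in> frontier (Q k)" for x
    using bdd that by (auto intro: cSup_upper cInf_lower)
  have "\<bar>SUP x\<in>frontier (Q k). ereal (f x)\<bar> \<noteq> \<infinity>"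
  proof -
    obtain z where z: "z \<in> frontier (Q k)" using frontier_nonempty by blast
    have "ereal (f z) \<le> (SUP x\<in>frontier (Q k). ereal (f x))" using z by (rule SUP_upper)
    moreover have "(SUP x\<in>frontier (Q k). ereal (f x)) \<le> ereal (Sup ?A)" using up by (intro SUP_least) simp
    ultimately show ?thesis by auto
  qed
  then show M: "Mdisk (\<lambda>x. ereal (f x)) (Q k) = ereal (Sup ?A)"
    unfolding Mdisk_def by (subst ereal_SUP) auto
  have "\<bar>INF x\<in>frontier (Q k). ereal (f x)\<bar> \<noteq> \<infinity>"
  proof -
    obtain z where z: "z \<in> frontier (Q k)" using frontier_nonempty by blast
    have "(INF x\<in>frontier (Q k). ereal (f x)) \<le> ereal (f z)" using z by (rule INF_lower)
    moreover have "ereal (Inf ?A) \<le> (INF x\<in>frontier (Q k). ereal (f x))" using up by (intro INF_greatest) simp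
    ultimately show ?thesis by auto
  qed
  then show m: "mdisk (\<lambda>x. ereal (f x)) (Q k) = ereal (Inf ?A)"
    unfolding mdisk_def by (subst ereal_INF) auto
  show "osc (\<lambda>x. ereal (f x)) (Q k) = ereal (real_osc f k)" by (simp add: osc_def M m real_osc_def)
  show "\<bar>f x - f y\<bar> \<le> real_osc f k" if "x \<in> frontier (Q k)" "y \<in> frontier (Q k)"
    using up[OF that(1)] up[OF that(2)] by (simp add: real_osc_def)
  obtain z where z: "z \<in> frontier (Q k)" using frontier_nonempty by blast
  then show "real_osc f k \<ge> 0" using up[OF z] by (simp add: real_osc_def)
qed

lemma real_osc_least:
  assumes "\<And>x y. x \<in> frontier (Q k) \<Longrightarrow> y \<in> frontier (Q k) \<Longrightarrow> \<bar>f x - f y\<bar> \<le> c"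
  shows "real_osc f k \<le> c"
proof -
  let ?A = "f ` frontier (Q k)"
  have ne: "?A \<noteq> {}" using frontier_nonempty by simp
  have "Sup ?A \<le> f y + c" if "y \<in> frontier (Q k)" for y
    using ne assms[OF _ that] by (intro cSup_least) (auto simp: abs_le_iff algebra_simps)
  then have "Sup ?A - c \<le> Inf ?A" using ne by (intro cInf_greatest) (auto simp: algebra_simps)
  then show ?thesis by (simp add: real_osc_def)
qed

lemma frontier_disjoint_ball:
  assumes "k \<notin> disks_meeting Q (ball x r)" shows "frontier (Q k) \<inter> ball x r = {}"
proof -
  have "Q k \<inter> ball x r = {}" using assms by (simp add: disks_meeting_def)
  then have "closure (Q k) \<inter> ball x r = {}" using open_Int_closure_eq_empty[of "ball x r" "Q k"] by (auto simp: Int_commute)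
  then show ?thesis using frontier_subset_closure by blast
qed

end

section \<open>The Caccioppoli inequality\<close>

text \<open>The absence of mixed terms is what makes the energy of an average of \<open>N\<close>
  cutoffs decay like \<open>1/N\<close>.\<close>

lemma square_sum_one_nonzero:
  fixes p :: "nat \<Rightarrow> real"
  assumes "\<And>i j. i < j \<Longrightarrow> j < N \<Longrightarrow> p i \<noteq> 0 \<Longrightarrow> p j = 0"
  shows "(\<Sum>j<N. p j)\<^sup>2 = (\<Sum>j<N. (p j)\<^sup>2)"
proof (cases "\<exists>j<N. p j \<noteq> 0")
  case True
  then obtain j where j: "j < N" "p j \<noteq> 0" by blast
  have z: "p i = 0" if "i < N" "i \<noteq> j" for i
    using assms[of i j] assms[of j i] that j by (metis linorder_neqE_nat)
  have "(\<Sum>i<N. p i) = (\<Sum>i\<in>{j}. p i)" "(\<Sum>i<N. (p i)\<^sup>2) = (\<Sum>i\<in>{j}. (p i)\<^sup>2)"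
    by (rule sum.mono_neutral_right; use z j in auto)+
  then show ?thesis by simp
qed auto

section \<open>Cutoff functions of small energy\<close>

definition tent :: "real \<Rightarrow> complex \<Rightarrow> real" where
  "tent r x = max 0 (min 1 (2 - norm x / r))"

lemma tent_bounds: "0 \<le> tent r x" "tent r x \<le> 1" by (auto simp: tent_def)

lemma tent_eq: "r > 0 \<Longrightarrow> norm x \<le> r \<Longrightarrow> tent r x = 1" "r > 0 \<Longrightarrow> norm x \<ge> 2 * r \<Longrightarrow> tent r x = 0"
  by (auto simp: tent_def min_def max_def field_simps)

lemma tent_lipschitz: assumes "r > 0" shows "\<bar>tent r x - tent r y\<bar> \<le> dist x y / r"
proof -
  have "\<bar>tent r x - tent r y\<bar> \<le> \<bar>norm x / r - norm y / r\<bar>" by (auto simp: tent_def)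
  also have "\<dots> = \<bar>norm x - norm y\<bar> / r" using assms by (simp add: diff_divide_distrib[symmetric])
  also have "\<dots> \<le> dist x y / r" using assms norm_triangle_ineq3[of x y] by (simp add: dist_norm divide_right_mono)
  finally show ?thesis .
qed

context planar_carpet
begin

text \<open>An average of tents at scales so sparse that no disk oscillates for two of them.\<close>

lemma cutoff_exists:
  assumes r0: "r0 > 0" and N: "N \<ge> (1::nat)"
  shows "\<exists>\<phi> Lc R. (Lc::real) \<ge> 0 \<and> (R::real) > 0 \<and> (\<forall>x. 0 \<le> \<phi> x \<and> \<phi> x \<le> 1) \<and> (\<forall>x y. \<bar>\<phi> x - \<phi> y\<bar> \<le> Lc * dist x y) \<and>
    (\<forall>x. norm x \<ge> R \<longrightarrow> \<phi> x = 0) \<and> (\<forall>x. norm x \<le> r0 \<longrightarrow> \<phi> x = 1) \<and>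
    (\<forall>F. finite F \<longrightarrow> (\<Sum>k\<in>F. (real_osc \<phi> k)\<^sup>2) \<le> 4 * fatness / real N)"
proof -
  \<comment> \<open>The tent of scale \<open>r\<close> vanishes outside
    \<open>ball 0 (2 * r)\<close>. The radius \<open>step r\<close> is so large that every disk
    meeting this ball lies in \<open>ball 0 (step r)\<close>.\<close>
  have "\<forall>r. \<exists>r'\<ge>2 * r. \<forall>k\<in>disks_meeting Q (ball 0 (2 * r)). closure (Q k) \<subseteq> ball 0 r'"
    using disks_meeting_ball_bounded by blast
  then obtain step where step: "\<And>r. step r \<ge> 2 * r"
    "\<And>r k. k \<in> disks_meeting Q (ball 0 (2 * r)) \<Longrightarrow> closure (Q k) \<subseteq> ball 0 (step r)" by metis
  define R where "R j = (step ^^ j) r0" for j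
  have R0: "R 0 = r0" and RS: "R (Suc j) = step (R j)" for j by (auto simp: R_def)
  have Rpos: "R j \<ge> r0" for j
  proof (induction j)
    case (Suc j)
    then show ?case using RS[of j] step(1)[of "R j"] r0 by linarith
  qed (simp add: R0)
  then have Rp: "R j > 0" for j using r0 by (meson less_le_trans)
  have Rmono: "i \<le> j \<Longrightarrow> R i \<le> R j" for i j
  proof (rule lift_Suc_mono_le)
    show "R n \<le> R (Suc n)" for n using RS[of n] step(1)[of "R n"] Rp[of n] by linarith
  qed
  define \<phi> where "\<phi> x = (\<Sum>j<N. tent (R j) x) / real N" for x
  have Np: "real N > 0" using N by simp
  define p where "p k j = real_osc (tent (R j)) k" for k j
  have bt: "bounded (tent (R j) ` A)" for j A
    unfolding bounded_iff using tent_bounds by (auto intro!: exI[of _ 1])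
  have p0: "p k j \<ge> 0" for k j unfolding p_def by (rule real_osc_nonneg[OF bt])
  have pout: "p k j = 0" if "k \<notin> disks_meeting Q (ball 0 (2 * R j))" for k j
  proof -
    have "tent (R j) x = 0" if "x \<in> frontier (Q k)" for x
      using frontier_disjoint_ball[OF \<open>k \<notin> _\<close>] that by (intro tent_eq Rp) force
    then have "p k j \<le> 0" unfolding p_def by (intro real_osc_least) simp
    then show ?thesis using p0[of k j] by simp
  qed
  have pin: "p k j = 0" if "closure (Q k) \<subseteq> ball 0 (R j)" for k j
  proof -
    have "tent (R j) x = 1" if "x \<in> frontier (Q k)" for x
      using \<open>closure (Q k) \<subseteq> _\<close> that frontier_subset_closure[of k] by (intro tent_eq Rp) force
    then have "p k j \<le> 0" unfolding p_def by (intro real_osc_least) simp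
    then show ?thesis using p0[of k j] by simp
  qed
  \<comment> \<open>A disk on which the tent of scale \<open>R i\<close> varies meets
    \<open>ball 0 (2 * R i)\<close>, so it lies in \<open>ball 0 (R (Suc i))\<close>, where all
    later tents equal 1.\<close>
  have one: "p k j = 0" if "i < j" "p k i \<noteq> 0" for i j k
  proof -
    have "k \<in> disks_meeting Q (ball 0 (2 * R i))" using pout that by blast
    then have "closure (Q k) \<subseteq> ball 0 (R (Suc i))" unfolding RS by (rule step(2))
    also have "\<dots> \<subseteq> ball 0 (R j)" using Rmono[of "Suc i" j] that by (intro subset_ball) simp
    finally show ?thesis by (rule pin)
  qed
  \<comment> \<open>The Lipschitz bound \<open>diameter (Q k) / R j\<close> is combined with the
    trivial bound 1. The latter is relaxed to 4 to match the fatness estimate in the ball of radius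
    \<open>2 * R j\<close>.\<close>
  have pm: "p k j \<le> min (diameter (Q k)) (2 * (2 * R j)) / R j" for k j
    unfolding p_def
  proof (rule real_osc_least)
    fix x y assume xy: "x \<in> frontier (Q k)" "y \<in> frontier (Q k)"
    have "dist x y \<le> diameter (Q k)" using xy frontier_subset_closure by (intro dist_le_diameter) auto
    then have "\<bar>tent (R j) x - tent (R j) y\<bar> * R j \<le> diameter (Q k)"
      using tent_lipschitz[OF Rp[of j], of x y] Rp[of j] by (simp add: pos_le_divide_eq)
    moreover have "\<bar>tent (R j) x - tent (R j) y\<bar> \<le> 1"
      using tent_bounds[of "R j" x] tent_bounds[of "R j" y] by linarith
    then have "\<bar>tent (R j) x - tent (R j) y\<bar> * R j \<le> 1 * R j" using Rp[of j] by (intro mult_right_mono) auto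
    ultimately show "\<bar>tent (R j) x - tent (R j) y\<bar> \<le> min (diameter (Q k)) (2 * (2 * R j)) / R j"
      using Rp[of j] by (simp add: pos_le_divide_eq)
  qed
  have energy: "(\<Sum>k\<in>F. (p k j)\<^sup>2) \<le> 4 * fatness" if F: "finite F" for F j
  proof -
    define F' where "F' = {k\<in>F. k \<in> disks_meeting Q (ball 0 (2 * R j))}"
    have F': "finite F'" "F' \<subseteq> disks_meeting Q (ball 0 (2 * R j))" using F by (auto simp: F'_def)
    have "(\<Sum>k\<in>F. (p k j)\<^sup>2) = (\<Sum>k\<in>F'. (p k j)\<^sup>2)"
      using F pout by (intro sum.mono_neutral_right) (auto simp: F'_def)
    also have "\<dots> \<le> (\<Sum>k\<in>F'. (min (diameter (Q k)) (2 * (2 * R j)))\<^sup>2 / (R j)\<^sup>2)"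
      using pm p0 by (intro sum_mono) (metis power_divide power_mono)
    also have "\<dots> = (\<Sum>k\<in>F'. (min (diameter (Q k)) (2 * (2 * R j)))\<^sup>2) / (R j)\<^sup>2"
      by (simp add: sum_divide_distrib)
    also have "\<dots> \<le> (fatness * (2 * R j)\<^sup>2) / (R j)\<^sup>2"
      using F' Rp[of j] by (intro divide_right_mono fatness(2)) auto
    also have "\<dots> = 4 * fatness" using Rp[of j] by (simp add: power_mult_distrib)
    finally show ?thesis .
  qed
  have rop: "real_osc \<phi> k \<le> (\<Sum>j<N. p k j) / real N" for k
  proof (rule real_osc_least)
    fix x y assume xy: "x \<in> frontier (Q k)" "y \<in> frontier (Q k)"
    have "\<bar>\<phi> x - \<phi> y\<bar> = \<bar>\<Sum>j<N. tent (R j) x - tent (R j) y\<bar> / real N"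
      by (simp add: \<phi>_def sum_subtractf diff_divide_distrib[symmetric] abs_divide)
    also have "\<dots> \<le> (\<Sum>j<N. \<bar>tent (R j) x - tent (R j) y\<bar>) / real N"
      by (intro divide_right_mono sum_abs) simp
    also have "\<dots> \<le> (\<Sum>j<N. p k j) / real N"
      unfolding p_def using xy by (intro divide_right_mono sum_mono real_osc_upper[OF bt]) auto
    finally show "\<bar>\<phi> x - \<phi> y\<bar> \<le> (\<Sum>j<N. p k j) / real N" .
  qed
  have b01: "0 \<le> \<phi> x \<and> \<phi> x \<le> 1" for x
  proof
    show "0 \<le> \<phi> x" unfolding \<phi>_def by (intro divide_nonneg_nonneg sum_nonneg tent_bounds) simp
    have "(\<Sum>j<N. tent (R j) x) \<le> (\<Sum>j<N. 1)" by (intro sum_mono tent_bounds)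
    then show "\<phi> x \<le> 1" unfolding \<phi>_def using Np by simp
  qed
  have lip: "\<bar>\<phi> x - \<phi> y\<bar> \<le> (1 / r0) * dist x y" for x y
  proof -
    have "\<bar>\<phi> x - \<phi> y\<bar> = \<bar>\<Sum>j<N. tent (R j) x - tent (R j) y\<bar> / real N"
      by (simp add: \<phi>_def sum_subtractf diff_divide_distrib[symmetric] abs_divide)
    also have "\<dots> \<le> (\<Sum>j<N. \<bar>tent (R j) x - tent (R j) y\<bar>) / real N"
      by (intro divide_right_mono sum_abs) simp
    also have "\<dots> \<le> (\<Sum>j<N. dist x y / r0) / real N"
    proof (intro divide_right_mono sum_mono)
      fix j
      have "\<bar>tent (R j) x - tent (R j) y\<bar> \<le> dist x y / R j" by (rule tent_lipschitz[OF Rp])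
      also have "\<dots> \<le> dist x y / r0" using Rpos[of j] r0 by (intro divide_left_mono) auto
      finally show "\<bar>tent (R j) x - tent (R j) y\<bar> \<le> dist x y / r0" .
    qed simp
    also have "\<dots> = (1 / r0) * dist x y" using Np by simp
    finally show ?thesis .
  qed
  have zero: "\<phi> x = 0" if "norm x \<ge> 2 * R N" for x
  proof -
    have "tent (R j) x = 0" if "j < N" for j
      using Rmono[of j N] that \<open>norm x \<ge> _\<close> by (intro tent_eq Rp) auto
    then show ?thesis by (simp add: \<phi>_def)
  qed
  have onein: "\<phi> x = 1" if "norm x \<le> r0" for x
  proof -
    have "tent (R j) x = 1" for j using Rpos[of j] that by (intro tent_eq Rp) auto
    then show ?thesis using Np by (simp add: \<phi>_def)
  qed
  have tot: "(\<Sum>k\<in>F. (real_osc \<phi> k)\<^sup>2) \<le> 4 * fatness / real N" if F: "finite F" for F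
  proof -
    have "(\<Sum>k\<in>F. (real_osc \<phi> k)\<^sup>2) \<le> (\<Sum>k\<in>F. (\<Sum>j<N. (p k j)\<^sup>2) / (real N)\<^sup>2)"
    proof (rule sum_mono)
      fix k
      have "bounded (\<phi> ` frontier (Q k))" unfolding bounded_iff using b01 by (auto intro!: exI[of _ 1])
      then have "real_osc \<phi> k \<ge> 0" by (rule real_osc_nonneg)
      then have "(real_osc \<phi> k)\<^sup>2 \<le> ((\<Sum>j<N. p k j) / real N)\<^sup>2" using rop by (intro power_mono) auto
      also have "\<dots> = (\<Sum>j<N. (p k j)\<^sup>2) / (real N)\<^sup>2"
        using square_sum_one_nonzero[of N "p k"] one by (simp add: power_divide)
      finally show "(real_osc \<phi> k)\<^sup>2 \<le> (\<Sum>j<N. (p k j)\<^sup>2) / (real N)\<^sup>2" .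
    qed
    also have "\<dots> = (\<Sum>j<N. \<Sum>k\<in>F. (p k j)\<^sup>2) / (real N)\<^sup>2"
      by (subst sum.swap) (simp add: sum_divide_distrib)
    also have "\<dots> \<le> (\<Sum>j<N. 4 * fatness) / (real N)\<^sup>2"
      using energy[OF F] by (intro divide_right_mono sum_mono) auto
    \<comment> \<open>There are \<open>N\<close> scales of energy at most \<open>4 * fatness\<close>
      each, divided by the square of \<open>N\<close> from averaging.\<close>
    also have "\<dots> = 4 * fatness / real N" using Np by (simp add: power2_eq_square)
    finally show ?thesis .
  qed
  show ?thesis
    by (intro exI[of _ \<phi>] exI[of _ "1 / r0"] exI[of _ "2 * R N"])
       (use r0 Rp b01 lip zero onein tot in auto)
qed

section \<open>Competitors and the comparison of energies\<close>

lemma energy_real: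
  assumes "\<And>k. k \<in> disks_meeting Q V \<Longrightarrow> bounded (f ` frontier (Q k))"
  shows "dirichlet_energy Q V (\<lambda>x. ereal (f x)) = (\<Sum>\<^sub>\<infinity>k\<in>disks_meeting Q V. ennreal ((real_osc f k)\<^sup>2))"
  unfolding dirichlet_energy_def
proof (rule infsum_cong)
  fix k assume "k \<in> disks_meeting Q V"
  from assms[OF this] show "(e2ennreal (osc (\<lambda>x. ereal (f x)) (Q k)))\<^sup>2 = ennreal ((real_osc f k)\<^sup>2)"
    by (simp add: osc_real real_osc_nonneg ennreal_power flip: ennreal.rep_eq) 
qed

lemma W12_locD:
  assumes "(\<lambda>x. ereal (u x)) \<in> W12_loc v UNIV Q" and b: "\<And>k. bounded (u ` frontier (Q k))"
  shows "(\<lambda>k. (real_osc u k)\<^sup>2) summable_on disks_meeting Q (ball x r)"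
    and "upper_gradient v UNIV Q (real_osc u) (\<lambda>x. ereal (u x))"
proof -
  have o: "real_of_ereal (osc (\<lambda>x. ereal (u x)) (Q k)) = real_osc u k" for k using osc_real[OF b] by simp
  show "upper_gradient v UNIV Q (real_osc u) (\<lambda>x. ereal (u x))"
    using assms(1) unfolding W12_loc_def mem_Collect_eq o by blast
  show "(\<lambda>k. (real_osc u k)\<^sup>2) summable_on disks_meeting Q (ball x r)"
  proof (cases "r > 0")
    case True
    then show ?thesis using assms(1) ball_compactly_contained unfolding W12_loc_def mem_Collect_eq o by blast
  next
    case False
    then show ?thesis by (simp add: disks_meeting_def ball_empty)
  qed
qed

text \<open>The product rule behind this membership is inherited from \<open>upper_gradient_oscillationI\<close>: it suffices
  to exhibit some square summable upper gradient, not the oscillations themselves.\<close>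

lemma test_function_W12:
  assumes u: "(\<lambda>x. ereal (u x)) \<in> W12_loc v UNIV Q" and M: "\<And>x. x \<in> S \<Longrightarrow> \<bar>u x\<bar> \<le> M"
    and R: "R > 0" and \<phi>01: "\<And>x. 0 \<le> \<phi> x \<and> \<phi> x \<le> 1" and Lc: "Lc \<ge> 0"
    and lip: "\<And>x y. \<bar>\<phi> x - \<phi> y\<bar> \<le> Lc * dist x y" and out: "\<And>x. norm x \<ge> R \<Longrightarrow> \<phi> x = 0"
  shows "(\<lambda>x. ereal (- ((\<phi> x)\<^sup>2 * u x))) \<in> W12 v UNIV Q"
proof -
  define f where "f x = - ((\<phi> x)\<^sup>2 * u x)" for x
  have M0: "M \<ge> 0" using M frontier_subset[of 0] frontier_nonempty[of 0] by fastforce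
  have bu: "bounded (u ` frontier (Q k))" for k
    unfolding bounded_iff using M frontier_subset[of k] by (auto intro!: exI[of _ M])
  have sq1: "(\<phi> x)\<^sup>2 \<le> 1" for x using \<phi>01[of x] by (simp add: power_le_one)
  have fM: "\<bar>f x\<bar> \<le> M" if "x \<in> S" for x
  proof -
    have "\<bar>f x\<bar> = (\<phi> x)\<^sup>2 * \<bar>u x\<bar>" by (simp add: f_def abs_mult)
    also have "\<dots> \<le> 1 * M" using sq1[of x] M[OF that] M0 by (intro mult_mono) auto
    finally show ?thesis by simp
  qed
  have bf: "bounded (f ` frontier (Q k))" for k
    unfolding bounded_iff using fM frontier_subset[of k] by (auto intro!: exI[of _ M])
  have wlip: "\<bar>(\<phi> x)\<^sup>2 - (\<phi> y)\<^sup>2\<bar> \<le> 2 * Lc * dist x y" for x y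
  proof -
    have "\<bar>(\<phi> x)\<^sup>2 - (\<phi> y)\<^sup>2\<bar> = \<bar>\<phi> x - \<phi> y\<bar> * \<bar>\<phi> x + \<phi> y\<bar>"
      by (simp add: power2_eq_square algebra_simps flip: abs_mult)
    also have "\<dots> \<le> (Lc * dist x y) * 2" using lip \<phi>01[of x] \<phi>01[of y] Lc by (intro mult_mono) auto
    finally show ?thesis by simp
  qed
  \<comment> \<open>Product rule, with \<open>\<phi>^2 \<le> 1\<close>, the bound \<open>M\<close>
    for \<open>u\<close> and the Lipschitz constant \<open>2 * Lc\<close> of
    \<open>\<phi>^2\<close>.\<close>
  have fdiff: "\<bar>f x - f y\<bar> \<le> \<bar>u x - u y\<bar> + 2 * M * Lc * dist x y" if "x \<in> S" "y \<in> S" for x y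
  proof -
    have "f x - f y = - ((\<phi> x)\<^sup>2 * (u x - u y)) - u y * ((\<phi> x)\<^sup>2 - (\<phi> y)\<^sup>2)"
      by (simp add: f_def algebra_simps)
    then have "\<bar>f x - f y\<bar> \<le> (\<phi> x)\<^sup>2 * \<bar>u x - u y\<bar> + \<bar>u y\<bar> * \<bar>(\<phi> x)\<^sup>2 - (\<phi> y)\<^sup>2\<bar>"
      using abs_triangle_ineq4[of "- ((\<phi> x)\<^sup>2 * (u x - u y))" "u y * ((\<phi> x)\<^sup>2 - (\<phi> y)\<^sup>2)"] by (simp add: abs_mult)
    also have "\<dots> \<le> 1 * \<bar>u x - u y\<bar> + M * (2 * Lc * dist x y)"
      using sq1 M[OF that(2)] M0 wlip by (intro add_mono mult_mono) auto
    finally show ?thesis by simp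
  qed
  \<comment> \<open>The upper gradient read off from the product rule, with distances replaced by
    diameters. Its squares are summable over the disks that meet a ball, because fatness gives this
    for the diameters.\<close>
  define \<rho> where "\<rho> k = real_osc u k + 2 * M * Lc * diameter (Q k)" for k
  have \<rho>0: "\<rho> k \<ge> 0" for k
    unfolding \<rho>_def using real_osc_nonneg[OF bu, of k] M0 Lc diameter_pos[of k] by (simp add: less_imp_le)
  have fro: "real_osc f k \<le> \<rho> k" for k
  proof (rule real_osc_least)
    fix x y assume xy: "x \<in> frontier (Q k)" "y \<in> frontier (Q k)"
    have "dist x y \<le> diameter (Q k)" using xy frontier_subset_closure by (intro dist_le_diameter) auto
    then have "2 * M * Lc * dist x y \<le> 2 * M * Lc * diameter (Q k)" using M0 Lc by (intro mult_left_mono) auto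
    then show "\<bar>f x - f y\<bar> \<le> \<rho> k"
      using fdiff[of x y] real_osc_upper[OF bu xy] xy frontier_subset unfolding \<rho>_def by fastforce
  qed
  have sq: "(\<lambda>k. (\<rho> k)\<^sup>2) summable_on disks_meeting Q (ball x r)" for x r
  proof (rule summable_on_comparison_test)
    show "(\<lambda>k. 2 * (real_osc u k)\<^sup>2 + 2 * (2 * M * Lc)\<^sup>2 * (diameter (Q k))\<^sup>2) summable_on disks_meeting Q (ball x r)"
      by (intro summable_on_add summable_on_cmult_right W12_locD(1)[OF u bu] summable_diameter)
    show "(\<rho> k)\<^sup>2 \<le> 2 * (real_osc u k)\<^sup>2 + 2 * (2 * M * Lc)\<^sup>2 * (diameter (Q k))\<^sup>2" for k
    proof -
      have "(a + b)\<^sup>2 \<le> 2 * a\<^sup>2 + 2 * b\<^sup>2" for a b :: real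
        using zero_le_power2[of "a - b"] by (simp add: power2_eq_square algebra_simps)
      from this[of "real_osc u k" "2 * M * Lc * diameter (Q k)"] show ?thesis
        by (simp add: \<rho>_def power_mult_distrib mult.assoc)
    qed
  qed auto
  obtain \<Gamma>1 where G1: "\<Gamma>1 \<subseteq> paths_in UNIV" "carpet_modulus v UNIV Q \<Gamma>1 = 0"
    "\<And>\<gamma> s t. \<gamma> \<in> paths_in UNIV - \<Gamma>1 \<Longrightarrow> s \<in> fst \<gamma> \<Longrightarrow> t \<in> fst \<gamma> \<Longrightarrow> s \<le> t \<Longrightarrow> snd \<gamma> s \<in> S \<Longrightarrow> snd \<gamma> t \<in> S \<Longrightarrow>
       \<bar>ereal (u (snd \<gamma> s))\<bar> \<noteq> \<infinity> \<and> \<bar>ereal (u (snd \<gamma> t))\<bar> \<noteq> \<infinity> \<and>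
       \<bar>ereal (u (snd \<gamma> s)) - ereal (u (snd \<gamma> t))\<bar> \<le> enn2ereal (path_sum Q (real_osc u) ({s..t}, snd \<gamma>))"
    using upper_gradientD[OF W12_locD(2)[OF u bu]] by blast
  \<comment> \<open>Along paths with positive length in the carpet the diameters need not control
    distances. These paths have modulus zero because the carpet has zero area.\<close>
  define \<Gamma>2 where "\<Gamma>2 = {\<gamma>\<in>paths_in UNIV. \<exists>a\<in>fst \<gamma>. \<exists>b\<in>fst \<gamma>. a \<le> b \<and>
     hausdorff_measure 1 (snd \<gamma> ` {a..b} \<inter> S) \<noteq> 0}"
  have ug: "upper_gradient v UNIV Q (real_osc f) (\<lambda>x. ereal (f x))"
  proof (rule upper_gradient_oscillationI[where \<rho>=\<rho> and \<Gamma>="\<Gamma>1 \<union> \<Gamma>2"])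
    show "carpet_modulus v UNIV Q (\<Gamma>1 \<union> \<Gamma>2) = 0"
      using G1(1,2) carpet_modulus_non_hausdorff_null[OF S_closed S_null, of v]
      by (intro carpet_modulus_null_Un) (auto simp: \<Gamma>2_def paths_in_def)
    show "\<Gamma>1 \<union> \<Gamma>2 \<subseteq> paths_in UNIV" using G1(1) by (auto simp: \<Gamma>2_def)
    fix \<gamma> s t
    assume \<gamma>: "\<gamma> \<in> paths_in UNIV - (\<Gamma>1 \<union> \<Gamma>2)" and st: "s \<in> fst \<gamma>" "t \<in> fst \<gamma>" "s \<le> t" "snd \<gamma> s \<in> S" "snd \<gamma> t \<in> S"
    have cp: "is_cpath \<gamma>" using \<gamma> by (simp add: paths_in_def)
    have "ennreal \<bar>u (snd \<gamma> s) - u (snd \<gamma> t)\<bar> \<le> path_sum Q (real_osc u) ({s..t}, snd \<gamma>)"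
      using G1(3)[of \<gamma> s t] \<gamma> st by (simp add: ennreal_le_iff_ereal)
    moreover have "ennreal (dist (snd \<gamma> s) (snd \<gamma> t)) \<le> path_sum Q (\<lambda>k. diameter (Q k)) ({s..t}, snd \<gamma>)"
    proof (rule dist_le_path_sum_diameter[OF _ st(3)])
      show "continuous_on {s..t} (snd \<gamma>)" by (rule continuous_on_cpath[OF cp cpath_interval_subset[OF cp st(1,2)]])
      show "hausdorff_measure 1 (snd \<gamma> ` {s..t} \<inter> S) = 0" using \<gamma> st by (auto simp: \<Gamma>2_def)
    qed
    ultimately have "ennreal \<bar>u (snd \<gamma> s) - u (snd \<gamma> t)\<bar> + ennreal (2 * M * Lc) * ennreal (dist (snd \<gamma> s) (snd \<gamma> t)) \<le>
        path_sum Q (real_osc u) ({s..t}, snd \<gamma>) + ennreal (2 * M * Lc) * path_sum Q (\<lambda>k. diameter (Q k)) ({s..t}, snd \<gamma>)"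
      by (intro add_mono mult_left_mono) auto
    also have "\<dots> = path_sum Q \<rho> ({s..t}, snd \<gamma>)"
    proof -
      have "ennreal (\<rho> k) = ennreal (real_osc u k) + ennreal (2 * M * Lc) * ennreal (diameter (Q k))" for k
        unfolding \<rho>_def using real_osc_nonneg[OF bu, of k] M0 Lc diameter_pos[of k]
        by (subst ennreal_plus) (auto simp: ennreal_mult'[symmetric] less_imp_le)
      then show ?thesis unfolding path_sum_suminf
        by (simp add: distrib_right mult.assoc suminf_add[symmetric])
    qed
    finally have "ennreal (\<bar>u (snd \<gamma> s) - u (snd \<gamma> t)\<bar> + 2 * M * Lc * dist (snd \<gamma> s) (snd \<gamma> t)) \<le> path_sum Q \<rho> ({s..t}, snd \<gamma>)"
      using M0 Lc by (simp add: ennreal_mult'[symmetric] ennreal_plus)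
    then show "ennreal \<bar>f (snd \<gamma> s) - f (snd \<gamma> t)\<bar> \<le> path_sum Q \<rho> ({s..t}, snd \<gamma>)"
      using ennreal_leI[OF fdiff[OF st(4,5)]] order_trans by blast
  qed (use \<rho>0 sq real_osc_upper[OF bf] in auto)
  \<comment> \<open>The cutoff vanishes off \<open>ball 0 R\<close>, so only disks meeting this ball
    contribute and local summability becomes global.\<close>
  have fz: "f x = 0" if "x \<in> frontier (Q k)" "k \<notin> disks_meeting Q (ball 0 R)" for x k
    using frontier_disjoint_ball[OF that(2)] that(1) out[of x] by (force simp: f_def)
  have z: "Sup (f ` frontier (Q k)) = 0 \<and> real_osc f k = 0" if "k \<notin> disks_meeting Q (ball 0 R)" for k
  proof -
    have "f ` frontier (Q k) = {0}" using fz[OF _ that] frontier_nonempty[of k] by force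
    then show ?thesis by (simp add: real_osc_def)
  qed
  have SupM: "(Sup (f ` frontier (Q k)))\<^sup>2 \<le> M\<^sup>2" for k
  proof -
    have ne: "f ` frontier (Q k) \<noteq> {}" using frontier_nonempty by simp
    have "\<bar>Sup (f ` frontier (Q k))\<bar> \<le> M"
      by (rule cSup_abs_le[OF ne]) (use fM frontier_subset in auto)
    then show ?thesis using power_mono[of "\<bar>Sup (f ` frontier (Q k))\<bar>" M 2] by simp
  qed
  have s1: "(\<lambda>k. (Sup (f ` frontier (Q k)))\<^sup>2 * (diameter (Q k))\<^sup>2) summable_on UNIV"
  proof -
    have "(\<lambda>k. (Sup (f ` frontier (Q k)))\<^sup>2 * (diameter (Q k))\<^sup>2) summable_on disks_meeting Q (ball 0 R)"
    proof (rule summable_on_comparison_test)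
      show "(\<lambda>k. M\<^sup>2 * (diameter (Q k))\<^sup>2) summable_on disks_meeting Q (ball 0 R)"
        by (intro summable_on_cmult_right summable_diameter)
    qed (use SupM in \<open>auto intro: mult_right_mono\<close>)
    then show ?thesis by (rule summable_on_cong_neutral[THEN iffD1, rotated -1]) (use z in auto)
  qed
  have s2: "(\<lambda>k. (real_osc f k)\<^sup>2) summable_on UNIV"
  proof -
    have "(\<lambda>k. (real_osc f k)\<^sup>2) summable_on disks_meeting Q (ball 0 R)"
      by (rule summable_on_comparison_test[OF sq[of 0 R]])
         (use fro real_osc_nonneg[OF bf] in \<open>auto intro: power_mono\<close>)
    then show ?thesis by (rule summable_on_cong_neutral[THEN iffD1, rotated -1]) (use z in auto)
  qed
  have "(\<lambda>x. ereal (f x)) \<in> W12 v UNIV Q"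
    unfolding W12_def W12_loc_def
    using Mdisk_real[OF bf] mdisk_real[OF bf] osc_real[OF bf] ug s1 s2 summable_on_subset_banach[OF s1 subset_UNIV]
      summable_on_subset_banach[OF s2 subset_UNIV]
    by simp
  then show ?thesis by (simp add: f_def)
qed

text \<open>Minimality is tested against \<open>u * (1 - \<phi>^2)\<close>. With \<open>m\<close>
  the infimum of \<open>\<phi>\<close> on a circle, the squared oscillation of the competitor there
  is at most \<open>1 - m^2 / 2\<close> times that of \<open>u\<close>, plus an error of
  \<open>20 * M^2\<close> times that of \<open>\<phi>\<close>. The energies of \<open>u\<close>
  cancel, and on \<open>Q k0\<close>, where \<open>m = 1\<close>, the remaining gain bounds the
  oscillation of \<open>u\<close>.\<close>

lemma caccioppoli:
  assumes u: "carpet_harmonic v UNIV Q (\<lambda>x. ereal (u x))" and M: "\<And>x. x \<in> S \<Longrightarrow> \<bar>u x\<bar> \<le> M"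
    and R: "R > 0" and \<phi>01: "\<And>x. 0 \<le> \<phi> x \<and> \<phi> x \<le> 1" and Lc: "Lc \<ge> 0"
    and lip: "\<And>x y. \<bar>\<phi> x - \<phi> y\<bar> \<le> Lc * dist x y" and out: "\<And>x. norm x \<ge> R \<Longrightarrow> \<phi> x = 0"
    and E: "\<And>F. finite F \<Longrightarrow> (\<Sum>k\<in>F. (real_osc \<phi> k)\<^sup>2) \<le> E" and k0: "\<And>x. x \<in> frontier (Q k0) \<Longrightarrow> \<phi> x = 1"
  shows "(real_osc u k0)\<^sup>2 \<le> 40 * M\<^sup>2 * E"
proof -
  define g where "g x = u x * (1 - (\<phi> x)\<^sup>2)" for x
  have uW: "(\<lambda>x. ereal (u x)) \<in> W12_loc v UNIV Q" using u by (simp add: carpet_harmonic_def)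
  have M0: "M \<ge> 0" using M frontier_subset[of 0] frontier_nonempty[of 0] by fastforce
  have bu: "bounded (u ` frontier (Q k))" for k
    unfolding bounded_iff using M frontier_subset[of k] by (auto intro!: exI[of _ M])
  have b\<phi>: "bounded (\<phi> ` frontier (Q k))" for k
    unfolding bounded_iff using \<phi>01 by (auto intro!: exI[of _ 1])
  have sq1: "(\<phi> x)\<^sup>2 \<le> 1" for x using \<phi>01[of x] by (simp add: power_le_one)
  have disk_max: "\<bar>g x\<bar> \<le> M" if "x \<in> S" for x
  proof -
    have "\<bar>g x\<bar> = \<bar>u x\<bar> * (1 - (\<phi> x)\<^sup>2)" using sq1[of x] by (simp add: g_def abs_mult)
    also have "\<dots> \<le> M * 1" using sq1[of x] M[OF that] M0 by (intro mult_mono) auto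
    finally show ?thesis by simp
  qed
  have bg: "bounded (g ` frontier (Q k))" for k
    unfolding bounded_iff using disk_max frontier_subset[of k] by (auto intro!: exI[of _ M])
  let ?V = "ball (0::complex) R" let ?I = "disks_meeting Q (ball 0 R)"
  define \<zeta> where "\<zeta> x = ereal (- ((\<phi> x)\<^sup>2 * u x))" for x
  have \<zeta>: "\<zeta> \<in> W12 v UNIV Q"
    unfolding \<zeta>_def by (rule test_function_W12[OF uW M R \<phi>01 Lc lip out])
  have \<zeta>0: "\<zeta> x = 0" if "x \<in> S - ?V" for x using out[of x] that by (simp add: \<zeta>_def)
  have "dirichlet_energy Q ?V (\<lambda>x. ereal (u x)) \<le> dirichlet_energy Q ?V (\<lambda>x. ereal (u x) + \<zeta> x)"
    using u \<zeta> \<zeta>0 ball_compactly_contained unfolding carpet_harmonic_def by blast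
  also have "(\<lambda>x. ereal (u x) + \<zeta> x) = (\<lambda>x. ereal (g x))"
    by (auto simp: \<zeta>_def g_def algebra_simps)
  finally have en: "(\<Sum>\<^sub>\<infinity>k\<in>?I. ennreal ((real_osc u k)\<^sup>2)) \<le> (\<Sum>\<^sub>\<infinity>k\<in>?I. ennreal ((real_osc g k)\<^sup>2))"
    using energy_real[of ?V u, OF bu] energy_real[of ?V g, OF bg] by simp
  \<comment> \<open>With the infimum, \<open>1 - \<phi>^2 \<le> 1 - m^2\<close> is valid on the
    whole circle, while \<open>\<phi>\<close> exceeds \<open>m\<close> there by at most its
    oscillation.\<close>
  define m where "m k = Inf (\<phi> ` frontier (Q k))" for k
  have m: "0 \<le> m k" "x \<in> frontier (Q k) \<Longrightarrow> m k \<le> \<phi> x \<and> \<phi> x \<le> m k + real_osc \<phi> k" "m k + real_osc \<phi> k \<le> 1" for k x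
  proof -
    have ne: "\<phi> ` frontier (Q k) \<noteq> {}" using frontier_nonempty by simp
    show "0 \<le> m k" unfolding m_def using ne \<phi>01 by (intro cInf_greatest) auto
    have s: "m k + real_osc \<phi> k = Sup (\<phi> ` frontier (Q k))" by (simp add: m_def real_osc_def)
    show "m k + real_osc \<phi> k \<le> 1" unfolding s using ne \<phi>01 by (intro cSup_least) auto
    show "m k \<le> \<phi> x \<and> \<phi> x \<le> m k + real_osc \<phi> k" if "x \<in> frontier (Q k)"
      unfolding s unfolding m_def using that b\<phi>[of k]
      by (auto intro!: cInf_lower cSup_upper bounded_imp_bdd_above bounded_imp_bdd_below)
  qed
  have est: "(real_osc g k)\<^sup>2 \<le> (real_osc u k)\<^sup>2 - (m k)\<^sup>2 * (real_osc u k)\<^sup>2 / 2 + 20 * M\<^sup>2 * (real_osc \<phi> k)\<^sup>2" for k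
  proof -
    let ?o = "real_osc u k" and ?p = "real_osc \<phi> k" and ?m = "m k"
    have o0: "?o \<ge> 0" by (rule real_osc_nonneg[OF bu])
    have p0: "?p \<ge> 0" by (rule real_osc_nonneg[OF b\<phi>])
    have o2: "?o \<le> 2 * M"
    proof (rule real_osc_least)
      fix x y assume "x \<in> frontier (Q k)" "y \<in> frontier (Q k)"
      then have "\<bar>u x\<bar> \<le> M" "\<bar>u y\<bar> \<le> M" using M frontier_subset by blast+
      then show "\<bar>u x - u y\<bar> \<le> 2 * M" by linarith
    qed
    have m1: "0 \<le> ?m" "?m + ?p \<le> 1" using m by auto
    have msq: "?m\<^sup>2 \<le> 1" using m1 p0 by (simp add: power_le_one)
    have gle: "real_osc g k \<le> (1 - ?m\<^sup>2) * ?o + 2 * M * (?m + ?p) * ?p"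
    proof (rule real_osc_least)
      fix x y assume xy: "x \<in> frontier (Q k)" "y \<in> frontier (Q k)"
      have "g x - g y = (1 - (\<phi> x)\<^sup>2) * (u x - u y) + u y * ((\<phi> y)\<^sup>2 - (\<phi> x)\<^sup>2)"
        by (simp add: g_def algebra_simps)
      then have "\<bar>g x - g y\<bar> \<le> (1 - (\<phi> x)\<^sup>2) * \<bar>u x - u y\<bar> + \<bar>u y\<bar> * \<bar>(\<phi> y)\<^sup>2 - (\<phi> x)\<^sup>2\<bar>"
        using abs_triangle_ineq[of "(1 - (\<phi> x)\<^sup>2) * (u x - u y)" "u y * ((\<phi> y)\<^sup>2 - (\<phi> x)\<^sup>2)"] sq1[of x]
        by (simp add: abs_mult)
      also have "\<dots> \<le> (1 - ?m\<^sup>2) * ?o + M * (2 * (?m + ?p) * ?p)"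
      proof (intro add_mono mult_mono)
        show "1 - (\<phi> x)\<^sup>2 \<le> 1 - ?m\<^sup>2" using m(2)[OF xy(1)] m1(1) by (simp add: power_mono)
        show "\<bar>u x - u y\<bar> \<le> ?o" by (rule real_osc_upper[OF bu xy])
        show "\<bar>u y\<bar> \<le> M" using M xy frontier_subset by blast
        have "\<bar>(\<phi> y)\<^sup>2 - (\<phi> x)\<^sup>2\<bar> = \<bar>\<phi> y + \<phi> x\<bar> * \<bar>\<phi> y - \<phi> x\<bar>"
          by (simp add: power2_eq_square algebra_simps flip: abs_mult)
        also have "\<dots> \<le> (2 * (?m + ?p)) * ?p"
          using m(2)[OF xy(1)] m(2)[OF xy(2)] m1(1) p0 real_osc_upper[OF b\<phi> xy(2) xy(1)] by (intro mult_mono) auto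
        finally show "\<bar>(\<phi> y)\<^sup>2 - (\<phi> x)\<^sup>2\<bar> \<le> 2 * (?m + ?p) * ?p" .
      qed (use msq M0 in auto)
      finally show "\<bar>g x - g y\<bar> \<le> (1 - ?m\<^sup>2) * ?o + 2 * M * (?m + ?p) * ?p" by (simp add: ac_simps)
    qed
    define q where "q = (?m + ?p) * ?p"
    have q: "0 \<le> q" "q \<le> ?p" using m1 p0 by (auto simp: q_def mult_left_le_one_le)
    have "(real_osc g k)\<^sup>2 \<le> ((1 - ?m\<^sup>2) * ?o + 2 * M * q)\<^sup>2"
      using gle real_osc_nonneg[OF bg, of k] by (intro power_mono) (auto simp: q_def mult.assoc)
    also have "\<dots> = (1 - ?m\<^sup>2)\<^sup>2 * ?o\<^sup>2 + 4 * M * ((1 - ?m\<^sup>2) * (?o * q)) + 4 * M\<^sup>2 * q\<^sup>2"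
      by (simp add: power2_eq_square algebra_simps)
    also have "\<dots> \<le> (1 - ?m\<^sup>2) * ?o\<^sup>2 + 4 * M * (?o * q) + 4 * M\<^sup>2 * ?p\<^sup>2"
    proof (intro add_mono)
      have "(1 - ?m\<^sup>2)\<^sup>2 \<le> 1 - ?m\<^sup>2" using msq by (simp add: power2_eq_square[of "1 - ?m\<^sup>2"] mult_left_le_one_le)
      then show "(1 - ?m\<^sup>2)\<^sup>2 * ?o\<^sup>2 \<le> (1 - ?m\<^sup>2) * ?o\<^sup>2" by (intro mult_right_mono) auto
      have "(1 - ?m\<^sup>2) * (?o * q) \<le> ?o * q" using msq o0 q by (intro mult_left_le_one_le) auto
      then show "4 * M * ((1 - ?m\<^sup>2) * (?o * q)) \<le> 4 * M * (?o * q)" using M0 by (intro mult_left_mono) auto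
      show "4 * M\<^sup>2 * q\<^sup>2 \<le> 4 * M\<^sup>2 * ?p\<^sup>2" using q by (intro mult_left_mono power_mono) auto
    qed
    \<comment> \<open>In this mixed term the part with factor \<open>m\<close> is absorbed by half
      of the gain \<open>(?m * ?o)^2\<close> through Young's inequality; the other part is quadratic
      in \<open>?p\<close> once \<open>?o \<le> 2 * M\<close> is used. The errors
      \<open>8 + 8\<close> and the \<open>4\<close> of the last summand make 20.\<close>
    also have "4 * M * (?o * q) \<le> (?m * ?o)\<^sup>2 / 2 + 16 * M\<^sup>2 * ?p\<^sup>2"
    proof -
      have "4 * M * (?o * q) = 4 * (?m * ?o) * (M * ?p) + 4 * M * ?o * ?p\<^sup>2"
        by (simp add: q_def power2_eq_square algebra_simps)
      also have "4 * (?m * ?o) * (M * ?p) \<le> (?m * ?o)\<^sup>2 / 2 + 8 * (M * ?p)\<^sup>2"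
        using zero_le_power2[of "?m * ?o - 4 * (M * ?p)"] unfolding power2_diff by (simp add: power_mult_distrib)
      also have "4 * M * ?o * ?p\<^sup>2 \<le> 4 * M * (2 * M) * ?p\<^sup>2"
        using o2 M0 by (intro mult_right_mono mult_left_mono) auto
      finally show ?thesis by (simp add: power2_eq_square algebra_simps)
    qed
    finally show ?thesis by (simp add: power2_eq_square algebra_simps)
  qed
  have sA: "(\<lambda>k. (real_osc u k)\<^sup>2) summable_on ?I" by (rule W12_locD(1)[OF uW bu])
  have sd: "(\<lambda>k. 20 * M\<^sup>2 * (real_osc \<phi> k)\<^sup>2) summable_on ?I"
  proof (rule summable_on_cmult_right)
    show "(\<lambda>k. (real_osc \<phi> k)\<^sup>2) summable_on ?I"
      by (rule nonneg_bdd_above_summable_on) (use E in \<open>auto intro!: bdd_aboveI\<close>)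
  qed
  have sc: "(\<lambda>k. (m k)\<^sup>2 * (real_osc u k)\<^sup>2 / 2) summable_on ?I"
  proof (rule summable_on_comparison_test[OF sA])
    fix k
    have "0 \<le> m k" "m k \<le> 1" using m(1,3)[of k] real_osc_nonneg[OF b\<phi>, of k] by linarith+
    then have "(m k)\<^sup>2 * (real_osc u k)\<^sup>2 \<le> 1 * (real_osc u k)\<^sup>2" by (intro mult_right_mono power_le_one) auto
    then show "(m k)\<^sup>2 * (real_osc u k)\<^sup>2 / 2 \<le> (real_osc u k)\<^sup>2" using zero_le_power2[of "real_osc u k"] by linarith
  qed auto
  have sB: "(\<lambda>k. (real_osc g k)\<^sup>2) summable_on ?I"
  proof (rule summable_on_comparison_test[OF summable_on_add[OF sA sd]])
    show "(real_osc g k)\<^sup>2 \<le> (real_osc u k)\<^sup>2 + 20 * M\<^sup>2 * (real_osc \<phi> k)\<^sup>2" for k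
      using est[of k] zero_le_mult_iff[of "(m k)\<^sup>2" "(real_osc u k)\<^sup>2"] by (smt (verit) zero_le_power2 divide_nonneg_pos mult_nonneg_nonneg)
  qed auto
  let ?c = "\<lambda>k. (m k)\<^sup>2 * (real_osc u k)\<^sup>2 / 2" and ?d = "\<lambda>k. 20 * M\<^sup>2 * (real_osc \<phi> k)\<^sup>2"
  \<comment> \<open>All four sums converge, so the energy inequality can be read in the reals and
    the energy of \<open>u\<close> cancelled.\<close>
  have "infsum (\<lambda>k. (real_osc u k)\<^sup>2) ?I \<le> infsum (\<lambda>k. (real_osc g k)\<^sup>2) ?I"
    using en sA sB by (simp add: infsum_ennreal infsum_nonneg)
  moreover have "infsum (\<lambda>k. (real_osc g k)\<^sup>2) ?I + infsum ?c ?I = infsum (\<lambda>k. (real_osc g k)\<^sup>2 + ?c k) ?I"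
    by (rule infsum_add[OF sB sc, symmetric])
  moreover have "\<dots> \<le> infsum (\<lambda>k. (real_osc u k)\<^sup>2 + ?d k) ?I"
  proof (rule infsum_mono[OF summable_on_add[OF sB sc] summable_on_add[OF sA sd]])
    show "(real_osc g k)\<^sup>2 + ?c k \<le> (real_osc u k)\<^sup>2 + ?d k" for k using est[of k] by linarith
  qed
  moreover have "\<dots> = infsum (\<lambda>k. (real_osc u k)\<^sup>2) ?I + infsum ?d ?I"
    by (rule infsum_add[OF sA sd])
  ultimately have "infsum ?c ?I \<le> infsum ?d ?I" by linarith
  also have "\<dots> \<le> 20 * M\<^sup>2 * E"
  proof (rule infsum_le_finite_sums[OF sd])
    fix F :: "nat set" assume "finite F"
    then have "20 * M\<^sup>2 * (\<Sum>k\<in>F. (real_osc \<phi> k)\<^sup>2) \<le> 20 * M\<^sup>2 * E" using E by (intro mult_left_mono) auto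
    then show "(\<Sum>k\<in>F. 20 * M\<^sup>2 * (real_osc \<phi> k)\<^sup>2) \<le> 20 * M\<^sup>2 * E" by (simp add: sum_distrib_left)
  qed
  finally have le: "infsum (\<lambda>k. (m k)\<^sup>2 * (real_osc u k)\<^sup>2 / 2) ?I \<le> 20 * M\<^sup>2 * E" .
  have k0I: "k0 \<in> ?I"
  proof (rule ccontr)
    assume "k0 \<notin> ?I"
    then have disj: "frontier (Q k0) \<inter> ball 0 R = {}" by (rule frontier_disjoint_ball)
    obtain z where z: "z \<in> frontier (Q k0)" using frontier_nonempty by blast
    then have "norm z \<ge> R" using disj by (auto simp: disjoint_iff not_less)
    then show False using out k0[OF z] by simp
  qed
  have "m k0 = 1"
  proof -
    have "\<phi> ` frontier (Q k0) = {1}" using k0 frontier_nonempty[of k0] by force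
    then show ?thesis by (simp add: m_def)
  qed
  moreover have "(m k0)\<^sup>2 * (real_osc u k0)\<^sup>2 / 2 \<le> infsum (\<lambda>k. (m k)\<^sup>2 * (real_osc u k)\<^sup>2 / 2) ?I"
    using finite_sum_le_infsum[OF sc, of "{k0}"] k0I by simp
  ultimately show ?thesis using le by simp
qed

text \<open>The Caccioppoli inequality is applied to a cutoff that equals 1 on the given circle and
  has energy at most \<open>4 * fatness / N\<close>. The left side does not depend on the cutoff, so
  \<open>N\<close> can tend to infinity.\<close>

theorem harmonic_oscillation_zero:
  assumes u: "carpet_harmonic v UNIV Q (\<lambda>x. ereal (u x))" and M: "\<And>x. x \<in> S \<Longrightarrow> \<bar>u x\<bar> \<le> M"
  shows "real_osc u k = 0"
proof -
  obtain b where b: "\<And>x. x \<in> closure (Q k) \<Longrightarrow> norm x \<le> b"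
    using bounded_closure[OF Q_bounded[of k]] unfolding bounded_iff by blast
  define r0 where "r0 = max b 1"
  have r0: "r0 > 0" "\<And>x. x \<in> closure (Q k) \<Longrightarrow> norm x \<le> r0" using b by (auto simp: r0_def le_max_iff_disj)
  have le: "(real_osc u k)\<^sup>2 \<le> 160 * M\<^sup>2 * fatness / real N" if N: "N \<ge> 1" for N
  proof -
    obtain \<phi> :: "complex \<Rightarrow> real" and Lc R where \<phi>: "Lc \<ge> 0" "R > 0" "\<And>x. 0 \<le> \<phi> x \<and> \<phi> x \<le> 1"
      "\<And>x y. \<bar>\<phi> x - \<phi> y\<bar> \<le> Lc * dist x y" "\<And>x. norm x \<ge> R \<Longrightarrow> \<phi> x = 0" "\<And>x. norm x \<le> r0 \<Longrightarrow> \<phi> x = 1"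
      "\<And>F. finite F \<Longrightarrow> (\<Sum>k\<in>F. (real_osc \<phi> k)\<^sup>2) \<le> 4 * fatness / real N"
      using cutoff_exists[OF r0(1) N] by metis
    have "(real_osc u k)\<^sup>2 \<le> 40 * M\<^sup>2 * (4 * fatness / real N)"
    proof (rule caccioppoli[OF u M \<phi>(2,3,1,4,5,7)])
      show "\<phi> x = 1" if "x \<in> frontier (Q k)" for x
        using that r0(2) frontier_subset_closure[of k] by (intro \<phi>(6)) blast
    qed
    then show ?thesis by simp
  qed
  have "(\<lambda>N. 160 * M\<^sup>2 * fatness / real N) \<longlonglongrightarrow> 0"
    by (rule lim_const_over_n)
  then have "(real_osc u k)\<^sup>2 \<le> 0"
    by (rule LIMSEQ_le_const) (use le in blast)
  then show ?thesis by simp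
qed

end

section \<open>Paths along which the normalized version is a limit\<close>

lemma not_negligible_interval:
  assumes "(a::real) < b" "negligible N"
  obtains t where "a < t" "t < b" "t \<notin> N"
proof -
  have "\<not> {a<..<b} \<subseteq> N"
  proof
    assume "{a<..<b} \<subseteq> N"
    then have "negligible {a<..<b}" using assms(2) negligible_subset by blast
    moreover have "open {a<..<b}" "{a<..<b} \<noteq> {}" using assms(1) by auto
    ultimately show False using open_not_negligible by blast
  qed
  then obtain t where "t \<in> {a<..<b}" "t \<notin> N" by blast
  then show ?thesis using that[of t] by simp
qed

lemma first_exit:
  fixes \<phi> :: "real \<Rightarrow> real"
  assumes c: "continuous_on {a..b} \<phi>" and ab: "a \<le> b" "\<phi> a < r" "r \<le> \<phi> b"
  shows "\<exists>e\<in>{a..b}. \<phi> e = r \<and> (\<forall>t\<in>{a..e}. \<phi> t \<le> r)"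
proof -
  define Z where "Z = {t\<in>{a..b}. r \<le> \<phi> t}"
  have "closed Z" unfolding Z_def
    using continuous_closed_preimage[OF c, of "{r..}"] by (simp add: vimage_def Int_def)
  moreover have "b \<in> Z" using ab by (simp add: Z_def)
  moreover have bdd: "bdd_below Z" by (auto simp: Z_def bdd_below_def)
  ultimately have Z: "Inf Z \<in> Z" by (intro closed_contains_Inf) auto
  have before: "\<phi> t < r" if "t \<in> {a..<Inf Z}" for t
  proof (rule ccontr)
    assume "\<not> ?thesis"
    then have "t \<in> Z" using that Z by (auto simp: Z_def)
    then show False using that bdd cInf_lower[of t Z] by simp
  qed
  have I: "a \<le> Inf Z" "Inf Z \<le> b" "r \<le> \<phi> (Inf Z)" using Z by (auto simp: Z_def)
  have "continuous_on {a..Inf Z} \<phi>" by (rule continuous_on_subset[OF c]) (use I in auto)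
  then obtain t where t: "a \<le> t" "t \<le> Inf Z" "\<phi> t = r"
    using IVT'[of \<phi> a r "Inf Z"] ab I by auto
  then have "t = Inf Z" using before[of t] by force
  then have eq: "\<phi> (Inf Z) = r" using t by simp
  have "\<phi> t \<le> r" if "t \<in> {a..Inf Z}" for t
    using before[of t] eq that by (cases "t = Inf Z") (auto simp: less_imp_le)
  then show ?thesis using eq I by (intro bexI[of _ "Inf Z"]) auto
qed

lemma last_exit:
  fixes \<phi> :: "real \<Rightarrow> real"
  assumes c: "continuous_on {a..b} \<phi>" and ab: "a \<le> b" "\<phi> b < r" "r \<le> \<phi> a"
  shows "\<exists>e\<in>{a..b}. \<phi> e = r \<and> (\<forall>t\<in>{e..b}. \<phi> t \<le> r)"
proof -
  have "continuous_on {-b..-a} (\<lambda>t. \<phi> (- t))"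
    by (rule continuous_on_compose2[OF c]) (auto intro!: continuous_intros)
  then obtain e where e: "e \<in> {-b..-a}" "\<phi> (- e) = r" "\<forall>t\<in>{-b..e}. \<phi> (- t) \<le> r"
    using first_exit[of "-b" "-a" "\<lambda>t. \<phi> (- t)" r] ab by auto
  have "\<phi> t \<le> r" if "t \<in> {-e..b}" for t
    using e(3)[rule_format, of "- t"] that by auto
  then show ?thesis using e by (intro bexI[of _ "- e"]) auto
qed

lemma connected_trace: "is_cpath \<gamma> \<Longrightarrow> connected (trace \<gamma>)"
  unfolding trace_def
  by (intro connected_continuous_image continuous_on_cpath) (auto simp: is_cpath_def is_interval_connected)

text \<open>The length-area estimate leaves good parameters of positive measure, so any null set can
  be avoided in addition.\<close>

lemma (in planar_carpet) pick_segment: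
  assumes ab: "a < b" and R: "R > 0" and len: "\<beta> - \<alpha> \<le> 2 * R" "\<alpha> \<le> \<beta>" and \<rho>: "\<And>k. \<rho> k \<ge> 0" and \<eta>: "\<eta> \<ge> 0"
    and inside: "\<And>t s. t \<in> {\<alpha><..<\<beta>} \<Longrightarrow> s \<in> {a..b} \<Longrightarrow> pt d t s \<in> ball x R"
    and energy: "\<And>F. finite F \<Longrightarrow> F \<subseteq> disks_meeting Q (ball x R) \<Longrightarrow> (\<Sum>k\<in>F. (\<rho> k)\<^sup>2) \<le> \<eta>\<^sup>2"
    and \<epsilon>: "\<epsilon> > 0" and small: "sqrt fatness * R * \<eta> / \<epsilon> < \<beta> - \<alpha>" and N: "negligible N"
  shows "\<exists>t\<in>{\<alpha><..<\<beta>}. t \<notin> N \<and> path_sum Q \<rho> (seg d t a b) < ennreal \<epsilon>"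
proof -
  let ?X = "{t \<in> {\<alpha><..<\<beta>}. ennreal \<epsilon> \<le> path_sum Q \<rho> (seg d t a b)}"
  have X: "emeasure lborel ?X \<le> ennreal (sqrt fatness * R * \<eta> / \<epsilon>)"
    by (rule length_area[where x=x]; fact)
  have Xb: "?X \<in> sets borel" using borel_measurable_path_sum_seg[OF ab, of \<rho> d] by measurable
  obtain N' where N': "N \<subseteq> N'" "N' \<in> null_sets lborel" using null_set_of_negligible[OF N] by blast
  have "\<not> {\<alpha><..<\<beta>} \<subseteq> ?X \<union> N'"
  proof
    assume "{\<alpha><..<\<beta>} \<subseteq> ?X \<union> N'"
    then have "emeasure lborel {\<alpha><..<\<beta>} \<le> emeasure lborel (?X \<union> N')"
      using Xb N' by (intro emeasure_mono) auto
    also have "\<dots> = emeasure lborel ?X" using Xb N' by (intro emeasure_Un_null_set) auto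
    also note X
    finally have "ennreal (\<beta> - \<alpha>) \<le> ennreal (sqrt fatness * R * \<eta> / \<epsilon>)" using len(2) by simp
    moreover have "0 \<le> sqrt fatness * R * \<eta> / \<epsilon>"
      using fatness(1) R \<eta> \<epsilon> by (intro divide_nonneg_pos mult_nonneg_nonneg) auto
    ultimately have "\<beta> - \<alpha> \<le> sqrt fatness * R * \<eta> / \<epsilon>" by (simp only: ennreal_le_iff)
    then show False using small by linarith
  qed
  then obtain t where t: "t \<in> {\<alpha><..<\<beta>}" "t \<notin> ?X" "t \<notin> N'" by blast
  have "\<not> ennreal \<epsilon> \<le> path_sum Q \<rho> (seg d t a b)" using t(1,2) by blast
  then have "path_sum Q \<rho> (seg d t a b) < ennreal \<epsilon>" by (rule not_le_imp_less)
  moreover have "t \<notin> N" using t(3) N'(1) by blast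
  ultimately show ?thesis using t(1) by blast
qed

text \<open>Otherwise the segment would be the disjoint union of its countably many closed
  intersections with closures of disks. By Sierpinski's theorem only one of them is nonempty, the
  one for \<open>Q k\<close>, contrary to the point outside its closure.\<close>

lemma (in planar_carpet) seg_meets_carpet_interior:
  assumes ab: "a \<le> b" and k: "k \<in> disks_meeting Q (trace (seg d t a b))"
    and s: "s \<in> {a..b}" "pt d t s \<notin> closure (Q k)"
  shows "\<exists>y\<in>trace (seg d t a b). y \<in> carpet_interior UNIV Q"
proof (rule ccontr)
  assume none: "\<not> ?thesis"
  have all: "\<exists>j. pt d t r \<in> closure (Q j)" if "r \<in> {a..b}" for r
  proof -
    have "pt d t r \<in> trace (seg d t a b)" using that by (simp add: trace_seg)
    then show ?thesis using none unfolding carpet_interior_iff by blast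
  qed
  define U where "U j = {r\<in>{a..b}. pt d t r \<in> closure (Q j)}" for j
  have cl: "closed (U j)" for j
    unfolding U_def using continuous_closed_preimage[OF continuous_on_pt[of "{a..b}" d t], of "closure (Q j)"]
    by (simp add: vimage_def Int_def)
  have "range U - {{}} = {{a..b}}"
  proof (rule real_Sierpinski_lemma[OF ab])
    show "pairwise disjnt (range U - {{}})"
    proof (rule pairwiseI)
      fix A B assume "A \<in> range U - {{}}" "B \<in> range U - {{}}" "A \<noteq> B"
      then obtain i j where ij: "A = U i" "B = U j" "i \<noteq> j" by blast
      show "disjnt A B" using closure_disjoint[OF ij(3)] unfolding ij(1,2) disjnt_def U_def by blast
    qed
    show "\<Union> (range U - {{}}) = {a..b}"
    proof
      show "{a..b} \<subseteq> \<Union> (range U - {{}})"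
      proof
        fix r assume r: "r \<in> {a..b}"
        then obtain j where "r \<in> U j" using all[OF r] unfolding U_def by blast
        then show "r \<in> \<Union> (range U - {{}})" by blast
      qed
      show "\<Union> (range U - {{}}) \<subseteq> {a..b}" unfolding U_def by blast
    qed
    show "countable (range U - {{}})" by simp
    show "closed C \<and> C \<noteq> {}" if "C \<in> range U - {{}}" for C using cl that by blast
  qed
  moreover have "U k \<in> range U - {{}}"
  proof -
    obtain z where "z \<in> Q k" "z \<in> pt d t ` {a..b}" using k unfolding trace_seg by (rule disks_meetingE)
    then obtain r where "r \<in> {a..b}" "pt d t r \<in> closure (Q k)" using closure_subset by blast
    then have "r \<in> U k" unfolding U_def by blast
    then show ?thesis by blast
  qed
  ultimately have "U k \<in> {{a..b}}" by (rule subst)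
  then have "s \<in> U k" using s(1) by simp
  then show False using s(2) unfolding U_def by blast
qed

section \<open>Disk maxima of a Sobolev function along paths\<close>

locale sobolev_function = planar_carpet +
  fixes v :: modulus_version and g :: "complex \<Rightarrow> ereal"
  assumes g: "g \<in> W12_loc v UNIV Q"
begin

definition disk_max :: "nat \<Rightarrow> real" where "disk_max k = real_of_ereal (Mdisk g (Q k))"

definition disk_osc :: "nat \<Rightarrow> real" where "disk_osc k = real_of_ereal (osc g (Q k))"

lemma Mdisk_disk_max: "Mdisk g (Q k) = ereal (disk_max k)"
  using g by (auto simp: W12_loc_def disk_max_def ereal_real)

lemma disk_osc_upper_gradient: "upper_gradient v UNIV Q disk_osc g"
  using g unfolding W12_loc_def disk_osc_def by blast

lemma disk_osc_nonneg: "disk_osc k \<ge> 0"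
  using disk_osc_upper_gradient by (simp add: upper_gradient_def)

lemma disk_osc_summable: "(\<lambda>k. (disk_osc k)\<^sup>2) summable_on disks_meeting Q (ball x r)"
proof (cases "r > 0")
  case True
  then show ?thesis using g ball_compactly_contained unfolding W12_loc_def disk_osc_def by blast
next
  case False
  then show ?thesis by (simp add: disks_meeting_def ball_empty)
qed

lemma g_frontier:
  assumes "x \<in> frontier (Q k)"
  shows "\<bar>g x\<bar> \<noteq> \<infinity>" "\<bar>disk_max k - real_of_ereal (g x)\<bar> \<le> disk_osc k"
proof -
  have fin: "\<bar>Mdisk g (Q k)\<bar> \<noteq> \<infinity>" "\<bar>mdisk g (Q k)\<bar> \<noteq> \<infinity>" using g by (auto simp: W12_loc_def)
  have le: "mdisk g (Q k) \<le> g x" "g x \<le> Mdisk g (Q k)"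
    using assms by (auto simp: Mdisk_def mdisk_def intro: SUP_upper INF_lower)
  obtain M m where Mm: "Mdisk g (Q k) = ereal M" "mdisk g (Q k) = ereal m" using fin by (metis ereal_real')
  then obtain r where r: "g x = ereal r" using le by (cases "g x") auto
  then show "\<bar>g x\<bar> \<noteq> \<infinity>" by simp
  show "\<bar>disk_max k - real_of_ereal (g x)\<bar> \<le> disk_osc k"
    using le unfolding disk_max_def disk_osc_def osc_def Mm r by simp
qed

lemma path_sum_add_two:
  assumes "i \<noteq> j" "i \<in> disks_meeting Q (trace \<gamma>)" "j \<in> disks_meeting Q (trace \<gamma>)" "trace \<gamma>' \<subseteq> trace \<gamma>"
    "i \<notin> disks_meeting Q (trace \<gamma>')" "j \<notin> disks_meeting Q (trace \<gamma>')"
  shows "ennreal (disk_osc i) + path_sum Q disk_osc \<gamma>' + ennreal (disk_osc j) \<le> path_sum Q disk_osc \<gamma>"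
proof -
  have single: "ennreal (disk_osc l) = (\<Sum>k. ennreal (disk_osc k) * indicator {l} k)" for l
    by (subst suminf_finite[of "{l}"]) auto
  have "ennreal (disk_osc i) + path_sum Q disk_osc \<gamma>' + ennreal (disk_osc j) =
      (\<Sum>k. ennreal (disk_osc k) * indicator {i} k + ennreal (disk_osc k) * indicator (disks_meeting Q (trace \<gamma>')) k + ennreal (disk_osc k) * indicator {j} k)"
    unfolding path_sum_suminf single[of i] single[of j] by (simp add: suminf_add)
  also have "\<dots> \<le> path_sum Q disk_osc \<gamma>"
    unfolding path_sum_suminf
  proof (intro suminf_le allI)
    fix k
    show "ennreal (disk_osc k) * indicator {i} k + ennreal (disk_osc k) * indicator (disks_meeting Q (trace \<gamma>')) k + ennreal (disk_osc k) * indicator {j} k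
        \<le> ennreal (disk_osc k) * indicator (disks_meeting Q (trace \<gamma>)) k"
      using assms disks_meeting_mono[OF assms(4), of Q] by (auto split: split_indicator)
  qed auto
  finally show ?thesis .
qed

text \<open>The clauses of \<open>good_paths\<close> that involve \<open>g\<close>, in real form.
  Traces are bounded and hence compactly contained in the plane, so the two finiteness clauses there
  reduce to finiteness for the path itself.\<close>

definition coherent :: "cpath \<Rightarrow> bool" where
  "coherent \<gamma> \<longleftrightarrow> path_sum Q disk_osc \<gamma> < \<infinity> \<and> (\<forall>\<gamma>'. is_subpath \<gamma>' \<gamma> \<longrightarrow>
     (\<forall>i\<in>disks_meeting Q (trace \<gamma>'). \<forall>j\<in>disks_meeting Q (trace \<gamma>'). ennreal \<bar>disk_max i - disk_max j\<bar> \<le> path_sum Q disk_osc \<gamma>'))"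

lemma coherent_subpath: "coherent \<gamma> \<Longrightarrow> is_subpath \<gamma>' \<gamma> \<Longrightarrow> coherent \<gamma>'"
  unfolding coherent_def
  using is_subpath_trans path_sum_mono[OF trace_subpath, of \<gamma>' \<gamma> Q disk_osc disk_osc] by (meson le_less_trans order_refl)

text \<open>Take the first entry into \<open>Q j\<close> and the last exit from \<open>Q i\<close>
  before it. In between neither disk is met, so the oscillations of these two disks are still
  available in the path sum; they pay for passing from the boundary values of \<open>g\<close> at
  both ends to the maxima over the circles.\<close>

lemma coherent_almost_all:
  obtains \<Gamma> where "\<Gamma> \<subseteq> paths_in UNIV" "carpet_modulus v UNIV Q \<Gamma> = 0"
    "\<And>\<gamma>. \<gamma> \<in> paths_in UNIV - \<Gamma> \<Longrightarrow> coherent \<gamma>"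
proof -
  obtain \<Gamma>1 where G1: "\<Gamma>1 \<subseteq> paths_in UNIV" "carpet_modulus v UNIV Q \<Gamma>1 = 0"
    "\<And>\<gamma> s t. \<gamma> \<in> paths_in UNIV - \<Gamma>1 \<Longrightarrow> s \<in> fst \<gamma> \<Longrightarrow> t \<in> fst \<gamma> \<Longrightarrow> s \<le> t \<Longrightarrow> snd \<gamma> s \<in> S \<Longrightarrow> snd \<gamma> t \<in> S \<Longrightarrow>
       \<bar>g (snd \<gamma> s)\<bar> \<noteq> \<infinity> \<and> \<bar>g (snd \<gamma> t)\<bar> \<noteq> \<infinity> \<and>
       \<bar>g (snd \<gamma> s) - g (snd \<gamma> t)\<bar> \<le> enn2ereal (path_sum Q disk_osc ({s..t}, snd \<gamma>))"
    using upper_gradientD[OF disk_osc_upper_gradient] by blast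
  define \<Gamma>2 where "\<Gamma>2 = {\<gamma>\<in>paths_in UNIV. path_sum Q disk_osc \<gamma> = \<infinity>}"
  have "carpet_modulus v UNIV Q \<Gamma>2 = 0"
    unfolding \<Gamma>2_def by (intro carpet_modulus_path_sum_infinite disk_osc_nonneg disk_osc_summable Q_nonempty)
  then have "carpet_modulus v UNIV Q (\<Gamma>1 \<union> \<Gamma>2) = 0"
    using G1 by (intro carpet_modulus_null_Un) (auto simp: \<Gamma>2_def paths_in_def)
  moreover have "coherent \<gamma>" if \<gamma>: "\<gamma> \<in> paths_in UNIV - (\<Gamma>1 \<union> \<Gamma>2)" for \<gamma>
  proof -
    have cp: "is_cpath \<gamma>" using \<gamma> by (simp add: paths_in_def)
    have fin: "path_sum Q disk_osc \<gamma> < \<infinity>" using \<gamma> by (auto simp: \<Gamma>2_def less_top)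
    have *: "ennreal \<bar>disk_max i - disk_max j\<bar> \<le> path_sum Q disk_osc \<gamma>'"
      if sub: "is_subpath \<gamma>' \<gamma>" and st: "s \<in> fst \<gamma>'" "t \<in> fst \<gamma>'" "s \<le> t" "snd \<gamma> s \<in> Q i" "snd \<gamma> t \<in> Q j" and ij: "i \<noteq> j"
      for \<gamma>' s t i j
    proof -
      let ?h = "snd \<gamma>"
      have sn: "snd \<gamma>' = ?h" and f': "fst \<gamma>' \<subseteq> fst \<gamma>" using sub by (auto simp: is_subpath_def)
      have inc: "{s..t} \<subseteq> fst \<gamma>'" by (rule cpath_interval_subset[OF is_cpath_subpath[OF sub cp] st(1,2)])
      have hc: "continuous_on {s..t} ?h" using inc f' by (intro continuous_on_cpath[OF cp]) auto
      have "j \<in> met ?h s t" unfolding met_def disks_meeting_def using st by auto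
      moreover have "?h s \<notin> Q j" using st Q_disjoint[OF ij] by blast
      ultimately obtain \<tau> where \<tau>: "\<tau> \<in> {s..t}" "?h \<tau> \<in> frontier (Q j)" "j \<notin> met ?h s \<tau>"
        using first_hit[OF hc] by blast
      have "i \<in> met ?h s \<tau>" unfolding met_def disks_meeting_def using st \<tau> by auto
      moreover have "?h \<tau> \<notin> Q i" using \<tau>(2) frontier_subset notin_disk by blast
      moreover have "continuous_on {s..\<tau>} ?h" by (rule continuous_on_subset[OF hc]) (use \<tau> in auto)
      ultimately obtain \<sigma> where \<sigma>: "\<sigma> \<in> {s..\<tau>}" "?h \<sigma> \<in> frontier (Q i)" "i \<notin> met ?h \<sigma> \<tau>"
        using last_hit by blast
      have jn: "j \<notin> met ?h \<sigma> \<tau>" using \<tau>(3) met_mono[of s \<sigma> \<tau> \<tau> ?h] \<sigma>(1) by auto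
      have mem: "\<sigma> \<in> fst \<gamma>'" "\<tau> \<in> fst \<gamma>'" "\<sigma> \<le> \<tau>" using inc \<sigma>(1) \<tau>(1) by auto
      have "\<bar>g (?h \<sigma>) - g (?h \<tau>)\<bar> \<le> enn2ereal (path_sum Q disk_osc ({\<sigma>..\<tau>}, ?h))"
        using G1(3)[of \<gamma> \<sigma> \<tau>] \<gamma> mem f' \<sigma>(2) \<tau>(2) frontier_subset by blast
      moreover obtain a where a: "g (?h \<sigma>) = ereal a" "\<bar>disk_max i - a\<bar> \<le> disk_osc i"
        using g_frontier[OF \<sigma>(2)] by (metis ereal_real')
      moreover obtain b where b: "g (?h \<tau>) = ereal b" "\<bar>disk_max j - b\<bar> \<le> disk_osc j"
        using g_frontier[OF \<tau>(2)] by (metis ereal_real')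
      ultimately have ab: "ennreal \<bar>a - b\<bar> \<le> path_sum Q disk_osc ({\<sigma>..\<tau>}, ?h)"
        by (simp add: ennreal_le_iff_ereal)
      have "ennreal \<bar>disk_max i - disk_max j\<bar> \<le> ennreal (disk_osc i + \<bar>a - b\<bar> + disk_osc j)"
        using a(2) b(2) by (intro ennreal_leI) linarith
      also have "\<dots> = ennreal (disk_osc i) + ennreal \<bar>a - b\<bar> + ennreal (disk_osc j)"
        using disk_osc_nonneg by (simp add: ennreal_plus)
      also have "\<dots> \<le> ennreal (disk_osc i) + path_sum Q disk_osc ({\<sigma>..\<tau>}, ?h) + ennreal (disk_osc j)"
        using ab by (intro add_mono) auto
      also have "\<dots> \<le> path_sum Q disk_osc \<gamma>'"
      proof (rule path_sum_add_two[OF ij])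
        show "i \<in> disks_meeting Q (trace \<gamma>')" "j \<in> disks_meeting Q (trace \<gamma>')"
          using st by (auto simp: disks_meeting_def trace_def sn)
        have "{\<sigma>..\<tau>} \<subseteq> fst \<gamma>'" using inc \<sigma>(1) \<tau>(1) by auto
        then show "trace ({\<sigma>..\<tau>}, ?h) \<subseteq> trace \<gamma>'" by (auto simp: trace_def sn)
        show "i \<notin> disks_meeting Q (trace ({\<sigma>..\<tau>}, ?h))" "j \<notin> disks_meeting Q (trace ({\<sigma>..\<tau>}, ?h))"
          using \<sigma>(3) jn by (simp_all add: met_def trace_interval)
      qed
      finally show ?thesis .
    qed
    have "ennreal \<bar>disk_max i - disk_max j\<bar> \<le> path_sum Q disk_osc \<gamma>'"
      if sub: "is_subpath \<gamma>' \<gamma>" and ij: "i \<in> disks_meeting Q (trace \<gamma>')" "j \<in> disks_meeting Q (trace \<gamma>')" for \<gamma>' i j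
    proof (cases "i = j")
      case False
      have sn: "snd \<gamma>' = snd \<gamma>" using sub by (auto simp: is_subpath_def)
      obtain s where s: "s \<in> fst \<gamma>'" "snd \<gamma> s \<in> Q i" using ij(1) unfolding trace_def sn by (auto elim: disks_meetingE)
      obtain t where t: "t \<in> fst \<gamma>'" "snd \<gamma> t \<in> Q j" using ij(2) unfolding trace_def sn by (auto elim: disks_meetingE)
      show ?thesis
        using *[OF sub s(1) t(1) _ s(2) t(2) False] *[OF sub t(1) s(1) _ t(2) s(2)] False
        by (cases "s \<le> t") (auto simp: abs_minus_commute)
    qed simp
    then show ?thesis using fin by (simp add: coherent_def)
  qed
  moreover have "\<Gamma>1 \<union> \<Gamma>2 \<subseteq> paths_in UNIV" using G1(1) by (auto simp: \<Gamma>2_def)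
  ultimately show ?thesis using that by blast
qed

lemma seg_good_path:
  assumes "a < b" "coherent (seg d t a b)" "hausdorff_measure 1 (trace (seg d t a b) \<inter> S) = 0"
  shows "seg d t a b \<in> good_paths UNIV Q g"
  unfolding good_paths_def
proof (intro CollectI conjI allI impI ballI)
  let ?\<beta> = "seg d t a b"
  show "?\<beta> \<in> paths_in UNIV" using assms(1) by (intro seg_in_paths) simp
  show "\<not> snd ?\<beta> constant_on fst ?\<beta>"
  proof
    assume "snd ?\<beta> constant_on fst ?\<beta>"
    then have "pt d t a = pt d t b" using assms(1) by (auto simp: seg_def constant_on_def)
    then have "coord (\<not> d) (pt d t a) = coord (\<not> d) (pt d t b)" by simp
    then show False using assms(1) by simp
  qed
  show "hausdorff_measure 1 (trace ?\<beta> \<inter> S) = 0" by fact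
  fix \<gamma>'
  { fix i j assume "is_subpath \<gamma>' ?\<beta>" "i \<in> disks_meeting Q (trace \<gamma>')" "j \<in> disks_meeting Q (trace \<gamma>')"
    then have "ennreal \<bar>disk_max i - disk_max j\<bar> \<le> path_sum Q disk_osc \<gamma>'" using assms(2) unfolding coherent_def by blast
    then show "\<bar>Mdisk g (Q i) - Mdisk g (Q j)\<bar> \<le> enn2ereal (path_sum Q (\<lambda>i. real_of_ereal (osc g (Q i))) \<gamma>')"
      by (simp add: Mdisk_disk_max ennreal_le_iff_ereal disk_osc_def[abs_def]) }
  assume "is_subpath \<gamma>' ?\<beta> \<and> compactly_contained (trace \<gamma>') UNIV"
  then have "coherent \<gamma>'" using assms(2) coherent_subpath by blast
  then show "path_sum Q (\<lambda>i. real_of_ereal (osc g (Q i))) \<gamma>' < \<infinity>" by (simp add: coherent_def disk_osc_def[abs_def])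
next
  show "path_sum Q (\<lambda>i. real_of_ereal (osc g (Q i))) (seg d t a b) < \<infinity>"
    using assms(2) by (simp add: coherent_def disk_osc_def[abs_def])
qed

text \<open>A common weakening of the two kinds of access, by a point on the path and by an end of
  an open subpath. Besides coherence and zero length in the carpet, the limit arguments use only
  that the path comes arbitrarily close to \<open>x\<close> and contains another point.\<close>

definition approach :: "complex \<Rightarrow> cpath \<Rightarrow> bool" where
  "approach x \<gamma> \<longleftrightarrow> is_cpath \<gamma> \<and> coherent \<gamma> \<and> hausdorff_measure 1 (trace \<gamma> \<inter> S) = 0 \<and>
     x \<in> closure (trace \<gamma>) \<and> (\<exists>y\<in>trace \<gamma>. y \<noteq> x)"

lemma approach_if_accesses:
  assumes \<gamma>0: "\<gamma>0 \<in> good_paths UNIV Q g" and acc: "accesses UNIV Q \<gamma>0 \<gamma> x" 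
  shows "approach x \<gamma>"
proof -
  have sub: "is_subpath \<gamma> \<gamma>0" and cp0: "is_cpath \<gamma>0"
    using \<gamma>0 acc is_subpath_refl by (auto simp: accesses_def good_paths_def paths_in_def split: if_splits)
  have cp: "is_cpath \<gamma>" by (rule is_cpath_subpath[OF sub cp0])
  have cc: "compactly_contained A UNIV" if "bounded A" for A
    using that by (simp add: compactly_contained_def compact_eq_bounded_closed bounded_closure)
  have "path_sum Q disk_osc \<gamma> < \<infinity>"
    using \<gamma>0 sub cc[OF bounded_trace[OF cp]] unfolding good_paths_def disk_osc_def[abs_def] by blast
  moreover have "ennreal \<bar>disk_max i - disk_max j\<bar> \<le> path_sum Q disk_osc \<gamma>'"
    if "is_subpath \<gamma>' \<gamma>" "i \<in> disks_meeting Q (trace \<gamma>')" "j \<in> disks_meeting Q (trace \<gamma>')" for \<gamma>' i j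
  proof -
    have "\<bar>Mdisk g (Q i) - Mdisk g (Q j)\<bar> \<le> enn2ereal (path_sum Q (\<lambda>i. real_of_ereal (osc g (Q i))) \<gamma>')"
      using \<gamma>0 is_subpath_trans[OF that(1) sub] that(2,3) unfolding good_paths_def by blast
    then show ?thesis by (simp add: Mdisk_disk_max ennreal_le_iff_ereal disk_osc_def[abs_def])
  qed
  ultimately have "coherent \<gamma>" by (simp add: coherent_def)
  moreover have "hausdorff_measure 1 (trace \<gamma> \<inter> S) = 0"
  proof -
    have "trace \<gamma> \<inter> S \<subseteq> trace \<gamma>0 \<inter> S" using trace_subpath[OF sub] by blast
    from hausdorff_measure_mono[OF this, of 1] show ?thesis using \<gamma>0 by (simp add: good_paths_def)
  qed
  moreover have "x \<in> closure (trace \<gamma>) \<and> (\<exists>y\<in>trace \<gamma>. y \<noteq> x)"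
  proof (cases "x \<in> trace \<gamma>0 \<inter> carpet_interior UNIV Q")
    case True
    then have eq: "\<gamma> = \<gamma>0" using acc by (simp add: accesses_def)
    have "\<not> snd \<gamma>0 constant_on fst \<gamma>0" using \<gamma>0 by (simp add: good_paths_def)
    then have "\<exists>y\<in>trace \<gamma>0. y \<noteq> x" by (auto simp: constant_on_def trace_def)
    then show ?thesis using True eq closure_subset by auto
  next
    case False
    then have "x \<in> closure (trace \<gamma>) - trace \<gamma>" using acc unfolding accesses_def if_not_P[OF False] by blast
    moreover have "trace \<gamma> \<noteq> {}" using cp by (simp add: is_cpath_def trace_def)
    ultimately show ?thesis by auto
  qed
  ultimately show ?thesis using cp by (simp add: approach_def)
qed

text \<open>The distances from \<open>x\<close> to points of the connected trace contain an interval
  below \<open>r\<close>, and those attained on the carpet form a null set. At any other such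
  distance the path is inside a disk.\<close>

lemma approach_meets_disks:
  assumes ap: "approach x \<gamma>" and r: "r > 0"
  shows "\<exists>k z. z \<in> Q k \<and> z \<in> trace \<gamma> \<and> dist x z < r"
proof -
  have cp: "is_cpath \<gamma>" and null: "hausdorff_measure 1 (trace \<gamma> \<inter> S) = 0" using ap by (auto simp: approach_def)
  obtain y where y: "y \<in> trace \<gamma>" "y \<noteq> x" using ap by (auto simp: approach_def)
  define e where "e = min r (dist x y)"
  have e: "e > 0" using r y by (simp add: e_def)
  obtain z0 where z0: "z0 \<in> trace \<gamma>" "dist z0 x < e"
    using ap e unfolding approach_def closure_approachable by blast
  have "negligible (dist x ` (trace \<gamma> \<inter> S))"
    by (rule negligible_image_hausdorff_null[OF null]) (metis abs_dist_diff_le dist_commute)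
  then obtain t where t: "dist x z0 < t" "t < e" "t \<notin> dist x ` (trace \<gamma> \<inter> S)"
    using not_negligible_interval[of "dist x z0" e] z0 by (metis dist_commute)
  have "connected (dist x ` trace \<gamma>)"
    by (intro connected_continuous_image connected_trace[OF cp] continuous_intros)
  then have "t \<in> dist x ` trace \<gamma>"
    using connectedD_interval[of "dist x ` trace \<gamma>" "dist x z0" "dist x y" t] z0(1) y(1) t by (auto simp: e_def)
  then obtain z where z: "z \<in> trace \<gamma>" "dist x z = t" by auto
  then have "z \<notin> S" using t(3) by blast
  then obtain k where "z \<in> Q k" by (auto simp: carpet_eq)
  then show ?thesis using z t(2) by (auto simp: e_def)
qed

lemma eventually_disks_to:
  "eventually P (disks_to Q \<gamma> x) \<longleftrightarrow> (\<exists>r>0. \<forall>i\<in>disks_meeting Q (trace \<gamma>). Q i \<subseteq> ball x r \<longrightarrow> P i)"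
proof -
  have "eventually P (disks_to Q \<gamma> x) \<longleftrightarrow>
      (\<exists>r\<in>{0<..}. eventually P (principal {i \<in> disks_meeting Q (trace \<gamma>). Q i \<subseteq> ball x r}))"
    unfolding disks_to_def
  proof (rule eventually_INF_base)
    fix a b :: real assume "a \<in> {0<..}" "b \<in> {0<..}"
    then show "\<exists>c\<in>{0<..}. principal {i \<in> disks_meeting Q (trace \<gamma>). Q i \<subseteq> ball x c} \<le>
        inf (principal {i \<in> disks_meeting Q (trace \<gamma>). Q i \<subseteq> ball x a}) (principal {i \<in> disks_meeting Q (trace \<gamma>). Q i \<subseteq> ball x b})"
      by (intro bexI[of _ "min a b"]) auto
  qed auto
  then show ?thesis by (simp add: eventually_principal Bex_def Ball_def imp_conjL)
qed

text \<open>Near a point off all closed disks a disk that comes close is also small, so the disks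
  met close to \<open>x\<close> do lie in small balls, as \<open>disks_to\<close> demands.\<close>

lemma disks_to_nontrivial:
  assumes ap: "approach x \<gamma>" and x: "x \<in> carpet_interior UNIV Q"
  shows "disks_to Q \<gamma> x \<noteq> bot"
proof
  assume "disks_to Q \<gamma> x = bot"
  then have "eventually (\<lambda>_. False) (disks_to Q \<gamma> x)" by simp
  then obtain r where r: "r > 0" "\<forall>i\<in>disks_meeting Q (trace \<gamma>). \<not> Q i \<subseteq> ball x r"
    unfolding eventually_disks_to by auto
  obtain r' where r': "r' > 0" "\<And>k. Q k \<inter> ball x r' \<noteq> {} \<Longrightarrow> Q k \<subseteq> ball x r"
    using disks_near_small[OF x r(1)] by blast
  obtain k z where kz: "z \<in> Q k" "z \<in> trace \<gamma>" "dist x z < r'" using approach_meets_disks[OF ap r'(1)] by blast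
  then have "Q k \<inter> ball x r' \<noteq> {}" "k \<in> disks_meeting Q (trace \<gamma>)" by (auto simp: disks_meeting_def)
  then show False using r r' by blast
qed

lemma Liminf_disks_to:
  assumes ap: "approach x \<gamma>" and x: "x \<in> carpet_interior UNIV Q"
    and near: "\<And>\<epsilon>. \<epsilon> > 0 \<Longrightarrow> \<exists>r>0. \<forall>k\<in>disks_meeting Q (trace \<gamma>). Q k \<subseteq> ball x r \<longrightarrow> \<bar>disk_max k - c\<bar> \<le> \<epsilon>"
  shows "Liminf (disks_to Q \<gamma> x) (\<lambda>k. Mdisk g (Q k)) = ereal c"
proof -
  have "((\<lambda>k. disk_max k) \<longlongrightarrow> c) (disks_to Q \<gamma> x)"
  proof (rule tendstoI)
    fix e :: real assume "e > 0"
    then obtain r where "r > 0" "\<forall>k\<in>disks_meeting Q (trace \<gamma>). Q k \<subseteq> ball x r \<longrightarrow> \<bar>disk_max k - c\<bar> \<le> e/2"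
      using near[of "e/2"] by auto
    then show "\<forall>\<^sub>F k in disks_to Q \<gamma> x. dist (disk_max k) c < e"
      unfolding eventually_disks_to using \<open>e > 0\<close> by (intro exI[of _ r]) (auto simp: dist_real_def)
  qed
  then have "((\<lambda>k. Mdisk g (Q k)) \<longlongrightarrow> ereal c) (disks_to Q \<gamma> x)" by (simp add: Mdisk_disk_max)
  then show ?thesis by (rule lim_imp_Liminf[OF disks_to_nontrivial[OF ap x]])
qed

lemma disks_near_Liminf:
  assumes ap: "approach x \<gamma>" and x: "x \<in> carpet_interior UNIV Q" and \<epsilon>: "\<epsilon> > 0"
    and lim: "Liminf (disks_to Q \<gamma> x) (\<lambda>k. Mdisk g (Q k)) = ereal c" and \<delta>: "\<delta> > 0"
    and near: "\<And>k. k \<in> disks_meeting Q (trace \<gamma>) \<Longrightarrow> Q k \<subseteq> ball x \<delta> \<Longrightarrow> \<bar>disk_max k - m\<bar> \<le> \<epsilon>"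
  shows "\<bar>m - c\<bar> \<le> \<epsilon>"
proof -
  have ev: "\<forall>\<^sub>F k in disks_to Q \<gamma> x. ereal (m - \<epsilon>) \<le> Mdisk g (Q k)" "\<forall>\<^sub>F k in disks_to Q \<gamma> x. Mdisk g (Q k) \<le> ereal (m + \<epsilon>)"
    unfolding eventually_disks_to Mdisk_disk_max using near \<delta> by (auto intro!: exI[of _ \<delta>] simp: abs_le_iff algebra_simps)
  have "ereal (m - \<epsilon>) \<le> ereal c" using Liminf_bounded[OF ev(1)] lim by simp
  moreover have "Liminf (disks_to Q \<gamma> x) (\<lambda>k. Mdisk g (Q k)) \<le> Liminf (disks_to Q \<gamma> x) (\<lambda>k. ereal (m + \<epsilon>))"
    by (rule Liminf_mono[OF ev(2)])
  then have "ereal c \<le> ereal (m + \<epsilon>)"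
    unfolding lim Liminf_const[OF disks_to_nontrivial[OF ap x]] .
  ultimately show ?thesis by (simp add: abs_le_iff)
qed

end

section \<open>Independence of the path\<close>

lemma rectangle_crossing:
  assumes T: "connected T" and z0: "z0 \<in> T" "l1 < Re z0" "Re z0 < u1" "l2 < Im z0" "Im z0 < u2"
    and z1: "z1 \<in> T" "\<not> (l1 < Re z1 \<and> Re z1 < u1 \<and> l2 < Im z1 \<and> Im z1 < u2)"
  obtains d w where "w \<in> T" "if d then Re w = l1 \<or> Re w = u1 else Im w = l2 \<or> Im w = u2"
    "l1 \<le> Re w" "Re w \<le> u1" "l2 \<le> Im w" "Im w \<le> u2"
proof -
  let ?a = "Complex l1 l2" and ?b = "Complex u1 u2"
  have mem: "z \<in> box ?a ?b \<longleftrightarrow> l1 < Re z \<and> Re z < u1 \<and> l2 < Im z \<and> Im z < u2"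
    "z \<in> cbox ?a ?b \<longleftrightarrow> l1 \<le> Re z \<and> Re z \<le> u1 \<and> l2 \<le> Im z \<and> Im z \<le> u2" for z
    by (auto simp: box_def cbox_def Basis_complex_def)
  have "z0 \<in> box ?a ?b" using z0 by (simp add: mem)
  moreover have "z1 \<notin> box ?a ?b" using z1 by (simp add: mem)
  ultimately have "T \<inter> frontier (box ?a ?b) \<noteq> {}"
    using z0(1) z1(1) by (intro connected_Int_frontier[OF T]) auto
  moreover have "frontier (box ?a ?b) = cbox ?a ?b - box ?a ?b"
  proof -
    have "box ?a ?b \<noteq> {}" using \<open>z0 \<in> box ?a ?b\<close> by blast
    then show ?thesis unfolding frontier_box by (rule if_not_P)
  qed
  ultimately obtain w where w: "w \<in> T" "w \<in> cbox ?a ?b" "w \<notin> box ?a ?b" by blast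
  then have "l1 \<le> Re w" "Re w \<le> u1" "l2 \<le> Im w" "Im w \<le> u2" by (auto simp: mem)
  moreover have "(Re w = l1 \<or> Re w = u1) \<or> (Im w = l2 \<or> Im w = u2)"
    using w(3) calculation by (auto simp: mem)
  ultimately show ?thesis using that[of w True] that[of w False] w(1) by auto
qed

context sobolev_function
begin

text \<open>The path is followed from \<open>z\<close>, in the direction of a point \<open>y\<close>
  other than \<open>x\<close>, until its sup-norm distance from \<open>x\<close> reaches
  \<open>r1\<close>. This arc stays near \<open>x\<close>, where only little of the convergent path
  sum is left.\<close>

lemma short_arc:
  assumes ap: "approach x \<gamma>" and x: "x \<in> carpet_interior UNIV Q" and \<epsilon>: "\<epsilon> > 0"
  shows "\<exists>r0>0. \<forall>r1. 0 < r1 \<and> r1 \<le> r0 \<longrightarrow> (\<forall>z\<in>trace \<gamma>. dist x z < r1 \<longrightarrow>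
    (\<exists>\<gamma>' z1. is_subpath \<gamma>' \<gamma> \<and> path_sum Q disk_osc \<gamma>' \<le> ennreal \<epsilon> \<and> z \<in> trace \<gamma>' \<and> z1 \<in> trace \<gamma>' \<and>
       \<not> (\<bar>Re z1 - Re x\<bar> < r1 \<and> \<bar>Im z1 - Im x\<bar> < r1)))"
proof -
  have cp: "is_cpath \<gamma>" and fin: "path_sum Q disk_osc \<gamma> < \<infinity>" using ap by (auto simp: approach_def coherent_def)
  obtain y where y: "y \<in> trace \<gamma>" "y \<noteq> x" using ap by (auto simp: approach_def)
  define f where "f k = disk_osc k * indicator (disks_meeting Q (trace \<gamma>)) k" for k
  have f0: "f k \<ge> 0" for k using disk_osc_nonneg by (simp add: f_def)
  have "f summable_on disks_meeting Q (ball x 1)"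
  proof (rule summable_on_if_infsum_ennreal_finite)
    have "(\<Sum>\<^sub>\<infinity>k\<in>disks_meeting Q (ball x 1). ennreal (f k)) \<le> path_sum Q disk_osc \<gamma>"
      unfolding infsum_ennreal_eq_suminf path_sum_suminf
      by (intro suminf_le) (auto simp: f_def split: split_indicator)
    then show "(\<Sum>\<^sub>\<infinity>k\<in>disks_meeting Q (ball x 1). ennreal (f k)) < \<infinity>" using fin by (simp add: le_less_trans)
  qed (use f0 in auto)
  then obtain r2 where r2: "r2 > 0" "\<And>F. finite F \<Longrightarrow> F \<subseteq> disks_meeting Q (ball x r2) \<Longrightarrow> sum f F \<le> \<epsilon>"
    using small_energy_near[OF x, of f 1 \<epsilon>] f0 \<epsilon> by auto
  \<comment> \<open>The sup-norm distance from \<open>x\<close>, suited to axis-parallel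
    rectangles.\<close>
  define \<sigma> where "\<sigma> z = max \<bar>Re z - Re x\<bar> \<bar>Im z - Im x\<bar>" for z
  have \<sigma>d: "\<sigma> z \<le> dist x z" "dist x z \<le> 2 * \<sigma> z" for z
    using abs_Re_le_cmod[of "z - x"] abs_Im_le_cmod[of "z - x"] cmod_le[of "z - x"]
    by (auto simp: \<sigma>_def dist_norm norm_minus_commute max_def)
  have "\<sigma> y > 0" using y(2) by (auto simp: \<sigma>_def complex_eq_iff less_max_iff_disj)
  \<comment> \<open>The bound \<open>\<sigma> y\<close> guarantees an exit on the way to
    \<open>y\<close>; the divisor 3 gives \<open>2 * r1 < r2\<close>, so the arc stays in the
    Euclidean ball of radius \<open>r2\<close>.\<close>
  define r0 where "r0 = min (\<sigma> y) (r2 / 3)"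
  show ?thesis
  proof (intro exI[of _ r0] conjI allI impI ballI)
    show "r0 > 0" using \<open>\<sigma> y > 0\<close> r2 by (simp add: r0_def)
    fix r1 z assume r1: "0 < r1 \<and> r1 \<le> r0" and z: "z \<in> trace \<gamma>" "dist x z < r1"
    obtain t0 t1 where t: "t0 \<in> fst \<gamma>" "z = snd \<gamma> t0" "t1 \<in> fst \<gamma>" "y = snd \<gamma> t1"
      using z(1) y(1) by (auto simp: trace_def)
    let ?\<phi> = "\<lambda>t. \<sigma> (snd \<gamma> t)"
    have \<phi>: "?\<phi> t0 < r1" "r1 \<le> ?\<phi> t1" using \<sigma>d(1)[of z] z(2) r1 t by (auto simp: r0_def)
    have hc: "continuous_on A ?\<phi>" if "A \<subseteq> fst \<gamma>" for A
      unfolding \<sigma>_def using continuous_on_cpath[OF cp that] by (intro continuous_intros)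
    have "\<exists>a b e. a \<in> fst \<gamma> \<and> b \<in> fst \<gamma> \<and> a \<le> b \<and> t0 \<in> {a..b} \<and> e \<in> {a..b} \<and> ?\<phi> e = r1 \<and> (\<forall>t\<in>{a..b}. ?\<phi> t \<le> r1)"
    proof (cases "t0 \<le> t1")
      case True
      have inc: "{t0..t1} \<subseteq> fst \<gamma>" by (rule cpath_interval_subset[OF cp t(1,3)])
      obtain e where e: "e \<in> {t0..t1}" "?\<phi> e = r1" "\<forall>t\<in>{t0..e}. ?\<phi> t \<le> r1"
        using first_exit[OF hc[OF inc] True \<phi>] by blast
      then show ?thesis using t(1) inc by (intro exI[of _ t0] exI[of _ e]) auto
    next
      case False
      then have le: "t1 \<le> t0" by simp
      have inc: "{t1..t0} \<subseteq> fst \<gamma>" by (rule cpath_interval_subset[OF cp t(3,1)])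
      obtain e where e: "e \<in> {t1..t0}" "?\<phi> e = r1" "\<forall>t\<in>{e..t0}. ?\<phi> t \<le> r1"
        using last_exit[OF hc[OF inc] le \<phi>] by blast
      then show ?thesis using t(1) inc by (intro exI[of _ e] exI[of _ t0]) auto
    qed
    then obtain a b e where abe: "a \<in> fst \<gamma>" "b \<in> fst \<gamma>" "a \<le> b" "t0 \<in> {a..b}" "e \<in> {a..b}" "?\<phi> e = r1"
      "\<forall>t\<in>{a..b}. ?\<phi> t \<le> r1" by blast
    define \<gamma>' where "\<gamma>' = ({a..b}, snd \<gamma>)"
    have sub: "is_subpath \<gamma>' \<gamma>" unfolding \<gamma>'_def by (rule is_subpath_interval[OF cp abe(1-3)])
    have near: "trace \<gamma>' \<subseteq> ball x r2"
    proof
      fix w assume "w \<in> trace \<gamma>'"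
      then have "\<sigma> w \<le> r1" using abe(7) by (auto simp: \<gamma>'_def trace_def)
      then have "dist x w \<le> 2 * r1" using \<sigma>d(2)[of w] by simp
      also have "\<dots> < r2" using r1 r2(1) by (auto simp: r0_def)
      finally show "w \<in> ball x r2" by simp
    qed
    have "path_sum Q disk_osc \<gamma>' \<le> ennreal \<epsilon>"
      unfolding path_sum_suminf suminf_eq_SUP
    proof (rule SUP_least)
      fix n :: nat
      define F where "F = {k\<in>{..<n}. k \<in> disks_meeting Q (trace \<gamma>')}"
      have "(\<Sum>k<n. ennreal (disk_osc k) * indicator (disks_meeting Q (trace \<gamma>')) k) = (\<Sum>k\<in>F. ennreal (disk_osc k) * indicator (disks_meeting Q (trace \<gamma>')) k)"
        by (intro sum.mono_neutral_right) (auto simp: F_def)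
      also have "\<dots> = (\<Sum>k\<in>F. ennreal (f k))"
        using disks_meeting_mono[OF trace_subpath[OF sub], of Q] by (intro sum.cong) (auto simp: F_def f_def)
      also have "\<dots> = ennreal (sum f F)" using f0 by (intro sum_ennreal) auto
      also have "\<dots> \<le> ennreal \<epsilon>"
        using disks_meeting_mono[OF near, of Q] by (intro ennreal_leI r2(2)) (auto simp: F_def)
      finally show "(\<Sum>k<n. ennreal (disk_osc k) * indicator (disks_meeting Q (trace \<gamma>')) k) \<le> ennreal \<epsilon>" .
    qed
    moreover have "z \<in> trace \<gamma>'" using abe t by (auto simp: \<gamma>'_def trace_def)
    moreover have "snd \<gamma> e \<in> trace \<gamma>'" using abe(5) by (auto simp: \<gamma>'_def trace_def)
    moreover have "\<not> (\<bar>Re (snd \<gamma> e) - Re x\<bar> < r1 \<and> \<bar>Im (snd \<gamma> e) - Im x\<bar> < r1)"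
      using abe(6) by (auto simp: \<sigma>_def max_def split: if_splits)
    ultimately show "\<exists>\<gamma>' z1. is_subpath \<gamma>' \<gamma> \<and> path_sum Q disk_osc \<gamma>' \<le> ennreal \<epsilon> \<and> z \<in> trace \<gamma>' \<and> z1 \<in> trace \<gamma>' \<and>
       \<not> (\<bar>Re z1 - Re x\<bar> < r1 \<and> \<bar>Im z1 - Im x\<bar> < r1)" using sub by blast
  qed
qed

definition generic_seg :: "real \<Rightarrow> cpath \<Rightarrow> bool" where
  "generic_seg \<epsilon> \<beta> \<longleftrightarrow> coherent \<beta> \<and> hausdorff_measure 1 (trace \<beta> \<inter> S) = 0 \<and> path_sum Q disk_osc \<beta> < ennreal \<epsilon>"

lemma generic_seg_diff:
  assumes "generic_seg \<epsilon> \<beta>" "is_cpath \<beta>" "i \<in> disks_meeting Q (trace \<beta>)" "j \<in> disks_meeting Q (trace \<beta>)" "\<epsilon> > 0"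
  shows "\<bar>disk_max i - disk_max j\<bar> \<le> \<epsilon>"
proof -
  have "ennreal \<bar>disk_max i - disk_max j\<bar> \<le> path_sum Q disk_osc \<beta>"
    using assms is_subpath_refl unfolding generic_seg_def coherent_def by blast
  also have "\<dots> \<le> ennreal \<epsilon>" using assms(1) by (simp add: generic_seg_def less_imp_le)
  finally show ?thesis using assms by simp
qed

lemma negligible_not_generic:
  "\<exists>\<Gamma>. carpet_modulus v UNIV Q \<Gamma> = 0 \<and>
    (\<forall>a b d. a < b \<longrightarrow> negligible {t. seg d t a b \<in> \<Gamma> \<or> hausdorff_measure 1 (trace (seg d t a b) \<inter> S) \<noteq> 0}) \<and>
    (\<forall>a b d t. a < b \<longrightarrow> seg d t a b \<notin> \<Gamma> \<longrightarrow> coherent (seg d t a b))"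
proof -
  obtain \<Gamma> where G: "\<Gamma> \<subseteq> paths_in UNIV" "carpet_modulus v UNIV Q \<Gamma> = 0" "\<And>\<gamma>. \<gamma> \<in> paths_in UNIV - \<Gamma> \<Longrightarrow> coherent \<gamma>"
    using coherent_almost_all by blast
  have "negligible {t. seg d t a b \<in> \<Gamma> \<or> hausdorff_measure 1 (trace (seg d t a b) \<inter> S) \<noteq> 0}" if "a < b" for a b d
    using negligible_Un[OF negligible_seg_null[OF G(2) that, of d] negligible_seg_hausdorff[of d a b]]
    by (simp add: Collect_disj_eq)
  moreover have "coherent (seg d t a b)" if "a < b" "seg d t a b \<notin> \<Gamma>" for a b d t
    using G(3) seg_in_paths[of a b d t] that by simp
  ultimately show ?thesis using G(2) by blast
qed

text \<open>A side of length \<open>2 * r1\<close> is sought in a window of width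
  \<open>r1 / 2\<close>. The null set \<open>N\<close> will contain the coordinates at which a
  crossing or a corner would lie in the carpet.\<close>

lemma side_exists:
  assumes x: "x \<in> carpet_interior UNIV Q" and \<epsilon>: "\<epsilon> > 0"
  shows "\<exists>r0>0. \<forall>r1 d \<alpha> N. 0 < r1 \<and> r1 \<le> r0 \<and> coord d x - r1 \<le> \<alpha> \<and> \<alpha> + r1 / 2 \<le> coord d x + r1 \<and> negligible (N :: real set) \<longrightarrow>
    (\<exists>t. \<alpha> < t \<and> t < \<alpha> + r1 / 2 \<and> t \<notin> N \<and> generic_seg \<epsilon> (seg d t (coord (\<not> d) x - r1) (coord (\<not> d) x + r1)))"
proof -
  obtain \<Gamma> where G: "\<forall>a b d. a < b \<longrightarrow> negligible {t. seg d t a b \<in> \<Gamma> \<or> hausdorff_measure 1 (trace (seg d t a b) \<inter> S) \<noteq> 0}"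
    "\<forall>a b d t. a < b \<longrightarrow> seg d t a b \<notin> \<Gamma> \<longrightarrow> coherent (seg d t a b)"
    using negligible_not_generic by (elim exE conjE)
  \<comment> \<open>In the ball of radius \<open>2 * r1\<close>, which contains all candidate sides,
    the length-area bound becomes \<open>r1 / 4\<close>, half of the window.\<close>
  define \<eta> where "\<eta> = \<epsilon> / (8 * sqrt fatness)"
  have \<eta>: "\<eta> > 0" using \<epsilon> fatness(1) by (simp add: \<eta>_def)
  then have "\<eta>\<^sup>2 > 0" by simp
  then have "\<exists>r>0. r \<le> 1 \<and> (\<forall>F. finite F \<longrightarrow> F \<subseteq> disks_meeting Q (ball x r) \<longrightarrow> (\<Sum>k\<in>F. (disk_osc k)\<^sup>2) \<le> \<eta>\<^sup>2)"
    by (intro small_energy_near[OF x disk_osc_summable]) simp_all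
  then obtain r where r: "r > 0" "\<And>F. finite F \<Longrightarrow> F \<subseteq> disks_meeting Q (ball x r) \<Longrightarrow> (\<Sum>k\<in>F. (disk_osc k)\<^sup>2) \<le> \<eta>\<^sup>2"
    by blast
  show ?thesis
  proof (rule exI[of _ "r/2"], intro conjI allI impI)
    show "r/2 > 0" using r by simp
    fix r1 d \<alpha> and N :: "real set"
    assume A: "0 < r1 \<and> r1 \<le> r/2 \<and> coord d x - r1 \<le> \<alpha> \<and> \<alpha> + r1 / 2 \<le> coord d x + r1 \<and> negligible N"
    let ?a = "coord (\<not> d) x - r1" and ?b = "coord (\<not> d) x + r1"
    have ab: "?a < ?b" using A by simp
    let ?B = "{t. seg d t ?a ?b \<in> \<Gamma> \<or> hausdorff_measure 1 (trace (seg d t ?a ?b) \<inter> S) \<noteq> 0}"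
    have neg: "negligible (N \<union> ?B)" using A G(1)[rule_format, OF ab, of d] by (blast intro: negligible_Un)
    have inside: "pt d t s \<in> ball x (2 * r1)" if "t \<in> {\<alpha><..<\<alpha> + r1/2}" "s \<in> {?a..?b}" for t s
    proof -
      have "\<bar>coord d x - t\<bar> < r1" "\<bar>coord (\<not> d) x - s\<bar> \<le> r1" using that A by auto
      then show ?thesis using dist_le_coords[of x "pt d t s" d] by simp
    qed
    have energy: "(\<Sum>k\<in>F. (disk_osc k)\<^sup>2) \<le> \<eta>\<^sup>2" if F: "finite F" "F \<subseteq> disks_meeting Q (ball x (2 * r1))" for F
    proof (rule r(2)[OF F(1)])
      have "ball x (2 * r1) \<subseteq> ball x r" using A by (intro subset_ball) simp
      then show "F \<subseteq> disks_meeting Q (ball x r)" using F(2) disks_meeting_mono by blast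
    qed
    have eq: "sqrt fatness * (2 * r1) * \<eta> / \<epsilon> = r1 / 4" using \<epsilon> fatness(1) by (simp add: \<eta>_def)
    have small: "sqrt fatness * (2 * r1) * \<eta> / \<epsilon> < \<alpha> + r1/2 - \<alpha>" unfolding eq using A by simp
    have R: "0 < 2 * r1" "\<alpha> + r1/2 - \<alpha> \<le> 2 * (2 * r1)" "\<alpha> \<le> \<alpha> + r1/2" "0 \<le> \<eta>" using A \<eta> by linarith+
    have "\<exists>t\<in>{\<alpha><..<\<alpha> + r1/2}. t \<notin> N \<union> ?B \<and> path_sum Q disk_osc (seg d t ?a ?b) < ennreal \<epsilon>"
      by (rule pick_segment[where x=x and d=d and R="2 * r1" and \<rho>=disk_osc and \<eta>=\<eta>]; (fact | rule disk_osc_nonneg))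
    then obtain t where t: "t \<in> {\<alpha><..<\<alpha> + r1/2}" "t \<notin> N \<union> ?B" "path_sum Q disk_osc (seg d t ?a ?b) < ennreal \<epsilon>"
      by blast
    have "generic_seg \<epsilon> (seg d t ?a ?b)"
      using t(2,3) G(2)[rule_format, OF ab] unfolding generic_seg_def by blast
    moreover have "\<alpha> < t" "t < \<alpha> + r1 / 2" "t \<notin> N" using t(1,2) by auto
    ultimately show "\<exists>t. \<alpha> < t \<and> t < \<alpha> + r1 / 2 \<and> t \<notin> N \<and> generic_seg \<epsilon> (seg d t ?a ?b)"
      by blast
  qed
qed

lemma negligible_coord:
  assumes "hausdorff_measure 1 (A \<inter> S) = 0" shows "negligible (coord d ` (A \<inter> S))"
  by (rule negligible_image_hausdorff_null[OF assms]) (rule coord_le_dist)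

text \<open>Both paths cross every small rectangle around \<open>x\<close>. For almost every rectangle the crossings and
  the corners lie in disks, and along its sides the maxima over the disks hardly vary.\<close>

lemma approaches_comparable:
  assumes ap: "approach x \<gamma>1" "approach x \<gamma>2" and x: "x \<in> carpet_interior UNIV Q" and \<epsilon>: "\<epsilon> > 0"
  shows "\<exists>\<delta>>0. \<exists>m. \<forall>k z. z \<in> Q k \<longrightarrow> z \<in> trace \<gamma>1 \<union> trace \<gamma>2 \<longrightarrow> dist x z < \<delta> \<longrightarrow> \<bar>disk_max k - m\<bar> \<le> 3 * \<epsilon>"
proof -
  obtain ra where ra: "ra > 0" "\<And>r1 z. 0 < r1 \<Longrightarrow> r1 \<le> ra \<Longrightarrow> z \<in> trace \<gamma>1 \<Longrightarrow> dist x z < r1 \<Longrightarrow>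
    \<exists>\<gamma>' z1. is_subpath \<gamma>' \<gamma>1 \<and> path_sum Q disk_osc \<gamma>' \<le> ennreal \<epsilon> \<and> z \<in> trace \<gamma>' \<and> z1 \<in> trace \<gamma>' \<and>
       \<not> (\<bar>Re z1 - Re x\<bar> < r1 \<and> \<bar>Im z1 - Im x\<bar> < r1)"
    using short_arc[OF ap(1) x \<epsilon>] by blast
  obtain rb where rb: "rb > 0" "\<And>r1 z. 0 < r1 \<Longrightarrow> r1 \<le> rb \<Longrightarrow> z \<in> trace \<gamma>2 \<Longrightarrow> dist x z < r1 \<Longrightarrow>
    \<exists>\<gamma>' z1. is_subpath \<gamma>' \<gamma>2 \<and> path_sum Q disk_osc \<gamma>' \<le> ennreal \<epsilon> \<and> z \<in> trace \<gamma>' \<and> z1 \<in> trace \<gamma>' \<and>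
       \<not> (\<bar>Re z1 - Re x\<bar> < r1 \<and> \<bar>Im z1 - Im x\<bar> < r1)"
    using short_arc[OF ap(2) x \<epsilon>] by blast
  obtain rc where rc: "rc > 0" "\<And>r1 d \<alpha> N. 0 < r1 \<and> r1 \<le> rc \<and> coord d x - r1 \<le> \<alpha> \<and> \<alpha> + r1 / 2 \<le> coord d x + r1 \<and> negligible N \<Longrightarrow>
    (\<exists>t. \<alpha> < t \<and> t < \<alpha> + r1 / 2 \<and> t \<notin> N \<and> generic_seg \<epsilon> (seg d t (coord (\<not> d) x - r1) (coord (\<not> d) x + r1)))"
    using side_exists[OF x \<epsilon>] by blast
  define r1 where "r1 = min ra (min rb rc)"
  have r1: "0 < r1" "r1 \<le> ra" "r1 \<le> rb" "r1 \<le> rc" using ra rb rc by (auto simp: r1_def)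
  have null: "hausdorff_measure 1 (trace \<gamma>1 \<inter> S) = 0" "hausdorff_measure 1 (trace \<gamma>2 \<inter> S) = 0"
    using ap by (auto simp: approach_def)
  \<comment> \<open>Coordinates at which one of the two paths is in the carpet: lines off this null
    set meet the paths only inside disks.\<close>
  define N where "N d = coord d ` (trace \<gamma>1 \<inter> S) \<union> coord d ` (trace \<gamma>2 \<inter> S)" for d
  have N: "negligible (N d)" for d unfolding N_def by (intro negligible_Un negligible_coord null)
  let ?V = "\<lambda>t. seg True t (Im x - r1) (Im x + r1)" and ?H = "\<lambda>s. seg False s (Re x - r1) (Re x + r1)"
  have c: "coord True z = Re z" "coord False z = Im z" for z by (auto simp: coord_def)
  obtain tl where tl: "Re x - r1 < tl" "tl < Re x - r1/2" "tl \<notin> N True" "generic_seg \<epsilon> (?V tl)"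
    using rc(2)[of r1 True "Re x - r1" "N True"] r1 N by (auto simp: c)
  obtain tr where tr: "Re x + r1/2 < tr" "tr < Re x + r1" "tr \<notin> N True" "generic_seg \<epsilon> (?V tr)"
    using rc(2)[of r1 True "Re x + r1/2" "N True"] r1 N by (auto simp: c)
  \<comment> \<open>The horizontal sides are chosen after the vertical ones, at heights where the
    latter are not in the carpet. This puts the corners inside disks.\<close>
  define N' where "N' = N False \<union> (coord False ` (trace (?V tl) \<inter> S) \<union> coord False ` (trace (?V tr) \<inter> S))"
  have N': "negligible N'"
    unfolding N'_def using tl(4) tr(4) by (intro negligible_Un N negligible_coord) (auto simp: generic_seg_def)
  obtain sb where sb: "Im x - r1 < sb" "sb < Im x - r1/2" "sb \<notin> N'" "generic_seg \<epsilon> (?H sb)"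
    using rc(2)[of r1 False "Im x - r1" N'] r1 N' by (auto simp: c)
  obtain st where st: "Im x + r1/2 < st" "st < Im x + r1" "st \<notin> N'" "generic_seg \<epsilon> (?H st)"
    using rc(2)[of r1 False "Im x + r1/2" N'] r1 N' by (auto simp: c)
  have cpV: "is_cpath (?V t)" "is_cpath (?H t)" for t using r1 by (auto intro!: is_cpath_seg)
  have memV: "z \<in> trace (?V t) \<longleftrightarrow> Re z = t \<and> Im x - r1 \<le> Im z \<and> Im z \<le> Im x + r1" for z t
    by (auto simp: trace_seg pt_def complex_eq_iff)
  have memH: "z \<in> trace (?H s) \<longleftrightarrow> Im z = s \<and> Re x - r1 \<le> Re z \<and> Re z \<le> Re x + r1" for z s
    by (auto simp: trace_seg pt_def complex_eq_iff)
  have corner: "\<exists>k. k \<in> disks_meeting Q (trace (?V t)) \<and> k \<in> disks_meeting Q (trace (?H s))"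
    if "t = tl \<or> t = tr" "s = sb \<or> s = st" for t s
  proof -
    let ?p = "Complex t s"
    have V: "?p \<in> trace (?V t)" "?p \<in> trace (?H s)"
      unfolding memV memH using that tl tr sb st r1 by auto
    have "s \<notin> coord False ` (trace (?V t) \<inter> S)" using that sb(3) st(3) unfolding N'_def by blast
    then have "?p \<notin> S" using V(1) by (force simp: c)
    then obtain k where "?p \<in> Q k" by (auto simp: carpet_eq)
    then show ?thesis using V by (auto simp: disks_meeting_def)
  qed
  obtain k0 where k0: "k0 \<in> disks_meeting Q (trace (?V tl))" "k0 \<in> disks_meeting Q (trace (?H sb))"
    using corner[of tl sb] by blast
  obtain k1 where k1: "k1 \<in> disks_meeting Q (trace (?V tr))" "k1 \<in> disks_meeting Q (trace (?H sb))"
    using corner[of tr sb] by blast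
  obtain k2 where k2: "k2 \<in> disks_meeting Q (trace (?V tl))" "k2 \<in> disks_meeting Q (trace (?H st))"
    using corner[of tl st] by blast
  \<comment> \<open>The disk maxima vary by at most \<open>\<epsilon>\<close> along a side, and
    \<open>k0\<close> sits at the lower left corner. The right and the top side therefore cost two
    steps, through \<open>k1\<close> or \<open>k2\<close>.\<close>
  have sideV: "\<bar>disk_max i - disk_max k0\<bar> \<le> 2 * \<epsilon>" if "i \<in> disks_meeting Q (trace (?V t))" "t = tl \<or> t = tr" for i t
    using that(2)
  proof
    assume "t = tl"
    then have "\<bar>disk_max i - disk_max k0\<bar> \<le> \<epsilon>" using that(1) by (intro generic_seg_diff[OF tl(4) cpV(1) _ k0(1) \<epsilon>]) simp
    then show ?thesis using \<epsilon> by linarith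
  next
    assume "t = tr"
    then have "\<bar>disk_max i - disk_max k1\<bar> \<le> \<epsilon>" using that(1) by (intro generic_seg_diff[OF tr(4) cpV(1) _ k1(1) \<epsilon>]) simp
    then show ?thesis using generic_seg_diff[OF sb(4) cpV(2) k1(2) k0(2) \<epsilon>] by linarith
  qed
  have sideH: "\<bar>disk_max i - disk_max k0\<bar> \<le> 2 * \<epsilon>" if "i \<in> disks_meeting Q (trace (?H s))" "s = sb \<or> s = st" for i s
    using that(2)
  proof
    assume "s = sb"
    then have "\<bar>disk_max i - disk_max k0\<bar> \<le> \<epsilon>" using that(1) by (intro generic_seg_diff[OF sb(4) cpV(2) _ k0(2) \<epsilon>]) simp
    then show ?thesis using \<epsilon> by linarith
  next
    assume "s = st"
    then have "\<bar>disk_max i - disk_max k2\<bar> \<le> \<epsilon>" using that(1) by (intro generic_seg_diff[OF st(4) cpV(2) _ k2(2) \<epsilon>]) simp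
    then show ?thesis using generic_seg_diff[OF tl(4) cpV(1) k2(1) k0(1) \<epsilon>] by linarith
  qed
  have main: "\<bar>disk_max k - disk_max k0\<bar> \<le> 3 * \<epsilon>"
    if \<gamma>: "\<gamma> = \<gamma>1 \<or> \<gamma> = \<gamma>2" and z: "z \<in> Q k" "z \<in> trace \<gamma>" "dist x z < r1/2" for k z \<gamma>
  proof -
    have apg: "approach x \<gamma>" using \<gamma> ap by auto
    have zr: "dist x z < r1" using z(3) r1(1) by simp
    obtain \<gamma>' z1 where g': "is_subpath \<gamma>' \<gamma>" "path_sum Q disk_osc \<gamma>' \<le> ennreal \<epsilon>" "z \<in> trace \<gamma>'" "z1 \<in> trace \<gamma>'"
       "\<not> (\<bar>Re z1 - Re x\<bar> < r1 \<and> \<bar>Im z1 - Im x\<bar> < r1)"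
      using \<gamma> ra(2)[OF r1(1,2) _ zr] rb(2)[OF r1(1,3) _ zr] z(2) by blast
    have con: "connected (trace \<gamma>')"
      using apg g'(1) is_cpath_subpath by (intro connected_trace) (auto simp: approach_def)
    \<comment> \<open>The sides run at distances between \<open>r1 / 2\<close> and \<open>r1\<close>
      from \<open>x\<close>, so \<open>z\<close> is inside the rectangle, while the far end
      \<open>z1\<close> of the arc is not.\<close>
    have "\<bar>Re z - Re x\<bar> < r1/2" "\<bar>Im z - Im x\<bar> < r1/2"
      using z(3) coord_le_dist[of True z x] coord_le_dist[of False z x] by (auto simp: c dist_commute)
    then have zin: "tl < Re z" "Re z < tr" "sb < Im z" "Im z < st"
      using tl(1,2) tr(1,2) sb(1,2) st(1,2) by linarith+
    have z1out: "\<not> (tl < Re z1 \<and> Re z1 < tr \<and> sb < Im z1 \<and> Im z1 < st)"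
    proof
      assume "tl < Re z1 \<and> Re z1 < tr \<and> sb < Im z1 \<and> Im z1 < st"
      then have "\<bar>Re z1 - Re x\<bar> < r1" "\<bar>Im z1 - Im x\<bar> < r1"
        using tl(1) tr(2) sb(1) st(2) by linarith+
      then show False using g'(5) by blast
    qed
    obtain d w where w: "w \<in> trace \<gamma>'" "if d then Re w = tl \<or> Re w = tr else Im w = sb \<or> Im w = st"
      "tl \<le> Re w" "Re w \<le> tr" "sb \<le> Im w" "Im w \<le> st"
      using rectangle_crossing[OF con g'(3) zin g'(4) z1out] by blast
    have wg: "w \<in> trace \<gamma>" using w(1) trace_subpath[OF g'(1)] by blast
    have "w \<notin> S"
    proof
      assume "w \<in> S"
      then have "coord True w \<in> N True" "coord False w \<in> N False" using wg \<gamma> unfolding N_def by blast+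
      then show False using w(2) tl(3) tr(3) sb(3) st(3) by (auto simp: c N'_def split: if_splits)
    qed
    then obtain j where j: "w \<in> Q j" by (auto simp: carpet_eq)
    have "\<bar>disk_max j - disk_max k0\<bar> \<le> 2 * \<epsilon>"
    proof (cases d)
      case True
      then have "w \<in> trace (?V (Re w))" "Re w = tl \<or> Re w = tr" using w sb st by (auto simp: memV)
      then show ?thesis using j by (intro sideV[of j "Re w"]) (auto simp: disks_meeting_def)
    next
      case False
      then have "w \<in> trace (?H (Im w))" "Im w = sb \<or> Im w = st" using w tl tr by (auto simp: memH)
      then show ?thesis using j by (intro sideH[of j "Im w"]) (auto simp: disks_meeting_def)
    qed
    moreover have "\<bar>disk_max k - disk_max j\<bar> \<le> \<epsilon>"
    proof -
      have "k \<in> disks_meeting Q (trace \<gamma>')" "j \<in> disks_meeting Q (trace \<gamma>')"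
        using z(1) g'(3) w(1) j by (auto simp: disks_meeting_def)
      then have "ennreal \<bar>disk_max k - disk_max j\<bar> \<le> path_sum Q disk_osc \<gamma>'"
        using apg g'(1) unfolding approach_def coherent_def by blast
      also note g'(2)
      finally show ?thesis using \<epsilon> by simp
    qed
    ultimately show ?thesis by linarith
  qed
  have "\<forall>k z. z \<in> Q k \<longrightarrow> z \<in> trace \<gamma>1 \<union> trace \<gamma>2 \<longrightarrow> dist x z < r1/2 \<longrightarrow> \<bar>disk_max k - disk_max k0\<bar> \<le> 3 * \<epsilon>"
    using main by blast
  moreover have "r1/2 > 0" using r1(1) by simp
  ultimately show ?thesis by blast
qed

text \<open>Near \<open>x\<close> the maxima over the disks on both paths are within
  \<open>\<epsilon>/2\<close> of one number \<open>m\<close>, and so is the liminf \<open>c\<close>.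
  A single disk on \<open>\<gamma>2\<close> with maximum near \<open>c\<close> suffices, since disk
  maxima on a segment of small path sum hardly differ.\<close>

lemma approach_limit_unique:
  assumes ap: "approach x \<gamma>1" "approach x \<gamma>2" and x: "x \<in> carpet_interior UNIV Q" and \<epsilon>: "\<epsilon> > 0"
    and lim: "Liminf (disks_to Q \<gamma>1 x) (\<lambda>k. Mdisk g (Q k)) = ereal c"
  shows "\<exists>l\<in>disks_meeting Q (trace \<gamma>2). \<bar>disk_max l - c\<bar> \<le> \<epsilon>"
proof -
  have e6: "\<epsilon>/6 > 0" using \<epsilon> by simp
  obtain \<delta> m where \<delta>: "\<delta> > 0" "\<And>k z. z \<in> Q k \<Longrightarrow> z \<in> trace \<gamma>1 \<union> trace \<gamma>2 \<Longrightarrow> dist x z < \<delta> \<Longrightarrow> \<bar>disk_max k - m\<bar> \<le> 3 * (\<epsilon>/6)"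
    using approaches_comparable[OF ap x e6] by blast
  have "\<bar>m - c\<bar> \<le> 3 * (\<epsilon>/6)"
  proof (rule disks_near_Liminf[OF ap(1) x _ lim \<delta>(1)])
    fix k assume k: "k \<in> disks_meeting Q (trace \<gamma>1)" "Q k \<subseteq> ball x \<delta>"
    obtain z where z: "z \<in> Q k" "z \<in> trace \<gamma>1" using k(1) by (rule disks_meetingE)
    then show "\<bar>disk_max k - m\<bar> \<le> 3 * (\<epsilon>/6)" using \<delta>(2)[of z k] k(2) by auto
  qed (use \<epsilon> in simp)
  moreover obtain l z where l: "z \<in> Q l" "z \<in> trace \<gamma>2" "dist x z < \<delta>"
    using approach_meets_disks[OF ap(2) \<delta>(1)] by blast
  then have "\<bar>disk_max l - m\<bar> \<le> 3 * (\<epsilon>/6)" using \<delta>(2) by blast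
  moreover have "l \<in> disks_meeting Q (trace \<gamma>2)" using l by (auto simp: disks_meeting_def)
  moreover have "\<bar>disk_max l - c\<bar> \<le> \<bar>disk_max l - m\<bar> + \<bar>m - c\<bar>" by linarith
  ultimately have "l \<in> disks_meeting Q (trace \<gamma>2)" "\<bar>disk_max l - c\<bar> \<le> \<epsilon>" by linarith+
  then show ?thesis by blast
qed

end

section \<open>The constant value\<close>

text \<open>Off a family of modulus zero \<open>u\<close> is constant on the carpet points of a
  path. A generic vertical segment through \<open>Q i\<close> and a generic horizontal one through
  \<open>Q j\<close> cross in a large square; if they cross inside a disk, the values agree by way
  of its circle.\<close>

lemma (in planar_carpet) constant_on_frontiers:
  assumes ug: "upper_gradient v UNIV Q (\<lambda>_. 0) (\<lambda>x. ereal (u x))"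
    and osc0: "\<And>k x y. x \<in> frontier (Q k) \<Longrightarrow> y \<in> frontier (Q k) \<Longrightarrow> u x = u y"
  shows "\<exists>c \<Gamma>. carpet_modulus v UNIV Q \<Gamma> = 0 \<and> (\<forall>k. \<forall>x\<in>frontier (Q k). u x = c) \<and>
    (\<forall>\<gamma>\<in>paths_in UNIV - \<Gamma>. \<forall>x\<in>trace \<gamma> \<inter> S. \<forall>y\<in>trace \<gamma> \<inter> S. u x = u y)"
proof -
  obtain \<Gamma> where G: "carpet_modulus v UNIV Q \<Gamma> = 0"
    "\<And>\<gamma> x y. \<gamma> \<in> paths_in UNIV - \<Gamma> \<Longrightarrow> x \<in> trace \<gamma> \<inter> S \<Longrightarrow> y \<in> trace \<gamma> \<inter> S \<Longrightarrow>
      \<bar>ereal (u x) - ereal (u y)\<bar> \<le> enn2ereal (path_sum Q (\<lambda>_. 0) \<gamma>)"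
    using ug unfolding upper_gradient_def by blast
  have eq: "u x = u y" if "\<gamma> \<in> paths_in UNIV - \<Gamma>" "x \<in> trace \<gamma> \<inter> S" "y \<in> trace \<gamma> \<inter> S" for \<gamma> x y
    using G(2)[OF that] by (simp add: path_sum_suminf zero_ennreal.rep_eq)
  have same: "u x = u y" if x: "x \<in> frontier (Q i)" and y: "y \<in> frontier (Q j)" for i j x y
  proof -
    have "bounded (Q i \<union> Q j)" using Q_bounded by simp
    then obtain L where L: "L > 0" "\<And>z. z \<in> Q i \<union> Q j \<Longrightarrow> norm z < L"
      by (metis bounded_pos_less)
    \<comment> \<open>The segment passes through a point of \<open>Q k\<close> and ends at a point
      of norm at least \<open>L\<close>, which is outside \<open>Q k\<close>; so it meets the
      circle.\<close>
    have hit: "\<exists>t. \<bar>t\<bar> < L \<and> seg d t (-L) L \<notin> \<Gamma> \<and> trace (seg d t (-L) L) \<inter> frontier (Q k) \<noteq> {}"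
      if k: "k = i \<or> k = j" for d k
    proof -
      obtain z where z: "z \<in> Q k" using Q_nonempty by blast
      obtain \<rho> where \<rho>: "\<rho> > 0" "ball z \<rho> \<subseteq> Q k" using Q_open z openE by blast
      have "negligible {t. seg d t (-L) L \<in> \<Gamma>}" using L(1) by (intro negligible_seg_null[OF G(1)]) simp
      then obtain t where t: "coord d z - \<rho> < t" "t < coord d z + \<rho>" "t \<notin> {t. seg d t (-L) L \<in> \<Gamma>}"
        using not_negligible_interval[of "coord d z - \<rho>" "coord d z + \<rho>"] \<rho>(1) by auto
      let ?p = "pt d t (coord (\<not> d) z)"
      have "dist z ?p < \<rho>" using dist_le_coords[of z ?p d] t by simp
      then have p: "?p \<in> Q k" using \<rho> by auto
      then have "norm ?p < L" using L(2) k by blast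
      then have tL: "\<bar>t\<bar> < L" "\<bar>coord (\<not> d) z\<bar> < L"
        using coord_le_dist[of d ?p 0] coord_le_dist[of "\<not> d" ?p 0] by (auto simp: dist_norm)
      have "?p \<in> trace (seg d t (-L) L)" unfolding trace_seg by (rule imageI) (use tL in auto)
      moreover have "pt d t L \<in> trace (seg d t (-L) L)" unfolding trace_seg by (rule imageI) (use L in auto)
      moreover have "pt d t L \<notin> Q k"
      proof
        assume "pt d t L \<in> Q k"
        then have "norm (pt d t L) < L" using L(2) k by blast
        then show False using coord_le_dist[of "\<not> d" "pt d t L" 0] L(1) by (simp add: dist_norm)
      qed
      moreover have "connected (trace (seg d t (-L) L))"
        using L(1) by (intro connected_trace is_cpath_seg) simp
      ultimately have "trace (seg d t (-L) L) \<inter> frontier (Q k) \<noteq> {}"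
        using p by (intro connected_Int_frontier) auto
      then show ?thesis using tL t by blast
    qed
    obtain t z1 where t: "\<bar>t\<bar> < L" "seg True t (-L) L \<notin> \<Gamma>" "z1 \<in> trace (seg True t (-L) L)" "z1 \<in> frontier (Q i)"
      using hit[of i True] by blast
    obtain s z2 where s: "\<bar>s\<bar> < L" "seg False s (-L) L \<notin> \<Gamma>" "z2 \<in> trace (seg False s (-L) L)" "z2 \<in> frontier (Q j)"
      using hit[of j False] by blast
    let ?V = "seg True t (-L) L" and ?H = "seg False s (-L) L" and ?p = "Complex t s"
    have VH: "?V \<in> paths_in UNIV - \<Gamma>" "?H \<in> paths_in UNIV - \<Gamma>"
      using t(2) s(2) L(1) seg_in_paths[of "-L" L] by auto
    have pV: "?p \<in> trace ?V" "?p \<in> trace ?H" using t(1) s(1) by (auto simp: trace_seg pt_def image_iff)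
    have z: "z1 \<in> S" "z2 \<in> S" using t(4) s(4) frontier_subset by blast+
    have "u z1 = u z2"
    proof (cases "?p \<in> S")
      case True
      have "u z1 = u ?p" by (rule eq[OF VH(1)]) (use True t z pV in auto)
      also have "\<dots> = u z2" by (rule eq[OF VH(2)]) (use True s z pV in auto)
      finally show ?thesis .
    next
      case False
      then obtain k where k: "?p \<in> Q k" by (auto simp: carpet_eq)
      have con: "connected (trace ?V)" "connected (trace ?H)"
        using L(1) by (auto intro!: connected_trace is_cpath_seg)
      have "z1 \<notin> Q k" "z2 \<notin> Q k" using z by (auto simp: carpet_eq)
      then have "trace ?V \<inter> Q k \<noteq> {}" "trace ?V - Q k \<noteq> {}" "trace ?H \<inter> Q k \<noteq> {}" "trace ?H - Q k \<noteq> {}"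
        using k pV t(3) s(3) by blast+
      then have "trace ?V \<inter> frontier (Q k) \<noteq> {}" "trace ?H \<inter> frontier (Q k) \<noteq> {}"
        by (simp_all only: connected_Int_frontier[OF con(1)] connected_Int_frontier[OF con(2)] not_False_eq_True)
      then obtain w1 w2 where w: "w1 \<in> trace ?V" "w1 \<in> frontier (Q k)" "w2 \<in> trace ?H" "w2 \<in> frontier (Q k)"
        by blast
      have wS: "w1 \<in> S" "w2 \<in> S" using w frontier_subset by blast+
      have "u z1 = u w1" by (rule eq[OF VH(1)]) (use t z w wS in auto)
      also have "\<dots> = u w2" by (rule osc0[OF w(2,4)])
      also have "\<dots> = u z2" by (rule eq[OF VH(2)]) (use s z w wS in auto)
      finally show ?thesis .
    qed
    then show ?thesis using osc0[OF x t(4)] osc0[OF y s(4)] by simp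
  qed
  obtain x0 where x0: "x0 \<in> frontier (Q 0)" using frontier_nonempty by blast
  have "\<forall>k. \<forall>x\<in>frontier (Q k). u x = u x0" using same x0 by blast
  then show ?thesis using G(1) eq by blast
qed

section \<open>From the circles to all points of the carpet\<close>

context sobolev_function
begin

lemma seg_approach:
  assumes ab: "a < b" and co: "coherent (seg d t a b)" and null: "hausdorff_measure 1 (trace (seg d t a b) \<inter> S) = 0"
    and y: "y \<in> trace (seg d t a b)" "y \<in> carpet_interior UNIV Q"
  shows "approach y (seg d t a b)" "accessible UNIV Q g y"
proof -
  let ?\<beta> = "seg d t a b"
  have "accesses UNIV Q ?\<beta> ?\<beta> y"
    using y by (simp add: accesses_def carpet_interior_def)
  moreover have "?\<beta> \<in> good_paths UNIV Q g" by (rule seg_good_path[OF ab co null])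
  ultimately show "approach y ?\<beta>" "accessible UNIV Q g y"
    using approach_if_accesses unfolding accessible_def by blast+
qed

text \<open>This names the path picked by the choice operator in \<open>accessible_value\<close>.
  Only \<open>approach\<close> is retained of it, so values have to be compared between arbitrary
  approaching paths.\<close>

lemma accessible_value_approach:
  assumes "accessible UNIV Q g x"
  shows "\<exists>\<gamma>. approach x \<gamma> \<and> accessible_value UNIV Q g x = Liminf (disks_to Q \<gamma> x) (\<lambda>k. Mdisk g (Q k))"
proof -
  define \<gamma> where "\<gamma> = (SOME \<gamma>. \<exists>\<gamma>0\<in>good_paths UNIV Q g. accesses UNIV Q \<gamma>0 \<gamma> x)"
  have "\<exists>\<gamma>. \<exists>\<gamma>0\<in>good_paths UNIV Q g. accesses UNIV Q \<gamma>0 \<gamma> x" using assms unfolding accessible_def by blast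
  then have "\<exists>\<gamma>0\<in>good_paths UNIV Q g. accesses UNIV Q \<gamma>0 \<gamma> x" unfolding \<gamma>_def by (rule someI_ex)
  then have "approach x \<gamma>" using approach_if_accesses by blast
  moreover have "accessible_value UNIV Q g x = Liminf (disks_to Q \<gamma> x) (\<lambda>k. Mdisk g (Q k))"
    unfolding accessible_value_def Let_def \<gamma>_def ..
  ultimately show ?thesis by blast
qed

text \<open>By quasiroundness the disk contains a ball whose radius \<open>\<rho>\<close> is
  comparable to the length of segments that leave the disk. Among the vertical ones through this
  ball the length-area estimate finds a generic segment of small path sum. It has a point off all
  closed disks, so by \<open>P\<close> it meets a disk with maximum near \<open>c\<close>, and the
  maximum over \<open>Q k\<close> is close to that one.\<close>

lemma disks_near_value:
  assumes \<Gamma>: "carpet_modulus v UNIV Q \<Gamma> = 0"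
    and P: "\<And>d t a b y \<epsilon>. a < b \<Longrightarrow> seg d t a b \<notin> \<Gamma> \<Longrightarrow> coherent (seg d t a b) \<Longrightarrow>
      hausdorff_measure 1 (trace (seg d t a b) \<inter> S) = 0 \<Longrightarrow> y \<in> trace (seg d t a b) \<Longrightarrow> y \<in> carpet_interior UNIV Q \<Longrightarrow>
      \<epsilon> > 0 \<Longrightarrow> \<exists>l\<in>disks_meeting Q (trace (seg d t a b)). \<bar>disk_max l - c\<bar> \<le> \<epsilon>"
    and x: "x \<in> carpet_interior UNIV Q" and \<epsilon>2: "\<epsilon> > 0"
  shows "\<exists>r>0. \<forall>k. Q k \<subseteq> ball x r \<longrightarrow> \<bar>disk_max k - c\<bar> \<le> \<epsilon>"
proof -
  define e where "e = \<epsilon>/2"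
  have e: "e > 0" using \<epsilon>2 by (simp add: e_def)
  obtain \<Gamma>' where G: "\<forall>a b d. a < b \<longrightarrow> negligible {t. seg d t a b \<in> \<Gamma>' \<or> hausdorff_measure 1 (trace (seg d t a b) \<inter> S) \<noteq> 0}"
    "\<forall>a b d t. a < b \<longrightarrow> seg d t a b \<notin> \<Gamma>' \<longrightarrow> coherent (seg d t a b)"
    using negligible_not_generic by (elim exE conjE)
  obtain K0 where K0: "K0 \<ge> 1" "\<forall>i. \<exists>x r R. 0 < r \<and> R / r \<le> K0 \<and> ball x r \<subseteq> Q i \<and> Q i \<subseteq> ball x R"
    using round_disks by blast
  \<comment> \<open>In a ball of radius \<open>4 * R2\<close> the bad parameters then have measure
    at most \<open>R2 / K0 \<le> \<rho>\<close>, half of the window of width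
    \<open>2 * \<rho>\<close>.\<close>
  define \<eta> where "\<eta> = e / (4 * K0 * sqrt fatness)"
  have \<eta>: "\<eta> > 0" using e fatness(1) K0(1) by (simp add: \<eta>_def)
  then have "\<eta>\<^sup>2 > 0" by simp
  then have "\<exists>r>0. r \<le> 1 \<and> (\<forall>F. finite F \<longrightarrow> F \<subseteq> disks_meeting Q (ball x r) \<longrightarrow> (\<Sum>k\<in>F. (disk_osc k)\<^sup>2) \<le> \<eta>\<^sup>2)"
    by (intro small_energy_near[OF x disk_osc_summable]) simp_all
  then obtain r where r: "r > 0" "\<And>F. finite F \<Longrightarrow> F \<subseteq> disks_meeting Q (ball x r) \<Longrightarrow> (\<Sum>k\<in>F. (disk_osc k)\<^sup>2) \<le> \<eta>\<^sup>2"
    by blast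
  \<comment> \<open>As \<open>\<rho> \<le> \<delta>\<close> and \<open>R2 \<le> K0 * \<rho>\<close>,
    the ball of radius \<open>4 * R2\<close> about the centre of the disk stays in
    \<open>ball x r\<close>, by
    \<open>\<delta> + 4 * K0 * \<delta> \<le> 5 * K0 * \<delta>\<close>.\<close>
  define \<delta> where "\<delta> = r / (5 * K0)"
  have \<delta>: "\<delta> > 0" "5 * (K0 * \<delta>) = r" using r(1) K0(1) by (auto simp: \<delta>_def)
  have main: "\<bar>disk_max k - c\<bar> \<le> \<epsilon>" if k: "Q k \<subseteq> ball x \<delta>" for k
  proof -
    obtain z \<rho> R where zr: "0 < \<rho>" "R / \<rho> \<le> K0" "ball z \<rho> \<subseteq> Q k" "Q k \<subseteq> ball z R" using K0(2) by blast
    define R2 where "R2 = max R \<rho>"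
    have R2: "R2 > 0" "R \<le> R2" "\<rho> \<le> R2" "R2 \<le> K0 * \<rho>"
    proof -
      have "R \<le> K0 * \<rho>" using zr(1,2) by (simp add: pos_divide_le_eq)
      moreover have "1 * \<rho> \<le> K0 * \<rho>" using zr(1) K0(1) by (intro mult_right_mono) auto
      ultimately show "R2 \<le> K0 * \<rho>" by (simp add: R2_def)
    qed (use zr(1) in \<open>auto simp: R2_def\<close>)
    have "ball z \<rho> \<subseteq> ball x \<delta>" using zr(3) k by blast
    then have zx: "dist z x + \<rho> \<le> \<delta>" using zr(1) by (simp add: ball_subset_ball_iff)
    have "K0 * \<rho> \<le> K0 * \<delta>" using zx K0(1) zero_le_dist[of z x] by (intro mult_left_mono) linarith+
    moreover have "1 * \<delta> \<le> K0 * \<delta>" using \<delta>(1) K0(1) by (intro mult_right_mono) auto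
    ultimately have "dist z x + 4 * R2 \<le> r" using zx R2(4) \<delta>(2) zr(1) by linarith
    then have ballz: "ball z (4 * R2) \<subseteq> ball x r" by (simp add: ball_subset_ball_iff)
    let ?a = "Im z - 2 * R2" and ?b = "Im z + 2 * R2"
    have ab: "?a < ?b" using R2(1) by simp
    let ?B = "{t. seg True t ?a ?b \<in> \<Gamma>' \<or> hausdorff_measure 1 (trace (seg True t ?a ?b) \<inter> S) \<noteq> 0}"
    let ?N = "?B \<union> {t. seg True t ?a ?b \<in> \<Gamma>}"
    have neg: "negligible ?N"
      using G(1)[rule_format, OF ab] negligible_seg_null[OF \<Gamma> ab] by (rule negligible_Un)
    have inside: "pt True t s \<in> ball z (4 * R2)" if "t \<in> {Re z - \<rho><..<Re z + \<rho>}" "s \<in> {?a..?b}" for t s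
    proof -
      have "\<bar>Re z - t\<bar> < R2" "\<bar>Im z - s\<bar> \<le> 2 * R2" using that R2 by auto
      then show ?thesis using dist_le_coords[of z "pt True t s" True] R2(1) by (simp add: coord_def pt_def)
    qed
    have energy: "(\<Sum>k\<in>F. (disk_osc k)\<^sup>2) \<le> \<eta>\<^sup>2" if F: "finite F" "F \<subseteq> disks_meeting Q (ball z (4 * R2))" for F
      using F(2) disks_meeting_mono[OF ballz, of Q] by (intro r(2)[OF F(1)]) blast
    have eq: "sqrt fatness * (4 * R2) * \<eta> / e = R2 / K0" using e fatness(1) K0(1) by (simp add: \<eta>_def)
    have small: "sqrt fatness * (4 * R2) * \<eta> / e < Re z + \<rho> - (Re z - \<rho>)"
    proof -
      have "R2 / K0 \<le> \<rho>" using R2(4) K0(1) by (simp add: pos_divide_le_eq mult.commute)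
      then show ?thesis unfolding eq using zr(1) by linarith
    qed
    have R: "0 < 4 * R2" "Re z + \<rho> - (Re z - \<rho>) \<le> 2 * (4 * R2)" "Re z - \<rho> \<le> Re z + \<rho>" "0 \<le> \<eta>"
      using R2 zr(1) \<eta> by linarith+
    have "\<exists>t\<in>{Re z - \<rho><..<Re z + \<rho>}. t \<notin> ?N \<and> path_sum Q disk_osc (seg True t ?a ?b) < ennreal e"
      by (rule pick_segment[where x=z and d=True and R="4 * R2" and \<rho>=disk_osc and \<eta>=\<eta>]; (fact | rule disk_osc_nonneg))
    then obtain t where t: "t \<in> {Re z - \<rho><..<Re z + \<rho>}" "t \<notin> ?N" "path_sum Q disk_osc (seg True t ?a ?b) < ennreal e"
      by blast
    let ?\<beta> = "seg True t ?a ?b"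
    have co: "coherent ?\<beta>" and null: "hausdorff_measure 1 (trace ?\<beta> \<inter> S) = 0" and nG: "?\<beta> \<notin> \<Gamma>"
      using t(2) G(2)[rule_format, OF ab] by blast+
    have kin: "k \<in> disks_meeting Q (trace ?\<beta>)"
    proof -
      have "dist z (pt True t (Im z)) < \<rho>" using dist_le_coords[of z "pt True t (Im z)" True] t(1)
        by (auto simp: coord_def pt_def)
      then have "pt True t (Im z) \<in> Q k" using zr(3) by auto
      moreover have "pt True t (Im z) \<in> trace ?\<beta>" unfolding trace_seg by (rule imageI) (use R2(1) in auto)
      ultimately show ?thesis by (auto simp: disks_meeting_def)
    qed
    have "pt True t ?b \<notin> closure (Q k)"
    proof
      assume "pt True t ?b \<in> closure (Q k)"
      moreover have "closure (Q k) \<subseteq> cball z R"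
        using zr(4) by (meson ball_subset_cball closed_cball closure_minimal order_trans)
      ultimately have "dist z (pt True t ?b) \<le> R" by auto
      moreover have "2 * R2 \<le> dist z (pt True t ?b)"
        using coord_le_dist[of False z "pt True t ?b"] R2(1) by (simp add: coord_def pt_def)
      ultimately show False using R2(1,2) by linarith
    qed
    then obtain y where y: "y \<in> trace ?\<beta>" "y \<in> carpet_interior UNIV Q"
      using seg_meets_carpet_interior[OF less_imp_le[OF ab] kin, of ?b] ab by auto
    obtain l where l: "l \<in> disks_meeting Q (trace ?\<beta>)" "\<bar>disk_max l - c\<bar> \<le> e"
      using P[OF ab nG co null y e] by blast
    have "\<bar>disk_max k - disk_max l\<bar> \<le> e"
      by (rule generic_seg_diff[of e ?\<beta>])
         (use co null t(3) kin l(1) e is_cpath_seg[OF less_imp_le[OF ab]] in \<open>auto simp: generic_seg_def\<close>)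
    then have "\<bar>disk_max k - c\<bar> \<le> 2 * e" using l(2) by linarith
    then show ?thesis by (simp add: e_def)
  qed
  then show ?thesis using \<delta>(1) by blast
qed

text \<open>The carpet has empty interior, so small disks come arbitrarily close to
  \<open>x\<close>. A generic segment through such a disk leaves its closure and therefore contains
  a point off all closed disks, which it makes accessible.\<close>

lemma accessible_dense:
  assumes x: "x \<in> carpet_interior UNIV Q" and e: "e > 0"
  shows "\<exists>y. accessible UNIV Q g y \<and> dist y x < e"
proof -
  obtain \<Gamma>' where G: "\<forall>a b d. a < b \<longrightarrow> negligible {t. seg d t a b \<in> \<Gamma>' \<or> hausdorff_measure 1 (trace (seg d t a b) \<inter> S) \<noteq> 0}"
    "\<forall>a b d t. a < b \<longrightarrow> seg d t a b \<notin> \<Gamma>' \<longrightarrow> coherent (seg d t a b)"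
    using negligible_not_generic by (elim exE conjE)
  have e8: "e/8 > 0" using e by simp
  obtain r' where r': "r' > 0" "\<forall>k. Q k \<inter> ball x r' \<noteq> {} \<longrightarrow> Q k \<subseteq> ball x (e/8)"
    using disks_near_small[OF x e8] by blast
  have "\<not> ball x r' \<subseteq> S"
  proof
    assume "ball x r' \<subseteq> S"
    then have "ball x r' \<subseteq> interior S" by (rule interior_maximal) simp
    then show False using rel_carpet r'(1) by (auto simp: relative_sierpinski_carpet_def)
  qed
  then obtain z k where z: "z \<in> Q k" "z \<in> ball x r'" by (auto simp: carpet_eq)
  then have kb: "Q k \<subseteq> ball x (e/8)" using r'(2) by blast
  obtain \<rho> where \<rho>: "\<rho> > 0" "ball z \<rho> \<subseteq> Q k" using Q_open z(1) openE by blast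
  \<comment> \<open>The disk lies in \<open>ball x (e/8)\<close>. The half-length \<open>e/2\<close>
    is enough to leave it and keeps the segment within distance \<open>e\<close> of
    \<open>x\<close>.\<close>
  let ?a = "Im z - e/2" and ?b = "Im z + e/2"
  have ab: "?a < ?b" using e by simp
  obtain t where t: "Re z - \<rho> < t" "t < Re z + \<rho>"
    "t \<notin> {t. seg True t ?a ?b \<in> \<Gamma>' \<or> hausdorff_measure 1 (trace (seg True t ?a ?b) \<inter> S) \<noteq> 0}"
    using not_negligible_interval[OF _ G(1)[rule_format, OF ab, of True], of "Re z - \<rho>" "Re z + \<rho>"] \<rho>(1) by auto
  let ?\<beta> = "seg True t ?a ?b" and ?p = "pt True t (Im z)"
  have co: "coherent ?\<beta>" and null: "hausdorff_measure 1 (trace ?\<beta> \<inter> S) = 0"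
    using t(3) G(2)[rule_format, OF ab] by blast+
  have "dist z ?p < \<rho>" using dist_le_coords[of z ?p True] t(1,2) by (simp add: coord_def pt_def)
  then have p: "?p \<in> Q k" using \<rho> by auto
  have kin: "k \<in> disks_meeting Q (trace ?\<beta>)" 
  proof -
    have "?p \<in> trace ?\<beta>" unfolding trace_seg by (rule imageI) (use e in auto)
    then show ?thesis using p by (auto simp: disks_meeting_def)
  qed
  have px: "dist x ?p < e/8" using p kb by auto
  have "pt True t ?b \<notin> closure (Q k)"
  proof
    assume "pt True t ?b \<in> closure (Q k)"
    moreover have "closure (Q k) \<subseteq> cball x (e/8)"
      using kb by (meson ball_subset_cball closed_cball closure_minimal order_trans)
    ultimately have "dist x (pt True t ?b) \<le> e/8" by auto
    moreover have "dist ?p (pt True t ?b) = e/2" using e by (simp add: dist_pt)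
    ultimately show False using dist_triangle2[of ?p "pt True t ?b" x] px e by (simp add: dist_commute)
  qed
  then obtain y where y: "y \<in> trace ?\<beta>" "y \<in> carpet_interior UNIV Q"
    using seg_meets_carpet_interior[OF less_imp_le[OF ab] kin, of ?b] ab by auto
  have "accessible UNIV Q g y" by (rule seg_approach(2)[OF ab co null y])
  moreover have "dist y x < e"
  proof -
    obtain s where s: "s \<in> {?a..?b}" "y = pt True t s" using y(1) by (auto simp: trace_seg)
    have "Im z - e/2 \<le> s" "s \<le> Im z + e/2" using s(1) by auto
    then have "\<bar>s - Im z\<bar> \<le> e/2" by linarith
    then have "dist y ?p \<le> e/2" unfolding s(2) dist_pt .
    then show ?thesis using dist_triangle[of y x ?p] px e by (simp add: dist_commute)
  qed
  ultimately show ?thesis by blast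
qed

theorem normalized_version_constant:
  assumes ug: "upper_gradient v UNIV Q (\<lambda>_. 0) (\<lambda>x. ereal (u x))"
    and osc0: "\<And>k x y. x \<in> frontier (Q k) \<Longrightarrow> y \<in> frontier (Q k) \<Longrightarrow> u x = u y"
    and norm: "\<And>x. x \<in> S \<Longrightarrow> ereal (u x) = normalized_version UNIV Q g x"
  shows "\<exists>c. \<forall>x\<in>S. u x = c"
proof -
  have "\<exists>c \<Gamma>. carpet_modulus v UNIV Q \<Gamma> = 0 \<and> (\<forall>k. \<forall>x\<in>frontier (Q k). u x = c) \<and>
    (\<forall>\<gamma>\<in>paths_in UNIV - \<Gamma>. \<forall>x\<in>trace \<gamma> \<inter> S. \<forall>y\<in>trace \<gamma> \<inter> S. u x = u y)"
    by (rule constant_on_frontiers[OF ug]) (erule osc0, assumption)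
  then obtain c \<Gamma> where \<Gamma>: "carpet_modulus v UNIV Q \<Gamma> = 0" and "\<forall>k. \<forall>x\<in>frontier (Q k). u x = c"
    and "\<forall>\<gamma>\<in>paths_in UNIV - \<Gamma>. \<forall>x\<in>trace \<gamma> \<inter> S. \<forall>y\<in>trace \<gamma> \<inter> S. u x = u y"
    by (elim exE conjE)
  then have c: "\<And>k x. x \<in> frontier (Q k) \<Longrightarrow> u x = c"
    and eq: "\<And>\<gamma> x y. \<gamma> \<in> paths_in UNIV - \<Gamma> \<Longrightarrow> x \<in> trace \<gamma> \<inter> S \<Longrightarrow> y \<in> trace \<gamma> \<inter> S \<Longrightarrow> u x = u y"
    by blast+
  have intS: "x \<in> S" if "x \<in> carpet_interior UNIV Q" for x using that by (simp add: carpet_interior_def)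
  \<comment> \<open>On a generic segment \<open>u\<close> is constant on the carpet, with value
    \<open>c\<close> because the segment crosses a circle. At \<open>y\<close> this value is the
    liminf of \<open>g\<close> along the chosen path, and the comparison of approaching paths
    carries it to the segment.\<close>
  have P: "\<exists>l\<in>disks_meeting Q (trace (seg d t a b)). \<bar>disk_max l - c\<bar> \<le> \<epsilon>"
    if ab: "a < b" and nG: "seg d t a b \<notin> \<Gamma>" and co: "coherent (seg d t a b)"
      and null: "hausdorff_measure 1 (trace (seg d t a b) \<inter> S) = 0"
      and y: "y \<in> trace (seg d t a b)" "y \<in> carpet_interior UNIV Q" and \<epsilon>: "\<epsilon> > 0" for d t a b y \<epsilon>
  proof -
    let ?\<beta> = "seg d t a b"
    have ap: "approach y ?\<beta>" and acc: "accessible UNIV Q g y" using seg_approach[OF ab co null y] by auto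
    obtain k z where kz: "z \<in> Q k" "z \<in> trace ?\<beta>" using approach_meets_disks[OF ap zero_less_one] by blast
    have yS: "y \<in> S" using y(2) by (rule intS)
    then have "y \<notin> Q k" by (rule notin_disk)
    moreover have "connected (trace ?\<beta>)" using ab by (intro connected_trace is_cpath_seg) simp
    ultimately have "trace ?\<beta> \<inter> frontier (Q k) \<noteq> {}" using kz y(1) by (intro connected_Int_frontier) auto
    then obtain w where w: "w \<in> trace ?\<beta>" "w \<in> frontier (Q k)" by blast
    have path: "?\<beta> \<in> paths_in UNIV - \<Gamma>" using nG ab seg_in_paths[of a b] by simp
    have "u y = u w" by (rule eq[OF path]) (use y(1) yS w frontier_subset in auto)
    then have uy: "u y = c" using c[OF w(2)] by simp
    obtain \<gamma> where \<gamma>: "approach y \<gamma>" "accessible_value UNIV Q g y = Liminf (disks_to Q \<gamma> y) (\<lambda>k. Mdisk g (Q k))"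
      using accessible_value_approach[OF acc] by blast
    have "ereal (u y) = accessible_value UNIV Q g y" using norm[OF yS] acc by (simp add: normalized_version_def)
    then have "Liminf (disks_to Q \<gamma> y) (\<lambda>k. Mdisk g (Q k)) = ereal c" using \<gamma>(2) uy by simp
    then show ?thesis by (rule approach_limit_unique[OF \<gamma>(1) ap y(2) \<epsilon>])
  qed
  \<comment> \<open>The statement about all disks near \<open>x\<close> applies to whatever path was
    chosen at \<open>x\<close>.\<close>
  have acc_int: "accessible_value UNIV Q g x = ereal c"
    if acc: "accessible UNIV Q g x" and x: "x \<in> carpet_interior UNIV Q" for x
  proof -
    obtain \<gamma> where \<gamma>: "approach x \<gamma>" "accessible_value UNIV Q g x = Liminf (disks_to Q \<gamma> x) (\<lambda>k. Mdisk g (Q k))"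
      using accessible_value_approach[OF acc] by blast
    have "Liminf (disks_to Q \<gamma> x) (\<lambda>k. Mdisk g (Q k)) = ereal c"
    proof (rule Liminf_disks_to[OF \<gamma>(1) x])
      fix \<epsilon> :: real assume \<epsilon>: "\<epsilon> > 0"
      have "\<exists>r>0. \<forall>k. Q k \<subseteq> ball x r \<longrightarrow> \<bar>disk_max k - c\<bar> \<le> \<epsilon>"
        by (rule disks_near_value[OF \<Gamma> _ x \<epsilon>]) (rule P; assumption)
      then show "\<exists>r>0. \<forall>k\<in>disks_meeting Q (trace \<gamma>). Q k \<subseteq> ball x r \<longrightarrow> \<bar>disk_max k - c\<bar> \<le> \<epsilon>" by blast
    qed
    then show ?thesis using \<gamma>(2) by simp
  qed
  have accS: "x \<in> S" if "accessible UNIV Q g x" for x using that by (auto simp: accessible_def accesses_def)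
  \<comment> \<open>On the circles \<open>u\<close> is already known, and normalization identifies
    it with the accessible value. Both kinds of points are needed, as the liminf at a non-accessible
    point runs over all accessible points.\<close>
  have acc_all: "accessible_value UNIV Q g x = ereal c" if acc: "accessible UNIV Q g x" for x
  proof (cases "x \<in> carpet_interior UNIV Q")
    case False
    then obtain k where "x \<in> frontier (Q k)" using accS[OF acc] by (auto simp: carpet_interior_def)
    then have "u x = c" by (rule c)
    then show ?thesis using norm[OF accS[OF acc]] acc by (simp add: normalized_version_def)
  qed (rule acc_int[OF acc])
  have "u x = c" if xS: "x \<in> S" for x
  proof (cases "\<exists>k. x \<in> frontier (Q k)")
    case True
    then show ?thesis using c by blast
  next
    case nf: False
    then have xi: "x \<in> carpet_interior UNIV Q" using xS by (simp add: carpet_interior_def)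
    show ?thesis
    proof (cases "accessible UNIV Q g x")
      case True
      then show ?thesis using norm[OF xS] acc_all[OF True] by (simp add: normalized_version_def)
    next
      case False
      \<comment> \<open>Density of the accessible points makes this filter nontrivial; on the
        trivial filter the liminf of a constant would be infinite.\<close>
      let ?F = "at x within {y. accessible UNIV Q g y}"
      have "x islimpt {y. accessible UNIV Q g y}"
        unfolding islimpt_approachable
      proof (intro allI impI)
        fix e :: real assume "e > 0"
        then obtain y where y: "accessible UNIV Q g y" "dist y x < e" using accessible_dense[OF xi] by blast
        then have "y \<noteq> x" using False by blast
        then show "\<exists>x'\<in>{y. accessible UNIV Q g y}. x' \<noteq> x \<and> dist x' x < e" using y by blast
      qed
      then have nt: "?F \<noteq> bot" by (simp add: trivial_limit_within)
      have "Liminf ?F (accessible_value UNIV Q g) = Liminf ?F (\<lambda>_. ereal c)"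
        using acc_all by (intro Liminf_eq) (simp add: eventually_at_filter)
      also have "\<dots> = ereal c" by (rule Liminf_const[OF nt])
      finally show ?thesis using norm[OF xS] False nf by (simp add: normalized_version_def)
    qed
  qed
  then show ?thesis by blast
qed

end

theorem theorem2p74:
  fixes Q :: "nat \<Rightarrow> complex set" and u :: "complex \<Rightarrow> real" and v :: modulus_version
  assumes "relative_sierpinski_carpet UNIV Q"
    and "carpet_harmonic v UNIV Q (\<lambda>x. ereal (u x))"
    and "normalized v UNIV Q (\<lambda>x. ereal (u x))"
    and "bounded (u ` carpet UNIV Q)"
  shows "u constant_on carpet UNIV Q"
proof -
  interpret planar_carpet Q by unfold_locales (rule assms(1))
  obtain M where M: "\<And>x. x \<in> S \<Longrightarrow> \<bar>u x\<bar> \<le> M" using assms(4) by (auto simp: bounded_iff)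
  have ro0: "real_osc u k = 0" for k by (rule harmonic_oscillation_zero[OF assms(2) M])
  have bu: "bounded (u ` frontier (Q k))" for k
    by (rule bounded_subset[OF assms(4)]) (use frontier_subset in blast)
  have uW: "(\<lambda>x. ereal (u x)) \<in> W12_loc v UNIV Q" using assms(2) by (simp add: carpet_harmonic_def)
  have "real_osc u = (\<lambda>_. 0)" using ro0 by auto
  then have ug: "upper_gradient v UNIV Q (\<lambda>_. 0) (\<lambda>x. ereal (u x))" using W12_locD(2)[OF uW bu] by simp
  have osc0: "u x = u y" if "x \<in> frontier (Q k)" "y \<in> frontier (Q k)" for k x y
    using real_osc_upper[OF bu that] ro0[of k] by simp
  obtain g where gW: "g \<in> W12_loc v UNIV Q" and un: "\<And>x. x \<in> S \<Longrightarrow> ereal (u x) = normalized_version UNIV Q g x"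
    using assms(3) unfolding normalized_def by blast
  interpret sobolev_function Q v g by unfold_locales (rule gW)
  have "\<exists>c. \<forall>x\<in>S. u x = c"
    by (rule normalized_version_constant[OF ug]) (erule osc0, assumption, erule un)
  then show ?thesis by (simp add: constant_on_def)
qed

end
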